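(* Let $\mathcal{P}$ be $Q(2d,q)$, or $W(2d-1,q)$ with $q$ even. Let $(Y,Z)$ be a cross-intersecting EKR set of generators of $\mathcal{P}$ of maximum size. Then either $Y=Z$ and $Y$ is an EKR set, or $d$ is even and $Y\cup Z$ is the set of generators of a subgeometry of $\mathcal{P}$ isomorphic to $Q^+(2d-1,q)$.
   Context: All dimensions are vector space dimensions. $Q(2d,q)$ (parabolic quadric), $W(2d-1,q)$ (symplectic polar space) and $Q^+(2d-1,q)$ (hyperbolic quadric) are the finite classical polar spaces of rank $d$ in projective spaces over $\mathbb{F}_q$ of the indicated projective dimension; generators are the totally isotropic/singular subspaces of the maximal dimension $d$. A cross-intersecting EKR set of generators is a pair $(Y,Z)$ of sets of generators such that every $y\in Y$ and $z\in Z$ satisfy $\dim(y\cap z)\ge1$; it is of maximum size if $|Y|\cdot|Z|$ is maximum among all cross-intersecting EKR sets of the polar space. An EKR set is a set of generators pairwise intersecting in at least a point. For $Q(2d,q)$, a subgeometry isomorphic to $Q^+(2d-1,q)$ is the intersection of $Q(2d,q)$ with a hyperplane of $\mathrm{PG}(2d,q)$ that meets it in a hyperbolic quadric; for $q$ even, $W(2d-1,q)$ is isomorphic to $Q(2d,q)$ and such subgeometries of $W(2d-1,q)$ are those corresponding to these under the isomorphism. *)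

theory Defs
  imports "HOL-Analysis.Analysis"
begin

text \<open>
  The field of order q is a type 'a of class field and finite, with q = CARD('a). A polar space
  is represented by the set of all its subspaces (totally singular, respectively totally
  isotropic), as linear subspaces of 'a^'n; the zero subspace is included. All dimensions are
  vector space dimensions.
\<close>

definition bilinear_form :: "('a::field^'n \<Rightarrow> 'a^'n \<Rightarrow> 'a) \<Rightarrow> bool" where
  "bilinear_form B \<longleftrightarrow>
     (\<forall>v. Vector_Spaces.linear (*s) (*) (\<lambda>w. B v w)) \<and>
     (\<forall>w. Vector_Spaces.linear (*s) (*) (\<lambda>v. B v w))"

definition polar_form :: "('a::field^'n \<Rightarrow> 'a) \<Rightarrow> 'a^'n \<Rightarrow> 'a^'n \<Rightarrow> 'a" where
  "polar_form Q v w = Q (v + w) - Q v - Q w"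

definition quadratic_form :: "('a::field^'n \<Rightarrow> 'a) \<Rightarrow> bool" where
  "quadratic_form Q \<longleftrightarrow> (\<forall>c v. Q (c *s v) = c\<^sup>2 * Q v) \<and> bilinear_form (polar_form Q)"

text \<open>
  In characteristic 2 the polar form of a nonsingular form on an odd-dimensional space has a
  one-dimensional radical (the nucleus); nonsingularity only demands that the quadratic form has
  no nonzero zero on the radical.
\<close>

definition nonsingular_on :: "('a::field^'n) set \<Rightarrow> ('a^'n \<Rightarrow> 'a) \<Rightarrow> bool" where
  "nonsingular_on U Q \<longleftrightarrow> (\<forall>v\<in>U. Q v = 0 \<and> (\<forall>w\<in>U. polar_form Q v w = 0) \<longrightarrow> v = 0)"

definition totally_singular_subspaces ::
    "('a::field^'n) set \<Rightarrow> ('a^'n \<Rightarrow> 'a) \<Rightarrow> ('a^'n) set set" where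
  "totally_singular_subspaces U Q = {S. vec.subspace S \<and> S \<subseteq> U \<and> (\<forall>v\<in>S. Q v = 0)}"

definition totally_isotropic_subspaces ::
    "('a::field^'n \<Rightarrow> 'a^'n \<Rightarrow> 'a) \<Rightarrow> ('a^'n) set set" where
  "totally_isotropic_subspaces B = {S. vec.subspace S \<and> (\<forall>v\<in>S. \<forall>w\<in>S. B v w = 0)}"

definition polar_rank :: "('a::{field,finite}^'n) set set \<Rightarrow> nat" where
  "polar_rank P = Max (vec.dim ` P)"

definition generators :: "('a::{field,finite}^'n) set set \<Rightarrow> ('a^'n) set set" where
  "generators P = {S \<in> P. vec.dim S = polar_rank P}"

text \<open>\<open>Q(2d,q)\<close>; over a finite field its rank is automatically \<open>d\<close>.\<close>

definition parabolic_quadric :: "nat \<Rightarrow> ('a::{field,finite}^'n) set set \<Rightarrow> bool" where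
  "parabolic_quadric d P \<longleftrightarrow> CARD('n) = 2 * d + 1 \<and>
     (\<exists>Q. quadratic_form Q \<and> nonsingular_on UNIV Q \<and> P = totally_singular_subspaces UNIV Q)"

text \<open>\<open>W(2d-1,q)\<close>; its rank is automatically \<open>d\<close>.\<close>

definition symplectic_polar_space :: "nat \<Rightarrow> ('a::{field,finite}^'n) set set \<Rightarrow> bool" where
  "symplectic_polar_space d P \<longleftrightarrow> CARD('n) = 2 * d \<and>
     (\<exists>B. bilinear_form B \<and> (\<forall>v. B v v = 0) \<and> (\<forall>v. (\<forall>w. B v w = 0) \<longrightarrow> v = 0) \<and>
          P = totally_isotropic_subspaces B)"

text \<open>
  \<open>Q\<^sup>+(2d-1,q)\<close> in the projective space of the 2d-dimensional space \<open>U\<close>. The rank condition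
  separates it from the elliptic quadric, whose rank is \<open>d - 1\<close>.
\<close>

definition hyperbolic_quadric_in ::
    "nat \<Rightarrow> ('a::{field,finite}^'n) set \<Rightarrow> ('a^'n) set set \<Rightarrow> bool" where
  "hyperbolic_quadric_in d U G \<longleftrightarrow> vec.subspace U \<and> vec.dim U = 2 * d \<and>
     (\<exists>Q. quadratic_form Q \<and> nonsingular_on U Q \<and> G = totally_singular_subspaces U Q) \<and>
     polar_rank G = d"

definition hyperbolic_section ::
    "nat \<Rightarrow> ('a::{field,finite}^'n) set set \<Rightarrow> ('a^'n) set set \<Rightarrow> bool" where
  "hyperbolic_section d P G \<longleftrightarrow>
     (\<exists>H. vec.subspace H \<and> vec.dim H + 1 = CARD('n) \<and>
          G = {S \<in> P. S \<subseteq> H} \<and> hyperbolic_quadric_in d H G)"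

text \<open>
  An isomorphism of polar spaces that is induced by a linear map of the underlying vector spaces.
  For even q the isomorphism from \<open>Q(2d,q)\<close> to \<open>W(2d-1,q)\<close> is of this kind: it is the
  projection from the nucleus.
\<close>

definition linear_polar_iso ::
    "('a::field^'m \<Rightarrow> 'a^'n) \<Rightarrow> ('a^'m) set set \<Rightarrow> ('a^'n) set set \<Rightarrow> bool" where
  "linear_polar_iso f P P' \<longleftrightarrow> Vector_Spaces.linear (*s) (*s) f \<and>
     bij_betw (\<lambda>S. f ` S) P P' \<and> (\<forall>S\<in>P. \<forall>T\<in>P. S \<subseteq> T \<longleftrightarrow> f ` S \<subseteq> f ` T)"

text \<open>
  The subgeometries of \<open>P\<close> isomorphic to \<open>Q\<^sup>+(2d-1,q)\<close>, for \<open>P = Q(2d,q)\<close> and for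
  \<open>P = W(2d-1,q)\<close> with q even. In the second case \<open>P\<close> lives in dimension 2d = CARD('n), and
  the index type 'n option provides the space of dimension 2d + 1 that carries \<open>Q(2d,q)\<close>.
\<close>

definition hyperbolic_subgeometry ::
    "nat \<Rightarrow> ('a::{field,finite}^'n) set set \<Rightarrow> ('a^'n) set set \<Rightarrow> bool" where
  "hyperbolic_subgeometry d P G \<longleftrightarrow>
     parabolic_quadric d P \<and> hyperbolic_section d P G \<or>
     even CARD('a) \<and> symplectic_polar_space d P \<and>
     (\<exists>(f :: 'a^('n option) \<Rightarrow> 'a^'n) P\<^sub>0 G\<^sub>0.
        parabolic_quadric d P\<^sub>0 \<and> linear_polar_iso f P\<^sub>0 P \<and>
        hyperbolic_section d P\<^sub>0 G\<^sub>0 \<and> G = (\<lambda>S. f ` S) ` G\<^sub>0)"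

definition EKR_set :: "('a::{field,finite}^'n) set set \<Rightarrow> ('a^'n) set set \<Rightarrow> bool" where
  "EKR_set P Y \<longleftrightarrow> Y \<subseteq> generators P \<and> (\<forall>y\<in>Y. \<forall>z\<in>Y. vec.dim (y \<inter> z) \<ge> 1)"

definition cross_EKR ::
    "('a::{field,finite}^'n) set set \<Rightarrow> ('a^'n) set set \<Rightarrow> ('a^'n) set set \<Rightarrow> bool" where
  "cross_EKR P Y Z \<longleftrightarrow> Y \<subseteq> generators P \<and> Z \<subseteq> generators P \<and>
     (\<forall>y\<in>Y. \<forall>z\<in>Z. vec.dim (y \<inter> z) \<ge> 1)"

definition max_cross_EKR ::
    "('a::{field,finite}^'n) set set \<Rightarrow> ('a^'n) set set \<Rightarrow> ('a^'n) set set \<Rightarrow> bool" where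
  "max_cross_EKR P Y Z \<longleftrightarrow> cross_EKR P Y Z \<and>
     (\<forall>Y' Z'. cross_EKR P Y' Z' \<longrightarrow> card Y' * card Z' \<le> card Y * card Z)"

end

theory Submission
  imports Defs
begin

text \<open>
  Let \<open>A\<close> be the adjacency operator of the graph on the generators in which disjoint generators are
  joined. A pair \<open>(Y, Z)\<close> is cross-intersecting iff the indicator of \<open>Y\<close> is orthogonal to the image under
  \<open>A\<close> of the indicator of \<open>Z\<close>, so a bound for \<open>A\<close> on functions of sum zero bounds the product of the
  sizes, as in Hoffman's bound for cocliques.

  The eigenvalues of \<open>A\<close> come from a triangular form. Let the pencil of a totally singular subspace \<open>S\<close> of
  dimension \<open>t\<close> be the indicator of the generators through \<open>S\<close>. Its image under \<open>A\<close> is \<open>q\<close> to the power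
  \<open>(d - t + 1) choose 2\<close> times the indicator of the generators disjoint from \<open>S\<close>
  (\<open>card_opposite_above\<close>), and Moebius inversion over the subspaces of \<open>S\<close> turns this into a multiple of
  the pencil of \<open>S\<close> plus pencils of smaller subspaces (\<open>opp_pencil_lower\<close>). Since \<open>A\<close> is symmetric, its
  eigenvalues are \<open>(-1)\<^sup>t\<close> times \<open>q\<close> to the power \<open>((d - t + 1) choose 2) + (t choose 2)\<close>. For \<open>t \<ge> 1\<close> their
  absolute values are at most \<open>lam\<close>, which is \<open>q\<close> to the power \<open>d choose 2\<close>, with equality only for
  \<open>t = 1\<close> and \<open>t = d\<close>.

  The pencil of a point attains the resulting bound, so a maximum pair attains it too. Both sets then have
  the size of a point pencil, the difference of their indicators is an eigenvector for \<open>+lam\<close>, and the sum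
  is, up to an additive constant, an eigenvector for \<open>-lam\<close> (\<open>max_cross_cards\<close>, \<open>max_cross_opp\<close>). For odd \<open>d\<close> the
  eigenvalue \<open>+lam\<close> does not exist and \<open>Y = Z\<close>. For even \<open>d\<close> the difference is orthogonal to all pencils
  of subspaces of dimension less than \<open>d\<close>, so every such subspace lies on as many members of \<open>Y\<close> as of \<open>Z\<close>,
  and the sum is a combination of point pencils, which determines how many members of \<open>Y\<close> and \<open>Z\<close> are
  adjacent to a given generator, even within a residue (\<open>nbr_sum_identity\<close>).

  Let now \<open>d\<close> be even and \<open>g\<close> in \<open>Y - Z\<close>. These counts show that every hyperplane of \<open>g\<close> lies on exactly one
  further member of \<open>Y \<union> Z\<close>, its partner, which belongs to \<open>Z - Y\<close> (\<open>private_hyperplanes\<close>), and that in the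
  residue of a subspace of codimension 2 in \<open>g\<close> the two families form the two reguli of a grid
  (\<open>private_coline\<close>). The grids glue together: the union of the joins of \<open>g\<close> with its partners is a
  hyperplane \<open>H\<close> of the ambient space, and partners have the same hyperplane. As any two generators
  inside \<open>H\<close> are connected by adjacent generators inside \<open>H\<close>, all generators inside \<open>H\<close> belong to \<open>Y \<union> Z\<close>,
  and no other generator does (\<open>balanced_pair_hyperbolic\<close>).

  A symplectic space in characteristic 2 is the projection of a parabolic quadric from its nucleus
  (\<open>symplectic_from_parabolic\<close>), and this projection preserves dimensions of intersections.
\<close>

section \<open>Finite vector spaces and bilinear pairings\<close>

lemma card_span_independent:
  fixes B :: "('a::{field,finite}^'n) set"
  assumes "finite B" "vec.independent B"
  shows "card (vec.span B) = CARD('a) ^ card B"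
  using assms
proof (induction B rule: finite_induct)
  case empty
  then show ?case by (simp add: vec.span_empty)
next
  case (insert b B)
  have ind: "vec.independent B" and b: "b \<notin> vec.span B"
    using insert by (auto simp: vec.independent_insert)
  let ?f = "\<lambda>(c, v). c *s b + v"
  have span: "vec.span (insert b B) = ?f ` (UNIV \<times> vec.span B)"
  proof (intro equalityI subsetI)
    fix x assume "x \<in> vec.span (insert b B)"
    then obtain k where "x - k *s b \<in> vec.span B" by (auto simp: vec.span_insert)
    then show "x \<in> ?f ` (UNIV \<times> vec.span B)"
      by (intro image_eqI[of _ _ "(k, x - k *s b)"]) auto
  next
    fix x assume "x \<in> ?f ` (UNIV \<times> vec.span B)"
    then obtain k v where "x = k *s b + v" "v \<in> vec.span B" by auto
    then show "x \<in> vec.span (insert b B)"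
      by (auto simp: vec.span_insert intro!: exI[of _ k])
  qed
  have "inj_on ?f (UNIV \<times> vec.span B)"
  proof (clarsimp simp: inj_on_def)
    fix c v c' v'
    assume v: "v \<in> vec.span B" "v' \<in> vec.span B" and eq: "c *s b + v = c' *s b + v'"
    have diff: "(c - c') *s b = v' - v" using eq by (simp add: vec.scale_left_diff_distrib algebra_simps)
    have "c = c'"
    proof (rule ccontr)
      assume "c \<noteq> c'"
      then have "b = inverse (c - c') *s (v' - v)"
        unfolding diff[symmetric] vec.scale_scale by simp
      then show False using b v by (auto intro: vec.span_diff vec.span_scale)
    qed
    then show "c = c' \<and> v = v'" using eq by simp
  qed
  then show ?case
    using insert ind by (simp add: span card_image card_cartesian_product)
qed

lemma card_subspace:
  fixes S :: "('a::{field,finite}^'n) set"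
  assumes "vec.subspace S"
  shows "card S = CARD('a) ^ vec.dim S"
proof -
  obtain B where "B \<subseteq> S" "vec.independent B" "S \<subseteq> vec.span B" "card B = vec.dim S"
    using vec.basis_exists by blast
  moreover from this have "vec.span B = S"
    using assms by (simp add: vec.span_subspace)
  ultimately show ?thesis
    using card_span_independent[of B] by (simp add: vec.finiteI_independent)
qed

lemma card_field_gt_1: "1 < CARD('a::{field,finite})"
  using card_mono[of UNIV "{0, 1::'a}"] by simp

lemma dim_eq_iff_card:
  fixes S :: "('a::{field,finite}^'n) set"
  assumes "vec.subspace S"
  shows "vec.dim S = k \<longleftrightarrow> card S = CARD('a) ^ k"
  using card_subspace[OF assms] card_field_gt_1[where 'a = 'a] by simp

lemma subspace_nonzeroE:
  fixes S :: "('a::field^'n) set"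
  assumes "vec.subspace S" "vec.dim S \<ge> 1"
  obtains v where "v \<in> S" "v \<noteq> 0"
proof -
  have "\<not> S \<subseteq> {0}" using assms vec.dim_eq_0[of S] by force
  then show ?thesis using that by blast
qed

lemma subspace_eq_zero_iff:
  fixes S :: "('a::field^'n) set"
  assumes "vec.subspace S"
  shows "S = {0} \<longleftrightarrow> vec.dim S = 0"
  using assms vec.subspace_0 by (auto simp: vec.dim_eq_0)

lemma obtain_hyperplane:
  fixes T S :: "('a::field^'n) set"
  assumes "vec.subspace T" "S \<subseteq> T" "vec.subspace S" "vec.dim S \<le> k" "k \<le> vec.dim T"
  obtains H where "vec.subspace H" "S \<subseteq> H" "H \<subseteq> T" "vec.dim H = k"
proof -
  obtain B where B: "B \<subseteq> S" "vec.independent B" "S \<subseteq> vec.span B" "card B = vec.dim S"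
    using vec.basis_exists by blast
  obtain C where C: "B \<subseteq> C" "C \<subseteq> T" "vec.independent C" "T \<subseteq> vec.span C"
    using vec.maximal_independent_subset_extend[of B T] B assms by blast
  have fin: "finite C" using C vec.finiteI_independent by blast
  have cardC: "card C = vec.dim T" using C using vec.dim_eq_card_independent[OF C(3)] vec.span_subspace[OF C(2,4) assms(1)] vec.dim_span[of C] by simp
  obtain D where D: "B \<subseteq> D" "D \<subseteq> C" "card D = k"
    using exists_subset_between[of B k C] B C assms fin cardC by auto
  have "vec.independent D" using D C vec.independent_mono by blast
  then have "vec.dim (vec.span D) = k" using D by (simp add: vec.dim_eq_card_independent)
  moreover have "vec.span D \<subseteq> T" using D C assms by (meson vec.span_minimal order.trans)
  moreover have "S \<subseteq> vec.span D" using B D by (meson order.trans vec.span_mono)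
  ultimately show ?thesis using that[of "vec.span D"] by simp
qed

definition join :: "('a::field^'n) set \<Rightarrow> ('a^'n) set \<Rightarrow> ('a^'n) set" where
  "join S T = {x + y |x y. x \<in> S \<and> y \<in> T}"

lemma subspace_join: "vec.subspace S \<Longrightarrow> vec.subspace T \<Longrightarrow> vec.subspace (join S T)"
  unfolding join_def by (rule vec.subspace_sums)

lemma joinI: "x \<in> S \<Longrightarrow> y \<in> T \<Longrightarrow> x + y \<in> join S T"
  by (auto simp: join_def)

lemma joinE:
  assumes "v \<in> join S T"
  obtains x y where "x \<in> S" "y \<in> T" "v = x + y"
  using assms by (auto simp: join_def)

lemma join_left: "vec.subspace T \<Longrightarrow> S \<subseteq> join S T"
  using joinI[of _ S 0 T] by (auto dest: vec.subspace_0)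

lemma join_right: "vec.subspace S \<Longrightarrow> T \<subseteq> join S T"
  using joinI[of 0 S _ T] by (auto dest: vec.subspace_0)

lemma join_least: "vec.subspace U \<Longrightarrow> S \<subseteq> U \<Longrightarrow> T \<subseteq> U \<Longrightarrow> join S T \<subseteq> U"
  by (auto simp: join_def intro!: vec.subspace_add)

lemma dim_join:
  "vec.subspace S \<Longrightarrow> vec.subspace T \<Longrightarrow>
    vec.dim (join S T) + vec.dim (S \<inter> T) = vec.dim S + vec.dim T"
  unfolding join_def by (rule vec.dim_sums_Int)

lemma dim_strict_mono:
  fixes S T :: "('a::field^'n) set"
  assumes "vec.subspace S" "vec.subspace T" "S \<subset> T"
  shows "vec.dim S < vec.dim T"
  using assms vec.dim_psubset[of S T] by (metis vec.span_eq_iff)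

lemma dim_inter_hyperplane:
  fixes y H :: "('a::field^'n) set"
  assumes "vec.subspace y" "vec.subspace H" "vec.dim H + 1 = CARD('n)"
  shows "vec.dim y \<le> vec.dim (y \<inter> H) + 1"
proof -
  have "vec.dim (join y H) \<le> CARD('n)" by (rule dim_subset_UNIV_cart_gen)
  then show ?thesis using dim_join[OF assms(1,2)] assms(3) by linarith
qed

lemma card_functional_level:
  fixes \<phi> :: "'a::{field,finite}^'n \<Rightarrow> 'a"
  assumes T: "vec.subspace T"
    and add: "\<And>x y. \<phi> (x + y) = \<phi> x + \<phi> y" and scale: "\<And>c x. \<phi> (c *s x) = c * \<phi> x"
    and t: "t \<in> T" "\<phi> t \<noteq> 0"
  shows "card {x\<in>T. \<phi> x = c} * CARD('a) = card T"
proof -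
  \<comment> \<open>All levels are translates of the kernel by multiples of \<open>t\<close>.\<close>
  have level: "card {x\<in>T. \<phi> x = c} = card {x\<in>T. \<phi> x = 0}" for c
  proof (rule bij_betw_same_card[symmetric], rule bij_betwI)
    let ?w = "(c / \<phi> t) *s t"
    have w: "?w \<in> T" "\<phi> ?w = c" using t T by (auto simp: scale vec.subspace_scale)
    have minus: "\<phi> (x - y) = \<phi> x - \<phi> y" for x y
      using add[of "x - y" y] by simp
    show "(\<lambda>x. x + ?w) \<in> {x\<in>T. \<phi> x = 0} \<rightarrow> {x\<in>T. \<phi> x = c}"
      using w T by (auto simp: add vec.subspace_add)
    show "(\<lambda>x. x - ?w) \<in> {x\<in>T. \<phi> x = c} \<rightarrow> {x\<in>T. \<phi> x = 0}"
      using w T by (auto simp: minus vec.subspace_diff)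
  qed auto
  have "card T = (\<Sum>c\<in>UNIV. card {x\<in>T. \<phi> x = c})"
    using sum.group[of T UNIV \<phi> "\<lambda>_. 1::nat"] by simp
  also have "\<dots> = (\<Sum>c\<in>(UNIV::'a set). card {x\<in>T. \<phi> x = 0})"
    by (rule sum.cong[OF refl], rule level)
  finally show ?thesis by (simp add: level[of c])
qed

lemma bilinear_formD:
  assumes "bilinear_form B"
  shows "B (u + v) w = B u w + B v w" "B w (u + v) = B w u + B w v"
    "B (c *s v) w = c * B v w" "B w (c *s v) = c * B w v"
    "B 0 w = 0" "B w 0 = 0" "B (u - v) w = B u w - B v w" "B w (u - v) = B w u - B w v"
proof -
  have l: "Vector_Spaces.linear (*s) (*) (B w)" "Vector_Spaces.linear (*s) (*) (\<lambda>v. B v w)" for w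
    using assms by (auto simp: bilinear_form_def)
  then have h: "module_hom (*s) (*) (B w)" "module_hom (*s) (*) (\<lambda>v. B v w)" for w
    by (auto simp: Vector_Spaces.linear_def)
  show "B (u + v) w = B u w + B v w" "B w (u + v) = B w u + B w v"
    "B (c *s v) w = c * B v w" "B w (c *s v) = c * B w v"
    "B 0 w = 0" "B w 0 = 0" "B (u - v) w = B u w - B v w" "B w (u - v) = B w u - B w v"
    by (fact module_hom.add[OF h(1)] module_hom.add[OF h(2)] module_hom.scale[OF h(1)]
        module_hom.scale[OF h(2)] module_hom.zero[OF h(1)] module_hom.zero[OF h(2)]
        module_hom.diff[OF h(1)] module_hom.diff[OF h(2)])+
qed

lemma pairing_zeros:
  fixes B :: "'a::{field,finite}^'n \<Rightarrow> 'a^'n \<Rightarrow> 'a"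
  assumes B: "bilinear_form B" and T: "vec.subspace T"
  shows "real CARD('a) * (\<Sum>s\<in>S. real (card {t\<in>T. B s t = 0})) =
    (real CARD('a) - 1) * (real (card {s\<in>S. \<forall>t\<in>T. B s t = 0}) * real (card T)) +
    real (card S) * real (card T)"
proof -
  have zeros: "real CARD('a) * real (card {t\<in>T. B s t = 0}) =
     real (card T) + (if \<forall>t\<in>T. B s t = 0 then (real CARD('a) - 1) * real (card T) else 0)" for s
  proof (cases "\<forall>t\<in>T. B s t = 0")
    case True
    then have "{t\<in>T. B s t = 0} = T" by auto
    with True show ?thesis by (simp add: algebra_simps)
  next
    case False
    then obtain t where "t \<in> T" "B s t \<noteq> 0" by auto
    then have "card {t\<in>T. B s t = 0} * CARD('a) = card T"
      by (intro card_functional_level[where \<phi> = "B s"] T) (auto simp: bilinear_formD[OF B])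
    then have "real (card {t\<in>T. B s t = 0}) * real CARD('a) = real (card T)"
      by (metis of_nat_mult)
    then show ?thesis unfolding if_not_P[OF False] by (simp add: mult.commute)
  qed
  have "real CARD('a) * (\<Sum>s\<in>S. real (card {t\<in>T. B s t = 0})) =
    (\<Sum>s\<in>S. real (card T) + (if \<forall>t\<in>T. B s t = 0 then (real CARD('a) - 1) * real (card T) else 0))"
    by (simp add: sum_distrib_left zeros)
  also have "\<dots> = real (card S) * real (card T) +
      real (card {s\<in>S. \<forall>t\<in>T. B s t = 0}) * ((real CARD('a) - 1) * real (card T))"
    by (simp add: sum.distrib sum.If_cases Int_def)
  finally show ?thesis by (simp add: algebra_simps)
qed

text \<open>
  Both sides come from counting the zeros of \<open>B\<close> on \<open>S \<times> T\<close>, row by row and column by column: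
  a row that is not identically zero is a nonzero functional and vanishes on a \<open>1/q\<close> fraction of
  \<open>T\<close>. This one count replaces the usual dimension formulas for orthogonal complements and
  holds for degenerate forms as well.
\<close>

lemma card_pairing:
  fixes B :: "'a::{field,finite}^'n \<Rightarrow> 'a^'n \<Rightarrow> 'a"
  assumes B: "bilinear_form B" and S: "vec.subspace S" and T: "vec.subspace T"
  shows "card {s\<in>S. \<forall>t\<in>T. B s t = 0} * card T = card {t\<in>T. \<forall>s\<in>S. B s t = 0} * card S"
proof -
  have B': "bilinear_form (\<lambda>x y. B y x)" using B by (auto simp: bilinear_form_def)
  have "(\<Sum>s\<in>S. real (card {t\<in>T. B s t = 0})) = (\<Sum>t\<in>T. real (card {s\<in>S. B s t = 0}))"
    using sum.swap_restrict[of S T "\<lambda>_ _. 1::real" "\<lambda>s t. B s t = 0"] by simp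
  then have "(real CARD('a) - 1) * (real (card {s\<in>S. \<forall>t\<in>T. B s t = 0}) * real (card T)) =
    (real CARD('a) - 1) * (real (card {t\<in>T. \<forall>s\<in>S. B s t = 0}) * real (card S))"
    using pairing_zeros[OF B T, of S] pairing_zeros[OF B' S, of T] by (simp add: algebra_simps)
  moreover have "real CARD('a) - 1 \<noteq> 0" using card_field_gt_1[where 'a='a] by simp
  ultimately have "real (card {s\<in>S. \<forall>t\<in>T. B s t = 0}) * real (card T) =
     real (card {t\<in>T. \<forall>s\<in>S. B s t = 0}) * real (card S)" by simp
  then show ?thesis by (simp only: of_nat_mult[symmetric] of_nat_eq_iff)
qed

lemma subspace_annihilator:
  assumes "bilinear_form B" "vec.subspace S"
  shows "vec.subspace {s\<in>S. \<forall>t\<in>T. B s t = 0}"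
  using assms by (auto simp: vec.subspace_def bilinear_formD)

text \<open>
  With \<open>S\<close> the whole space it gives the dimension of \<open>T\<^sup>\<bottom>\<close>; with two totally singular
  subspaces it compares their mutual annihilators.
\<close>

lemma dim_pairing:
  fixes B :: "'a::{field,finite}^'n \<Rightarrow> 'a^'n \<Rightarrow> 'a"
  assumes B: "bilinear_form B" and S: "vec.subspace S" and T: "vec.subspace T"
  shows "vec.dim {s\<in>S. \<forall>t\<in>T. B s t = 0} + vec.dim T = vec.dim {t\<in>T. \<forall>s\<in>S. B s t = 0} + vec.dim S"
proof -
  have B': "bilinear_form (\<lambda>x y. B y x)" using B by (auto simp: bilinear_form_def)
  have "CARD('a) ^ (vec.dim {s\<in>S. \<forall>t\<in>T. B s t = 0} + vec.dim T) =
    CARD('a) ^ (vec.dim {t\<in>T. \<forall>s\<in>S. B s t = 0} + vec.dim S)"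
    using card_pairing[OF assms] card_subspace[OF S] card_subspace[OF T]
      card_subspace[OF subspace_annihilator[OF B S, of T]]
      card_subspace[OF subspace_annihilator[OF B' T, of S]]
    by (simp add: power_add)
  then show ?thesis using card_field_gt_1[where 'a='a] by simp
qed

section \<open>Moebius inversion over subspaces\<close>

lemma double_count:
  assumes "finite F" "finite V"
    and "\<And>R. R \<in> F \<Longrightarrow> card {v\<in>V. r R v} = a" and "\<And>v. v \<in> V \<Longrightarrow> card {R\<in>F. r R v} = b"
  shows "card F * a = card V * b"
proof -
  have "(\<Sum>R\<in>F. card {v\<in>V. r R v}) = (\<Sum>v\<in>V. card {R\<in>F. r R v})"
    using sum.swap_restrict[OF assms(1,2), of "\<lambda>_ _. 1::nat" r] by simp
  then show ?thesis using assms by simp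
qed

lemma insert_vector_to_subspace:
  fixes R H :: "('a::field^'n) set"
  assumes "vec.subspace R" "v \<notin> R"
  shows "vec.subspace (join R (vec.span {v}))" "vec.dim (join R (vec.span {v})) = Suc (vec.dim R)"
    "v \<in> join R (vec.span {v})" "R \<subseteq> join R (vec.span {v})"
proof -
  show "vec.subspace (join R (vec.span {v}))" using assms by (simp add: subspace_join)
  have "R \<inter> vec.span {v} = {0}"
  proof -
    have "x = 0" if x: "x \<in> R" "x \<in> vec.span {v}" for x
    proof (rule ccontr)
      assume "x \<noteq> 0"
      moreover obtain k where k: "x = k *s v" using x by (auto simp: vec.span_singleton)
      ultimately have "v = inverse k *s x" by auto
      then show False using assms x vec.subspace_scale by metis
    qed
    then show ?thesis using assms vec.subspace_0 vec.span_zero by auto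
  qed
  moreover have "v \<noteq> 0" using assms vec.subspace_0 by auto
  ultimately show "vec.dim (join R (vec.span {v})) = Suc (vec.dim R)"
    using dim_join[of R "vec.span {v}"] assms by (simp add: vec.dim_eq_0)
  show "v \<in> join R (vec.span {v})"
    using join_right[OF assms(1), of "vec.span {v}"] vec.span_base[of v "{v}"] by auto
  show "R \<subseteq> join R (vec.span {v})" by (rule join_left) simp
qed

lemma subspace_eqI:
  fixes S T :: "('a::field^'n) set"
  assumes "vec.subspace S" "vec.subspace T" "S \<subseteq> T" "vec.dim T \<le> vec.dim S"
  shows "S = T"
  using vec.subspace_dim_equal[OF assms] .

text \<open>
  Each vector of \<open>T - H\<close> spans together with \<open>R'\<close> exactly one such \<open>R\<close>, and each \<open>R\<close> contains
  \<open>card R - card R'\<close> of these vectors.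
\<close>

lemma card_complement_traces:
  fixes T H :: "('a::{field,finite}^'n) set"
  assumes T: "vec.subspace T" and H: "vec.subspace H" "H \<subseteq> T" "vec.dim T = Suc (vec.dim H)"
    and R': "vec.subspace R'" "R' \<subseteq> H"
  shows "card {R. vec.subspace R \<and> R \<subseteq> T \<and> \<not> R \<subseteq> H \<and> R \<inter> H = R'} * CARD('a) ^ vec.dim R' =
    CARD('a) ^ vec.dim H"
proof -
  let ?q = "CARD('a)"
  let ?F = "{R. vec.subspace R \<and> R \<subseteq> T \<and> \<not> R \<subseteq> H \<and> R \<inter> H = R'}"
  have dimF: "vec.dim R = Suc (vec.dim R')" if R: "R \<in> ?F" for R
  proof -
    have "H \<subset> join R H" using R H join_left[of H R] join_right[of R H] by auto
    then have "vec.dim H < vec.dim (join R H)"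
      using R H by (intro dim_strict_mono subspace_join) auto
    moreover have "vec.dim (join R H) \<le> vec.dim T"
      using R H T by (intro vec.dim_subset join_least) auto
    ultimately show ?thesis using dim_join[of R H] R H by auto
  qed
  have "card ?F * (?q ^ Suc (vec.dim R') - ?q ^ vec.dim R') = card (T - H) * 1"
  proof (rule double_count[where r = "\<lambda>R v. v \<in> R"])
    fix R assume R: "R \<in> ?F"
    then have "{v\<in>T - H. v \<in> R} = R - R'" by auto
    moreover have "card (R - R') = card R - card R'" using R by (intro card_Diff_subset) auto
    ultimately show "card {v\<in>T - H. v \<in> R} = ?q ^ Suc (vec.dim R') - ?q ^ vec.dim R'"
      using R R' card_subspace[of R] card_subspace[of R'] dimF[OF R] by simp
  next
    fix v assume v: "v \<in> T - H"
    let ?J = "join R' (vec.span {v})"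
    have vR': "v \<notin> R'" using v R' by auto
    note J = insert_vector_to_subspace[OF R'(1) vR']
    have JT: "?J \<subseteq> T" using v H R' T by (intro join_least vec.span_minimal) auto
    have "?J \<inter> H = R'"
    proof -
      have "R' \<subseteq> ?J \<inter> H" using J R' by auto
      moreover have "vec.dim (?J \<inter> H) < vec.dim ?J"
        using J v H by (intro dim_strict_mono vec.subspace_inter) auto
      ultimately show ?thesis using R' J H
        by (intro subspace_eqI[symmetric] vec.subspace_inter) auto
    qed
    then have "?J \<in> ?F" using J JT v by auto
    moreover have "R = ?J" if R: "R \<in> ?F" "v \<in> R" for R
    proof (rule subspace_eqI[symmetric])
      show "?J \<subseteq> R" using R R' by (intro join_least vec.span_minimal) auto
    qed (use R J dimF[OF R(1)] in auto)
    ultimately have "{R\<in>?F. v \<in> R} = {?J}" using J by blast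
    then show "card {R\<in>?F. v \<in> R} = 1" by simp
  qed auto
  moreover have "card (T - H) = ?q ^ Suc (vec.dim H) - ?q ^ vec.dim H"
    using H T card_subspace[of T] card_subspace[of H] by (simp add: card_Diff_subset)
  ultimately have "(?q - 1) * (card ?F * ?q ^ vec.dim R') = (?q - 1) * ?q ^ vec.dim H"
    by (simp add: algebra_simps diff_mult_distrib2)
  then show ?thesis using card_field_gt_1[where 'a='a] by simp
qed

text \<open>
  The value \<open>\<mu>(0, R)\<close> of the Moebius function of the subspace lattice, for \<open>R\<close> of dimension \<open>r\<close>.
\<close>

definition subspace_moebius :: "'a itself \<Rightarrow> nat \<Rightarrow> real" where
  "subspace_moebius _ r = (-1) ^ r * real CARD('a) ^ (r choose 2)"

lemma choose_two_Suc: "Suc r choose 2 = (r choose 2) + r"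
  by (simp add: numeral_2_eq_2)

lemma subspace_moebius_Suc:
  "subspace_moebius TYPE('a) (Suc r) = - (real CARD('a) ^ r) * subspace_moebius TYPE('a) r"
  by (simp add: subspace_moebius_def choose_two_Suc power_add)

text \<open>
  Fix a hyperplane \<open>H\<close> of \<open>T\<close>, of dimension \<open>m\<close>, and sort the subspaces of \<open>T\<close> that are not inside \<open>H\<close> by their trace
  on \<open>H\<close>. A trace of dimension \<open>r\<close> occurs \<open>q\<^sup>m\<^sup>-\<^sup>r\<close> times, which compensates the factor \<open>- q\<^sup>r\<close> between
  consecutive Moebius values. The sum over \<open>T\<close> is therefore \<open>1 - q\<^sup>m\<close> times the sum over \<open>H\<close>,
  and one of these two factors is zero.
\<close>

lemma sum_subspace_moebius:
  fixes T :: "('a::{field,finite}^'n) set"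
  assumes "vec.subspace T"
  shows "(\<Sum>R | vec.subspace R \<and> R \<subseteq> T. subspace_moebius TYPE('a) (vec.dim R)) =
    (if T = {0} then 1 else 0)"
  using assms
proof (induction "vec.dim T" arbitrary: T)
  case 0
  then have T: "T = {0}" by (simp add: subspace_eq_zero_iff)
  have "{R. vec.subspace R \<and> R \<subseteq> {0::'a^'n}} = {{0}}" using vec.subspace_0 by auto
  then show ?case using T by (simp add: subspace_moebius_def numeral_2_eq_2)
next
  case (Suc m)
  let ?q = "real CARD('a)" and ?\<mu> = "subspace_moebius TYPE('a)"
  obtain H where H: "vec.subspace H" "H \<subseteq> T" "vec.dim H = m"
    using obtain_hyperplane[of T "{0}" m] Suc by (auto simp: vec.subspace_0)
  define L where "L = {R. vec.subspace R \<and> R \<subseteq> H}"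
  define M where "M = {R. vec.subspace R \<and> R \<subseteq> T \<and> \<not> R \<subseteq> H}"
  have fib: "(\<Sum>R\<in>{R\<in>M. R \<inter> H = R'}. ?\<mu> (vec.dim R)) = - (?q ^ m) * ?\<mu> (vec.dim R')"
    if R': "R' \<in> L" for R'
  proof -
    have "{R\<in>M. R \<inter> H = R'} =
        {R. vec.subspace R \<and> R \<subseteq> T \<and> \<not> R \<subseteq> H \<and> R \<inter> H = R'}" by (auto simp: M_def)
    then have "card {R\<in>M. R \<inter> H = R'} * CARD('a) ^ vec.dim R' = CARD('a) ^ m"
      using card_complement_traces[of T H R'] H Suc R' by (simp add: L_def)
    then have c: "real (card {R\<in>M. R \<inter> H = R'}) * ?q ^ vec.dim R' = ?q ^ m"
      by (simp only: of_nat_mult[symmetric] of_nat_power[symmetric])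
    have "vec.dim R = Suc (vec.dim R')" if R: "R \<in> M" "R \<inter> H = R'" for R
    proof -
      have R: "vec.subspace R" "R \<subseteq> T" "\<not> R \<subseteq> H" "R \<inter> H = R'" using R by (auto simp: M_def)
      have "H \<subset> join R H" using R H join_left[of H R] join_right[of R H] by auto
      then have "vec.dim H < vec.dim (join R H)"
        using R H by (intro dim_strict_mono subspace_join) auto
      moreover have "vec.dim (join R H) \<le> vec.dim T"
        using R H Suc by (intro vec.dim_subset join_least) auto
      ultimately show ?thesis using dim_join[of R H] R H Suc by auto
    qed
    then have "(\<Sum>R\<in>{R\<in>M. R \<inter> H = R'}. ?\<mu> (vec.dim R)) =
        real (card {R\<in>M. R \<inter> H = R'}) * ?\<mu> (Suc (vec.dim R'))"
      by simp
    then show ?thesis using c by (simp add: subspace_moebius_Suc)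
  qed
  have "{R. vec.subspace R \<and> R \<subseteq> T} = L \<union> M" "L \<inter> M = {}"
    using H by (auto simp: L_def M_def)
  then have "(\<Sum>R | vec.subspace R \<and> R \<subseteq> T. ?\<mu> (vec.dim R)) =
      (\<Sum>R\<in>L. ?\<mu> (vec.dim R)) + (\<Sum>R\<in>M. ?\<mu> (vec.dim R))"
    by (simp add: sum.union_disjoint)
  also have "(\<Sum>R\<in>M. ?\<mu> (vec.dim R)) =
      (\<Sum>R'\<in>L. \<Sum>R\<in>{R\<in>M. R \<inter> H = R'}. ?\<mu> (vec.dim R))"
    using H by (intro sum.group[symmetric]) (auto simp: L_def M_def intro: vec.subspace_inter)
  also have "\<dots> = - (?q ^ m) * (\<Sum>R\<in>L. ?\<mu> (vec.dim R))"
    by (simp add: fib sum_distrib_left)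
  also have "(\<Sum>R\<in>L. ?\<mu> (vec.dim R)) = (if H = {0} then 1 else 0)"
    unfolding L_def using Suc H by simp
  finally have "(\<Sum>R | vec.subspace R \<and> R \<subseteq> T. ?\<mu> (vec.dim R)) = 0"
    using H subspace_eq_zero_iff[OF H(1)] by auto
  moreover have "T \<noteq> {0}" using Suc subspace_eq_zero_iff[of T] by auto
  ultimately show ?case by simp
qed

section \<open>Zeros of quadratic forms over finite fields\<close>

text \<open>
  More than half of the field elements are squares, in every characteristic, so that the values of
  \<open>a x\<^sup>2\<close> and of \<open>- c - b y\<^sup>2\<close> overlap.
\<close>

lemma squares_represent:
  fixes a b c :: "'a::{field,finite}"
  assumes "a \<noteq> 0" "b \<noteq> 0"
  shows "\<exists>x y. a * x\<^sup>2 + b * y\<^sup>2 + c = 0"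
proof -
  define s where "s = range (\<lambda>x::'a. x\<^sup>2)"
  have fib: "card {x::'a. x\<^sup>2 = z} \<le> (if z = 0 then 1 else 2)" for z
  proof (cases "\<exists>x0. x0\<^sup>2 = z")
    case True
    then obtain x0 where x0: "x0\<^sup>2 = z" by blast
    have "{x. x\<^sup>2 = z} \<subseteq> {x0, - x0}" using x0 by (auto simp: power2_eq_iff)
    then have "card {x. x\<^sup>2 = z} \<le> card {x0, - x0}" by (intro card_mono) auto
    also have "\<dots> \<le> (if z = 0 then 1 else 2)" using x0 by (auto simp: card_insert_if)
    finally show ?thesis .
  qed auto
  have "CARD('a) = (\<Sum>z\<in>s. card {x::'a. x\<^sup>2 = z})"
    using sum.group[of "UNIV::'a set" s "\<lambda>x. x\<^sup>2" "\<lambda>_. 1::nat"] by (simp add: s_def)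
  also have "\<dots> \<le> (\<Sum>z\<in>s. if z = 0 then 1 else 2)" by (intro sum_mono fib)
  also have "\<dots> = 1 + 2 * card (s - {0})"
  proof -
    have "0 \<in> s" by (auto simp: s_def intro: image_eqI[of _ _ 0])
    then show ?thesis by (subst sum.remove[of s 0]) auto
  qed
  also have "\<dots> < 2 * card s"
  proof -
    have "0 \<in> s" by (auto simp: s_def intro: image_eqI[of _ _ 0])
    then have "card s > 0" by (auto simp: card_gt_0_iff)
    then show ?thesis using \<open>0 \<in> s\<close> by (simp add: card_Diff_singleton)
  qed
  finally have big: "CARD('a) < 2 * card s" .
  let ?A = "(\<lambda>z. a * z) ` s" and ?C = "(\<lambda>z. - c - b * z) ` s"
  have "card ?A = card s" "card ?C = card s" using assms by (auto intro!: card_image inj_onI)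
  have "?A \<inter> ?C \<noteq> {}"
  proof
    assume "?A \<inter> ?C = {}"
    then have "card (?A \<union> ?C) = card ?A + card ?C" by (intro card_Un_disjoint) auto
    moreover have "card (?A \<union> ?C) \<le> CARD('a)" by (intro card_mono) auto
    ultimately show False using big \<open>card ?A = card s\<close> \<open>card ?C = card s\<close> by simp
  qed
  then obtain x y where "a * x\<^sup>2 = - c - b * y\<^sup>2" by (auto simp: s_def)
  then show ?thesis by (intro exI[of _ x] exI[of _ y]) simp
qed

lemma square_surj_char2:
  assumes "(2::'a::{field,finite}) = 0"
  shows "\<exists>x. x\<^sup>2 = (z::'a)"
proof -
  have neg: "- x = x" for x :: 'a
  proof -
    have "x + x = 2 * x" by simp
    also have "\<dots> = 0" using assms by simp
    finally show ?thesis by (simp add: minus_unique)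
  qed
  have "inj (\<lambda>x::'a. x\<^sup>2)" by (rule injI) (metis neg power2_eq_iff)
  then have "surj (\<lambda>x::'a. x\<^sup>2)" by (intro finite_UNIV_inj_surj) auto
  then show ?thesis using surjD[of "\<lambda>x::'a. x\<^sup>2" z] by metis
qed

lemma quadratic_formD:
  assumes "quadratic_form Q"
  shows "Q (c *s v) = c\<^sup>2 * Q v" "bilinear_form (polar_form Q)" "Q 0 = 0"
    "Q (v + w) = Q v + Q w + polar_form Q v w" "polar_form Q v w = polar_form Q w v"
    "polar_form Q v v = 2 * Q v"
proof -
  show 1: "Q (c *s v) = c\<^sup>2 * Q v" "bilinear_form (polar_form Q)" for c v
    using assms by (auto simp: quadratic_form_def)
  show "Q 0 = 0" using 1(1)[of 0 0] by simp
  show "Q (v + w) = Q v + Q w + polar_form Q v w" by (simp add: polar_form_def)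
  show "polar_form Q v w = polar_form Q w v" by (simp add: polar_form_def add.commute)
  have "v + v = 2 *s v" using vec.scale_left_distrib[of 1 1 v] by simp
  then show "polar_form Q v v = 2 * Q v" by (simp add: polar_form_def 1)
qed

lemma dim_annihilator_ge:
  fixes B :: "'a::{field,finite}^'n \<Rightarrow> 'a^'n \<Rightarrow> 'a"
  assumes "bilinear_form B" "vec.subspace W" "vec.subspace T"
  shows "vec.dim W \<le> vec.dim {s\<in>W. \<forall>t\<in>T. B s t = 0} + vec.dim T"
  using dim_pairing[OF assms] by simp

text \<open>
  If the characteristic is odd, three pairwise orthogonal vectors exist, and a combination of them
  is singular by pigeonhole. If it is 2, two orthogonal independent vectors suffice, because every
  field element is a square.
\<close>

lemma quadratic_form_zero:
  fixes Q :: "'a::{field,finite}^'n \<Rightarrow> 'a"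
  assumes Q: "quadratic_form Q" and W: "vec.subspace W" and dim: "vec.dim W \<ge> 3"
  shows "\<exists>v\<in>W. v \<noteq> 0 \<and> Q v = 0"
proof (rule ccontr)
  assume "\<not> ?thesis"
  then have nz: "Q v \<noteq> 0" if "v \<in> W" "v \<noteq> 0" for v using that by blast
  let ?B = "polar_form Q"
  note B = quadratic_formD(2)[OF Q]
  note ann = dim_annihilator_ge[OF B W]
  obtain v where v: "v \<in> W" "v \<noteq> 0" using subspace_nonzeroE[OF W] dim by auto
  show False
  proof (cases "(2::'a) = 0")
    case True
    let ?W1 = "{s\<in>W. \<forall>t\<in>vec.span {v}. ?B s t = 0}"
    have "vec.dim ?W1 \<ge> 2" using ann[of "vec.span {v}"] dim v by simp
    then have "\<not> ?W1 \<subseteq> vec.span {v}"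
      using vec.dim_subset[of ?W1 "vec.span {v}"] v by auto
    then obtain w where w: "w \<in> W" "?B w v = 0" "w \<notin> vec.span {v}"
      using vec.span_base[of v "{v}"] by auto
    obtain x where x: "x\<^sup>2 = - Q w / Q v" using square_surj_char2[OF True] by blast
    have "Q (x *s v + w) = 0"
      using w(2) nz[OF v] quadratic_formD(5)[OF Q, of v w]
      by (simp add: quadratic_formD(1,4)[OF Q] bilinear_formD[OF B] x)
    moreover have "x *s v + w \<in> W" using v w W by (auto intro!: vec.subspace_add vec.subspace_scale)
    moreover have "x *s v + w \<noteq> 0"
    proof
      assume "x *s v + w = 0"
      then have "w = (- x) *s v" by (simp add: eq_neg_iff_add_eq_0 add.commute)
      then show False using w(3) by (metis vec.span_base vec.span_scale insertI1)
    qed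
    ultimately show False using nz by blast
  next
    case False
    let ?W1 = "{s\<in>W. \<forall>t\<in>vec.span {v}. ?B s t = 0}"
    have "vec.dim ?W1 \<ge> 1" using ann[of "vec.span {v}"] dim v by simp
    then obtain w where "w \<in> ?W1" "w \<noteq> 0"
      by (rule subspace_nonzeroE[OF subspace_annihilator[OF B W]])
    then have w: "w \<in> W" "w \<noteq> 0" "?B w v = 0" by (auto intro: vec.span_base)
    let ?W2 = "{s\<in>W. \<forall>t\<in>vec.span {v, w}. ?B s t = 0}"
    have "vec.dim (vec.span {v, w}) \<le> 2"
      using vec.dim_le_card[of "{v, w}" "{v, w}"] card_insert_le_m1[of 2 "{w}" v]
        vec.span_superset[of "{v, w}"] by (simp add: order.trans)
    then have "vec.dim ?W2 \<ge> 1" using ann[of "vec.span {v, w}"] dim by simp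
    then obtain u where "u \<in> ?W2" "u \<noteq> 0"
      by (rule subspace_nonzeroE[OF subspace_annihilator[OF B W]])
    then have u: "u \<in> W" "u \<noteq> 0" "?B u v = 0" "?B u w = 0" by (auto intro: vec.span_base)
    obtain x y where xy: "Q v * x\<^sup>2 + Q w * y\<^sup>2 + Q u = 0"
      using squares_represent[of "Q v" "Q w" "Q u"] nz v w by auto
    let ?z = "x *s v + y *s w + u"
    have "Q ?z = 0"
      using xy u(3,4) w(3) quadratic_formD(5)[OF Q, of v u] quadratic_formD(5)[OF Q, of w u]
        quadratic_formD(5)[OF Q, of v w]
      by (simp add: quadratic_formD(1,4)[OF Q] bilinear_formD[OF B] mult.commute)
    moreover have "?z \<in> W" using u v w W by (auto intro!: vec.subspace_add vec.subspace_scale)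
    moreover have "?z \<noteq> 0"
    proof
      assume "?z = 0"
      then have "?B u ?z = 0" by (simp add: bilinear_formD[OF B])
      then have "2 * Q u = 0" using u by (simp add: bilinear_formD[OF B] quadratic_formD(6)[OF Q])
      then show False using False nz[OF u(1,2)] by simp
    qed
    ultimately show False using nz by blast
  qed
qed

section \<open>Generators of a parabolic quadric\<close>

locale parabolic =
  fixes Q :: "'a::{field,finite}^'n \<Rightarrow> 'a" and d :: nat
  assumes quad: "quadratic_form Q" and nonsing: "nonsingular_on UNIV Q"
    and card_index: "CARD('n) = 2 * d + 1"
begin

abbreviation B :: "'a^'n \<Rightarrow> 'a^'n \<Rightarrow> 'a" where "B \<equiv> polar_form Q"

definition sing :: "('a^'n) set \<Rightarrow> bool" where
  "sing S \<longleftrightarrow> vec.subspace S \<and> (\<forall>v\<in>S. Q v = 0)"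

definition gen :: "('a^'n) set \<Rightarrow> bool" where
  "gen S \<longleftrightarrow> sing S \<and> vec.dim S = d"

definition perp :: "('a^'n) set \<Rightarrow> ('a^'n) set" where
  "perp S = {v. \<forall>w\<in>S. B v w = 0}"

lemmas bilin = quadratic_formD(2)[OF quad]
lemmas B_simps = bilinear_formD[OF bilin]
lemmas Q_scale = quadratic_formD(1)[OF quad]
lemmas Q_zero = quadratic_formD(3)[OF quad]
lemmas Q_add = quadratic_formD(4)[OF quad]
lemmas B_commute = quadratic_formD(5)[OF quad]

lemma q_gt_1: "1 < CARD('a)" by (rule card_field_gt_1)

lemma sing_subspace: "sing S \<Longrightarrow> vec.subspace S" by (simp add: sing_def)
lemma gen_sing: "gen S \<Longrightarrow> sing S" by (simp add: gen_def)
lemma gen_subspace: "gen S \<Longrightarrow> vec.subspace S" by (simp add: gen_def sing_def)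
lemma gen_dim: "gen S \<Longrightarrow> vec.dim S = d" by (simp add: gen_def)

lemma sing_subset: "sing S \<Longrightarrow> vec.subspace T \<Longrightarrow> T \<subseteq> S \<Longrightarrow> sing T"
  by (auto simp: sing_def)

lemma sing_zero: "sing {0}" by (simp add: sing_def Q_zero)

lemma sing_span: "Q v = 0 \<Longrightarrow> sing (vec.span {v})"
  unfolding sing_def by (intro conjI vec.subspace_span) (auto simp: vec.span_singleton Q_scale)

lemma sing_B: "sing S \<Longrightarrow> v \<in> S \<Longrightarrow> w \<in> S \<Longrightarrow> B v w = 0"
  unfolding polar_form_def by (simp add: sing_def vec.subspace_add)

lemma subspace_perp: "vec.subspace (perp S)"
  by (auto simp: perp_def vec.subspace_def B_simps)

lemma perp_antimono: "S \<subseteq> T \<Longrightarrow> perp T \<subseteq> perp S" by (auto simp: perp_def)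

lemma perpD: "v \<in> perp S \<Longrightarrow> w \<in> S \<Longrightarrow> B v w = 0" by (simp add: perp_def)

lemma sing_perp: "sing S \<Longrightarrow> S \<subseteq> perp S" by (auto simp: perp_def sing_B)

lemma perp_commute: "T \<subseteq> perp S \<longleftrightarrow> S \<subseteq> perp T"
  unfolding perp_def using B_commute by (simp add: subset_iff) metis

lemma perp_join: "vec.subspace S \<Longrightarrow> vec.subspace T \<Longrightarrow> perp (join S T) = perp S \<inter> perp T"
proof
  assume "vec.subspace S" "vec.subspace T"
  then show "perp (join S T) \<subseteq> perp S \<inter> perp T" by (simp add: perp_antimono join_left join_right)
qed (auto simp: perp_def join_def B_simps)

lemma perp_span: "v \<in> perp (vec.span {w}) \<longleftrightarrow> B v w = 0"
proof
  show "v \<in> perp (vec.span {w}) \<Longrightarrow> B v w = 0" by (rule perpD) (auto intro: vec.span_base)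
qed (auto simp: perp_def vec.span_singleton B_simps)

text \<open>
  In characteristic 2 the polar form has a radical, but the radical contains no nonzero singular
  vector, so the orthogonal complement of a totally singular \<open>S\<close> has the generic dimension.
\<close>

lemma dim_perp:
  assumes "sing S" shows "vec.dim (perp S) + vec.dim S = 2 * d + 1"
proof -
  have "{t\<in>S. \<forall>s\<in>UNIV. B s t = 0} = {0}"
    using nonsing assms vec.subspace_0[of S]
    by (auto simp: nonsingular_on_def sing_def B_simps B_commute)
  moreover have "{s\<in>UNIV. \<forall>t\<in>S. B s t = 0} = perp S" by (auto simp: perp_def)
  moreover have "vec.dim (UNIV :: ('a^'n) set) = 2 * d + 1" by (simp only: vec_dim_card card_index)
  ultimately show ?thesis
    using dim_pairing[OF bilin vec.subspace_UNIV sing_subspace[OF assms]] by (simp add: vec.dim_eq_0)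
qed

lemma sing_dim_le: assumes "sing S" shows "vec.dim S \<le> d"
  using dim_perp[OF assms] vec.dim_subset[OF sing_perp[OF assms]] by linarith

lemma sing_join:
  assumes "sing S" "sing T" "T \<subseteq> perp S" shows "sing (join S T)"
proof -
  have "B x y = 0" if "x \<in> S" "y \<in> T" for x y
    using that assms(3) B_commute[of x y] by (auto simp: perp_def)
  then show ?thesis using assms(1,2) by (auto simp: sing_def subspace_join Q_add elim!: joinE)
qed

text \<open>
  The complement of \<open>S\<close> in \<open>S\<^sup>\<bottom>\<close> has dimension \<open>2d + 1 - 2k\<close>, which is at least 3 for \<open>k < d\<close>; a
  singular vector in it enlarges \<open>S\<close>.
\<close>

lemma sing_of_dim: "k \<le> d \<Longrightarrow> \<exists>S. sing S \<and> vec.dim S = k"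
proof (induction k)
  case 0
  then show ?case using sing_zero by (intro exI[of _ "{0}"]) (simp add: vec.dim_eq_0)
next
  case (Suc k)
  then obtain S where S: "sing S" "vec.dim S = k" by auto
  have Sp: "S \<subseteq> perp S" "vec.dim (perp S) = 2 * d + 1 - k"
    using sing_perp[OF S(1)] dim_perp[OF S(1)] S by auto
  obtain A where A: "A \<subseteq> S" "vec.independent A" "S \<subseteq> vec.span A" "card A = k"
    using vec.basis_exists S by metis
  obtain C where C: "A \<subseteq> C" "C \<subseteq> perp S" "vec.independent C" "perp S \<subseteq> vec.span C"
    by (rule vec.maximal_independent_subset_extend[of A "perp S"]) (use A Sp in auto)
  define W where "W = vec.span (C - A)"
  have spanA: "vec.span A = S" using A S by (intro vec.span_subspace) (auto simp: sing_def)
  have cardC: "card C = 2 * d + 1 - k"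
    using vec.dim_eq_card_independent[OF C(3)] vec.dim_span[of C]
      vec.span_subspace[OF C(2,4) subspace_perp] Sp by simp
  have fin: "finite C" using C(3) by (rule vec.finiteI_independent)
  \<comment> \<open>\<open>W\<close> is a complement of \<open>S\<close> in \<open>perp S\<close>.\<close>
  have "vec.independent (C - A)" using C(3) by (rule vec.independent_mono) auto
  then have dimW: "vec.dim W = 2 * d + 1 - 2 * k"
    using cardC A C fin finite_subset[OF C(1) fin]
    by (simp add: W_def vec.dim_eq_card_independent card_Diff_subset)
  have W: "vec.subspace W" "W \<subseteq> perp S"
    unfolding W_def using C(2) by (simp, intro vec.span_minimal subspace_perp) auto
  have "C \<subseteq> join S W"
    using join_left[of W S] join_right[of S W] W(1) sing_subspace[OF S(1)] A(1)
      vec.span_superset[of "C - A", folded W_def] by blast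
  then have "vec.dim C \<le> vec.dim (join S W)" by (rule vec.dim_subset)
  then have "vec.dim (S \<inter> W) = 0"
    using dim_join[of S W] S W dimW cardC vec.dim_eq_card_independent[OF C(3)] Suc.prems
    by (simp add: sing_def del: vec.dim_eq_0)
  then have SW: "S \<inter> W = {0}"
    using subspace_eq_zero_iff[of "S \<inter> W"] S W
    by (simp add: sing_def vec.subspace_inter del: vec.dim_eq_0)
  obtain v where v: "v \<in> W" "v \<noteq> 0" "Q v = 0"
    using quadratic_form_zero[OF quad W(1)] dimW Suc.prems by force
  have "v \<notin> S" using SW v by auto
  note J = insert_vector_to_subspace[OF sing_subspace[OF S(1)] this]
  have "sing (join S (vec.span {v}))"
    using S v W subspace_perp by (intro sing_join sing_span vec.span_minimal) auto
  then show ?case using J S by auto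
qed

lemma gen_exists: "\<exists>y. gen y" using sing_of_dim[of d] by (auto simp: gen_def)

lemma totally_singular_eq: "totally_singular_subspaces UNIV Q = {S. sing S}"
  by (auto simp: totally_singular_subspaces_def sing_def)

lemma polar_rank_eq: "polar_rank {S. sing S} = d"
  unfolding polar_rank_def
proof (rule Max_eqI)
  show "d \<in> vec.dim ` {S. sing S}" using sing_of_dim[of d] by auto
qed (auto simp: sing_dim_le)

lemma generators_eq: "generators {S. sing S} = {S. gen S}"
  by (auto simp: generators_def polar_rank_eq gen_def)

text \<open>
  This is the projection of a generator onto the residue of \<open>S\<close>: the generator through \<open>S\<close> that
  meets \<open>y\<close> in as large a subspace as possible.
\<close>

lemma dim_gen_perp:
  assumes S: "sing S" and y: "gen y"
  shows "vec.dim (y \<inter> perp S) + vec.dim S = d + vec.dim (S \<inter> y)"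
    and "gen (join S (y \<inter> perp S))"
proof -
  let ?J = "join S (y \<inter> perp S)"
  have sub: "vec.subspace S" "vec.subspace (y \<inter> perp S)"
    using S y by (auto simp: sing_def gen_def vec.subspace_inter subspace_perp)
  have "{t\<in>y. \<forall>s\<in>S. B s t = 0} = y \<inter> perp S" by (auto simp: perp_def B_commute)
  moreover have "vec.dim (S \<inter> y) \<le> vec.dim {s\<in>S. \<forall>t\<in>y. B s t = 0}"
    using sing_B[OF gen_sing[OF y]] by (intro vec.dim_subset) auto
  ultimately have ge: "vec.dim (y \<inter> perp S) + vec.dim S \<ge> d + vec.dim (S \<inter> y)"
    using dim_pairing[OF bilin sub(1) gen_subspace[OF y]] gen_dim[OF y] by simp
  have J: "sing ?J" using S y sub
    by (intro sing_join) (auto simp: sing_def gen_def)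
  have "S \<inter> (y \<inter> perp S) = S \<inter> y" using sing_perp[OF S] by auto
  then have dimJ: "vec.dim ?J + vec.dim (S \<inter> y) = vec.dim S + vec.dim (y \<inter> perp S)"
    using dim_join[OF sub] by simp
  then show "vec.dim (y \<inter> perp S) + vec.dim S = d + vec.dim (S \<inter> y)"
    using ge sing_dim_le[OF J] by simp
  show "gen ?J" using J dimJ ge sing_dim_le[OF J] by (simp add: gen_def)
qed

lemma gen_maximal: assumes "gen y" "Q v = 0" "v \<in> perp y" shows "v \<in> y"
proof (rule ccontr)
  assume "v \<notin> y"
  note J = insert_vector_to_subspace[OF gen_subspace[OF assms(1)] this]
  have "sing (join y (vec.span {v}))" using assms subspace_perp
    by (intro sing_join sing_span vec.span_minimal gen_sing) auto
  then show False using sing_dim_le J gen_dim[OF assms(1)] by fastforce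
qed

lemma sing_contained_in_gen: assumes "sing S" shows "\<exists>y. gen y \<and> S \<subseteq> y"
proof -
  obtain y where "gen y" using gen_exists by blast
  then show ?thesis using dim_gen_perp(2)[OF assms, of y]
      join_left[OF vec.subspace_inter[OF gen_subspace subspace_perp]] by blast
qed

text \<open>
  Choose a generator \<open>y\<close> through \<open>S\<close> and split \<open>S\<^sup>\<bottom>\<close> into cosets of \<open>y\<close>. On a coset \<open>v + y\<close> the form is
  \<open>Q v + B v w\<close> with \<open>w\<close> in \<open>y\<close>. If \<open>v\<close> is not orthogonal to \<open>y\<close>, this takes every value equally often;
  otherwise the form is constant on the coset, and zero only on \<open>y\<close> itself.
\<close>

lemma card_singular_perp:
  assumes S: "sing S" shows "card {v\<in>perp S. Q v = 0} = CARD('a) ^ (2 * d - vec.dim S)"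
proof -
  obtain y where y: "gen y" "S \<subseteq> y" using sing_contained_in_gen[OF S] by blast
  let ?N = "{v\<in>perp S. Q v = 0}" and ?t = "vec.dim S"
  have yp: "y \<subseteq> perp y" "perp y \<subseteq> perp S" using y sing_perp gen_sing perp_antimono by auto
  \<comment> \<open>Every singular vector of \<open>perp S\<close> is hit \<open>card y\<close> times, once for each \<open>w\<close>.\<close>
  have "(\<Sum>v\<in>perp S. card {w\<in>y. Q (v + w) = 0}) = (\<Sum>w\<in>y. card {v\<in>perp S. Q (v + w) = 0})"
    using sum.swap_restrict[of "perp S" y "\<lambda>_ _. 1::nat" "\<lambda>v w. Q (v + w) = 0"] by simp
  also have "\<dots> = (\<Sum>w\<in>y. card ?N)"
  proof (rule sum.cong[OF refl], rule bij_betw_same_card, rule bij_betwI)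
    fix w assume w: "w \<in> y"
    show "(\<lambda>v. v + w) \<in> {v\<in>perp S. Q (v + w) = 0} \<rightarrow> ?N"
      using w yp subspace_perp by (auto intro!: vec.subspace_add)
    show "(\<lambda>v. v - w) \<in> ?N \<rightarrow> {v\<in>perp S. Q (v + w) = 0}"
      using w yp subspace_perp by (auto intro!: vec.subspace_diff)
  qed auto
  finally have count: "(\<Sum>v\<in>perp S. CARD('a) * card {w\<in>y. Q (v + w) = 0}) = CARD('a) * (card y * card ?N)"
    by (simp add: sum_distrib_left[symmetric])
  have zeros: "CARD('a) * card {w\<in>y. Q (v + w) = 0} =
      (if v \<in> y then CARD('a) * card y else if v \<in> perp y then 0 else card y)" if "v \<in> perp S" for v
  proof (cases "v \<in> perp y")
    case True
    then have "{w\<in>y. Q (v + w) = 0} = {w\<in>y. Q v = 0}"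
      using y by (auto simp: Q_add perp_def gen_def sing_def)
    moreover have "Q v = 0 \<longleftrightarrow> v \<in> y" using gen_maximal[OF y(1)] True y by (auto simp: gen_def sing_def)
    ultimately show ?thesis using True by auto
  next
    case False
    then obtain t where t: "t \<in> y" "B v t \<noteq> 0" by (auto simp: perp_def)
    have "{w\<in>y. Q (v + w) = 0} = {w\<in>y. B v w = - Q v}"
      using y by (intro Collect_cong conj_cong) (auto simp: Q_add gen_def sing_def add_eq_0_iff)
    moreover have "card {w\<in>y. B v w = - Q v} * CARD('a) = card y"
      using t by (intro card_functional_level[OF gen_subspace[OF y(1)]]) (auto simp: B_simps)
    ultimately show ?thesis using False yp by (auto simp: mult.commute)
  qed
  have "(\<Sum>v\<in>perp S. CARD('a) * card {w\<in>y. Q (v + w) = 0}) =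
    (\<Sum>v\<in>perp S. (if v \<in> y then CARD('a) * card y else 0) + (if v \<in> perp S - perp y then card y else 0))"
    using yp by (intro sum.cong) (auto simp: zeros)
  also have "\<dots> = card y * CARD('a) * card y + (card (perp S) - card (perp y)) * card y"
  proof -
    have "perp S \<inter> y = y" "perp S \<inter> {v. v \<notin> perp y} = perp S - perp y"
      "perp S \<inter> (perp S - perp y) = perp S - perp y" using yp by auto
    then show ?thesis using yp by (simp add: sum.distrib sum.If_cases card_Diff_subset
          Collect_conj_eq[symmetric] Int_def[symmetric] set_diff_eq[symmetric])
  qed
  finally have "CARD('a) * (card y * card ?N) = card y * CARD('a) * card y + (card (perp S) - card (perp y)) * card y"
    using count by simp
  then have "card y * (CARD('a) * card ?N) = card y * (CARD('a) * card y + (card (perp S) - card (perp y)))"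
    by (simp add: algebra_simps)
  moreover have "card y = CARD('a) ^ d" using card_subspace[of y] y by (simp add: gen_def sing_def)
  ultimately have "CARD('a) * card ?N = CARD('a) * CARD('a) ^ d + (card (perp S) - card (perp y))"
    using q_gt_1 by simp
  moreover have "vec.dim (perp S) = Suc (2 * d - ?t)" "vec.dim (perp y) = Suc d"
    using dim_perp[OF S] dim_perp[OF gen_sing[OF y(1)]] gen_dim[OF y(1)] sing_dim_le[OF S] by auto
  then have "card (perp S) = CARD('a) * CARD('a) ^ (2 * d - ?t)" "card (perp y) = CARD('a) * CARD('a) ^ d"
    by (simp_all add: card_subspace[OF subspace_perp])
  moreover have "CARD('a) * CARD('a) ^ d \<le> CARD('a) * CARD('a) ^ (2 * d - ?t)"
    using sing_dim_le[OF S] q_gt_1 by (intro mult_left_mono power_increasing) auto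
  ultimately have "CARD('a) * card ?N = CARD('a) * CARD('a) ^ (2 * d - ?t)" by simp
  then show ?thesis using q_gt_1 by simp
qed


section \<open>Counting generators\<close>

lemma card_gen: "gen y \<Longrightarrow> card y = CARD('a) ^ d"
  using card_subspace[of y] by (simp add: gen_def sing_def)

lemma gen_eqI: "gen y \<Longrightarrow> gen z \<Longrightarrow> y \<subseteq> z \<Longrightarrow> y = z"
  using subspace_eqI[of y z] by (simp add: gen_def sing_def)

lemma extend_by_vector:
  assumes S: "sing S" and v: "v \<in> perp S" "Q v = 0" "v \<notin> S"
  shows "sing (join S (vec.span {v}))" "vec.dim (join S (vec.span {v})) = Suc (vec.dim S)"
    "vec.subspace z \<Longrightarrow> join S (vec.span {v}) \<subseteq> z \<longleftrightarrow> S \<subseteq> z \<and> v \<in> z"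
proof -
  note J = insert_vector_to_subspace[OF sing_subspace[OF S] v(3)]
  show "sing (join S (vec.span {v}))"
    using v S subspace_perp by (intro sing_join sing_span vec.span_minimal) auto
  show "vec.dim (join S (vec.span {v})) = Suc (vec.dim S)" by (rule J)
  show "join S (vec.span {v}) \<subseteq> z \<longleftrightarrow> S \<subseteq> z \<and> v \<in> z" if "vec.subspace z"
  proof
    show "S \<subseteq> z \<and> v \<in> z \<Longrightarrow> join S (vec.span {v}) \<subseteq> z"
      using that by (intro join_least vec.span_minimal) auto
  qed (use J in blast)
qed

text \<open>
  Downward induction on the dimension of \<open>S\<close>, counting pairs of a generator \<open>z\<close> and a vector
  \<open>v\<close> of \<open>z\<close> outside \<open>S\<close>: adjoining \<open>v\<close> to \<open>S\<close> keeps it disjoint from \<open>y\<close> precisely if \<open>v\<close> avoids the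
  projection of \<open>y\<close>.
\<close>

lemma card_opposite_above:
  assumes "sing S" "gen y" "S \<inter> y = {0}"
  shows "card {z. gen z \<and> S \<subseteq> z \<and> z \<inter> y = {0}} = CARD('a) ^ (Suc (d - vec.dim S) choose 2)"
  using assms
proof (induction "d - vec.dim S" arbitrary: S)
  case 0
  then have "gen S" using sing_dim_le[of S] by (simp add: gen_def)
  moreover have "z = S" if "gen z" "S \<subseteq> z" for z
    using gen_eqI[OF \<open>gen S\<close> that] by simp
  ultimately have "{z. gen z \<and> S \<subseteq> z \<and> z \<inter> y = {0}} = {S}" using 0 by auto
  then show ?case using 0 by (simp add: numeral_2_eq_2)
next
  case (Suc k)
  let ?t = "vec.dim S"
  let ?F = "{z. gen z \<and> S \<subseteq> z \<and> z \<inter> y = {0}}"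
  let ?J = "join S (y \<inter> perp S)"
  let ?V = "{v\<in>perp S. Q v = 0} - ?J"
  have sub: "vec.subspace S" "vec.subspace y" "vec.subspace (y \<inter> perp S)"
    using Suc.prems by (auto simp: gen_subspace sing_subspace subspace_perp vec.subspace_inter)
  have J: "gen ?J" "S \<subseteq> ?J" "y \<inter> perp S \<subseteq> ?J"
    using dim_gen_perp(2)[OF Suc.prems(1,2)] join_left[OF sub(3)] join_right[OF sub(1)] by auto
  have t: "?t \<le> d" "d - ?t = Suc k" using sing_dim_le[OF Suc.prems(1)] Suc by auto
  have "card ?F * (CARD('a) ^ d - CARD('a) ^ ?t) = card ?V * CARD('a) ^ (Suc k choose 2)"
  proof (rule double_count[where r = "\<lambda>z v. v \<in> z"])
    fix z assume z: "z \<in> ?F"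
    have "z \<inter> ?J = S"
    proof
      show "z \<inter> ?J \<subseteq> S"
      proof
        fix v assume "v \<in> z \<inter> ?J"
        then obtain s w where sw: "v \<in> z" "s \<in> S" "w \<in> y" "v = s + w" by (auto elim!: joinE)
        have "v - s \<in> z" using sw z by (intro vec.subspace_diff) (auto simp: gen_subspace)
        then have "w \<in> z \<inter> y" using sw by simp
        moreover have "z \<inter> y = {0}" using z by simp
        ultimately have "w = 0" by blast
        then show "v \<in> S" using z sw by auto
      qed
    qed (use z J in auto)
    moreover have "z \<subseteq> {v\<in>perp S. Q v = 0}"
      using z sing_perp[of z] perp_antimono[of S z] by (auto simp: gen_def sing_def)
    ultimately have "{v\<in>?V. v \<in> z} = z - S" by auto
    then show "card {v\<in>?V. v \<in> z} = CARD('a) ^ d - CARD('a) ^ ?t"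
      using z sub card_gen[of z] card_subspace[of S] by (auto simp: card_Diff_subset)
  next
    fix v assume v: "v \<in> ?V"
    let ?S = "join S (vec.span {v})"
    have vS: "v \<in> perp S" "Q v = 0" "v \<notin> S" using v J by auto
    note ext = extend_by_vector[OF Suc.prems(1) vS]
    have "?S \<inter> y = {0}"
    proof
      show "?S \<inter> y \<subseteq> {0}"
      proof
        fix x assume x: "x \<in> ?S \<inter> y"
        then obtain s k where sk: "s \<in> S" "x = s + k *s v" by (auto elim!: joinE simp: vec.span_singleton)
        show "x \<in> {0}"
        proof (cases "k = 0")
          case True
          then show ?thesis using sk x Suc.prems(3) by auto
        next
          case False
          have "x \<in> perp S" using sk vS sub sing_perp[OF Suc.prems(1)]
            by (auto intro!: vec.subspace_add vec.subspace_scale subspace_perp)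
          then have "x \<in> ?J" "s \<in> ?J" using x sk J by auto
          then have "inverse k *s (x - s) \<in> ?J"
            using gen_subspace[OF J(1)] by (intro vec.subspace_scale vec.subspace_diff)
          then have "v \<in> ?J" using sk False by simp
          then show ?thesis using v by simp
        qed
      qed
      show "{0} \<subseteq> ?S \<inter> y" using sub ext(1) by (auto simp: sing_def vec.subspace_0)
    qed
    then have "card {z. gen z \<and> ?S \<subseteq> z \<and> z \<inter> y = {0}} = CARD('a) ^ (Suc (d - vec.dim ?S) choose 2)"
      using Suc.hyps ext Suc.prems t by (intro Suc.hyps(1)) auto
    moreover have "{z. gen z \<and> ?S \<subseteq> z \<and> z \<inter> y = {0}} = {z\<in>?F. v \<in> z}"
      using ext(3) gen_subspace by blast
    ultimately show "card {z\<in>?F. v \<in> z} = CARD('a) ^ (Suc k choose 2)" using ext(2) t diff_Suc[of d ?t] by simp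
  qed auto
  also have "card ?V = CARD('a) ^ (2 * d - ?t) - CARD('a) ^ d"
  proof -
    have "?J \<subseteq> {v\<in>perp S. Q v = 0}"
      using J sing_perp[of ?J] perp_antimono[of S ?J] by (auto simp: gen_def sing_def)
    then show ?thesis using card_singular_perp[OF Suc.prems(1)] card_gen[OF J(1)]
      by (simp add: card_Diff_subset)
  qed
  also have "\<dots> = CARD('a) ^ Suc k * (CARD('a) ^ d - CARD('a) ^ ?t)"
  proof -
    have "2 * d - ?t = Suc k + d" "d = Suc k + ?t" using t by auto
    then have "CARD('a) ^ (2 * d - ?t) = CARD('a) ^ Suc k * CARD('a) ^ d" "CARD('a) ^ d = CARD('a) ^ Suc k * CARD('a) ^ ?t"
      by (simp_all only: power_add[symmetric])
    then show ?thesis by (simp only: diff_mult_distrib2)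
  qed
  finally have "(CARD('a) ^ d - CARD('a) ^ ?t) * card ?F = (CARD('a) ^ d - CARD('a) ^ ?t) * CARD('a) ^ (Suc (Suc k) choose 2)"
    by (simp only: choose_two_Suc[of "Suc k"] power_add mult.assoc mult.commute mult.left_commute)
  moreover have "CARD('a) ^ ?t < CARD('a) ^ d" using t q_gt_1 by (intro power_strict_increasing) auto
  ultimately show ?case using t by simp
qed

text \<open>
  The number of generators of a parabolic quadric of rank \<open>d - r\<close>, the residue of an \<open>r\<close>-space.
\<close>

definition gens_above :: "nat \<Rightarrow> nat" where
  "gens_above r = (\<Prod>i\<in>{1..d - r}. CARD('a) ^ i + 1)"

lemma gens_above_rec: "r < d \<Longrightarrow> gens_above r = gens_above (Suc r) * (CARD('a) ^ (d - r) + 1)"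
proof -
  assume "r < d"
  then have "d - r = Suc (d - Suc r)" by simp
  then show ?thesis by (simp add: gens_above_def)
qed

lemma gens_above_pos: "gens_above r > 0"
  by (auto simp: gens_above_def intro!: prod_pos)

text \<open>
  The same double count of pairs of a generator and a vector as for the opposite generators.
\<close>

lemma card_gens_above:
  assumes "sing S"
  shows "card {z. gen z \<and> S \<subseteq> z} = gens_above (vec.dim S)"
  using assms
proof (induction "d - vec.dim S" arbitrary: S)
  case 0
  then have "gen S" using sing_dim_le[of S] by (simp add: gen_def)
  moreover have "z = S" if "gen z" "S \<subseteq> z" for z
    using gen_eqI[OF \<open>gen S\<close> that] by simp
  ultimately have "{z. gen z \<and> S \<subseteq> z} = {S}" using 0 by auto
  then show ?case using 0 by (simp add: gens_above_def)
next
  case (Suc k)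
  let ?t = "vec.dim S"
  let ?F = "{z. gen z \<and> S \<subseteq> z}"
  let ?V = "{v\<in>perp S. Q v = 0} - S"
  have t: "?t < d" "d - ?t = Suc k" using Suc by auto
  have "card ?F * (CARD('a) ^ d - CARD('a) ^ ?t) = card ?V * gens_above (Suc ?t)"
  proof (rule double_count[where r = "\<lambda>z v. v \<in> z"])
    fix z assume z: "z \<in> ?F"
    then have "z \<subseteq> {v\<in>perp S. Q v = 0}"
      using sing_perp[of z] perp_antimono[of S z] by (auto simp: gen_def sing_def)
    then have "{v\<in>?V. v \<in> z} = z - S" by auto
    then show "card {v\<in>?V. v \<in> z} = CARD('a) ^ d - CARD('a) ^ ?t"
      using z card_gen[of z] card_subspace[OF sing_subspace[OF Suc.prems]]
      by (auto simp: card_Diff_subset)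
  next
    fix v assume v: "v \<in> ?V"
    then have vS: "v \<in> perp S" "Q v = 0" "v \<notin> S" by auto
    note ext = extend_by_vector[OF Suc.prems(1) vS]
    have "{z\<in>?F. v \<in> z} = {z. gen z \<and> join S (vec.span {v}) \<subseteq> z}"
      using ext(3) gen_subspace by blast
    then show "card {z\<in>?F. v \<in> z} = gens_above (Suc ?t)"
      using Suc.hyps(1)[of "join S (vec.span {v})"] ext(1,2) t by simp
  qed auto
  also have "card ?V = CARD('a) ^ (2 * d - ?t) - CARD('a) ^ ?t"
  proof -
    have "S \<subseteq> {v\<in>perp S. Q v = 0}" using Suc.prems sing_perp by (auto simp: sing_def)
    then show ?thesis
      using card_singular_perp[OF Suc.prems] card_subspace[OF sing_subspace[OF Suc.prems]]
      by (simp add: card_Diff_subset)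
  qed
  also have "\<dots> = (CARD('a) ^ d - CARD('a) ^ ?t) * (CARD('a) ^ (d - ?t) + 1)"
  proof -
    have "(CARD('a) ^ d - CARD('a) ^ ?t) * (CARD('a) ^ (d - ?t) + 1) =
        (CARD('a) ^ (2 * d - ?t) - CARD('a) ^ d) + (CARD('a) ^ d - CARD('a) ^ ?t)"
    proof -
      have "CARD('a) ^ d * CARD('a) ^ (d - ?t) = CARD('a) ^ (2 * d - ?t)" "CARD('a) ^ ?t * CARD('a) ^ (d - ?t) = CARD('a) ^ d"
        using t(1) by (simp_all only: power_add[symmetric]) (simp_all add: mult_2)
      then show ?thesis by (simp add: distrib_left diff_mult_distrib)
    qed
    moreover have "CARD('a) ^ ?t \<le> CARD('a) ^ d" "CARD('a) ^ d \<le> CARD('a) ^ (2 * d - ?t)"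
      using t q_gt_1 by (auto intro!: power_increasing)
    ultimately show ?thesis by simp
  qed
  finally have "(CARD('a) ^ d - CARD('a) ^ ?t) * card ?F = (CARD('a) ^ d - CARD('a) ^ ?t) * gens_above ?t"
    by (simp only: gens_above_rec[OF t(1)] mult.assoc mult.commute mult.left_commute)
  moreover have "CARD('a) ^ ?t < CARD('a) ^ d" using t q_gt_1 by (intro power_strict_increasing) auto
  ultimately show ?case by simp
qed

text \<open>
  Adjacency in the dual polar graph.
\<close>

definition nbrs :: "('a^'n) set \<Rightarrow> ('a^'n) set set" where
  "nbrs g = {y. gen y \<and> vec.dim (y \<inter> g) + 1 = d}"

lemma nbrs_gen: "y \<in> nbrs g \<Longrightarrow> gen y" by (simp add: nbrs_def)

lemma nbrs_inter_eq:
  assumes "gen g" "y \<in> nbrs g" "vec.subspace p" "p \<subseteq> g" "p \<subseteq> y" "vec.dim p + 1 = d"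
  shows "y \<inter> g = p"
  using assms by (intro subspace_eqI[symmetric]) (auto simp: nbrs_def gen_subspace vec.subspace_inter)

lemma nbrs_iff_contains:
  assumes "gen g" "gen y" "vec.subspace p" "p \<subseteq> g" "vec.dim p + 1 = d" "p \<subseteq> y"
  shows "y \<in> nbrs g \<longleftrightarrow> y \<noteq> g"
proof
  assume "y \<noteq> g"
  then have "y \<inter> g \<subset> y" using gen_eqI[of y g] assms by auto
  then have "vec.dim (y \<inter> g) < d"
    using dim_strict_mono[of "y \<inter> g" y] assms by (simp add: gen_def sing_def vec.subspace_inter)
  moreover have "vec.dim p \<le> vec.dim (y \<inter> g)" using assms by (intro vec.dim_subset) auto
  ultimately show "y \<in> nbrs g" using assms by (simp add: nbrs_def)
qed (use assms in \<open>auto simp: nbrs_def gen_def\<close>)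

text \<open>
  The axiom of polar spaces that relates a point and a generator. The neighbour is the projection of
  \<open>g\<close> onto the point.
\<close>

lemma unique_nbr_through:
  assumes g: "gen g" and v: "Q v = 0" "v \<notin> g"
  shows "{y \<in> nbrs g. v \<in> y} = {join (vec.span {v}) (g \<inter> perp (vec.span {v}))}"
    and "vec.dim (g \<inter> perp (vec.span {v})) + 1 = d"
proof -
  let ?v = "vec.span {v}" let ?p = "g \<inter> perp ?v" let ?J = "join ?v ?p"
  have sub: "vec.subspace ?p" using g by (simp add: gen_subspace vec.subspace_inter subspace_perp)
  have "?v \<inter> g = {0}"
  proof -
    have "x = 0" if x: "x \<in> ?v" "x \<in> g" for x
    proof (rule ccontr)
      assume "x \<noteq> 0"
      moreover obtain k where k: "x = k *s v" using x by (auto simp: vec.span_singleton)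
      ultimately have "v = inverse k *s x" by auto
      then show False using x v vec.subspace_scale[OF gen_subspace[OF g]] by metis
    qed
    then show ?thesis using vec.subspace_0[OF gen_subspace[OF g]] vec.span_zero by auto
  qed
  moreover have "v \<noteq> 0" using v vec.subspace_0[OF gen_subspace[OF g]] by auto
  ultimately show dimp: "vec.dim ?p + 1 = d"
    using dim_gen_perp(1)[OF sing_span[OF v(1)] g] by simp
  have J: "gen ?J" by (rule dim_gen_perp(2)[OF sing_span[OF v(1)] g])
  have vJ: "v \<in> ?J" "?p \<subseteq> ?J"
    using join_left[OF sub, of ?v] join_right[OF vec.subspace_span, of ?p] vec.span_base[of v "{v}"] by auto
  then have "?J \<in> nbrs g" using nbrs_iff_contains[OF g J sub _ dimp] v by auto
  moreover have "y = ?J" if y: "y \<in> nbrs g" "v \<in> y" for y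
  proof -
    have gy: "gen y" using y by (simp add: nbrs_def)
    have "y \<inter> g \<subseteq> ?p" using sing_B[OF gen_sing[OF gy] _ y(2)] by (auto simp: perp_span)
    then have "y \<inter> g = ?p" using y dimp g gy sub
      by (intro subspace_eqI) (auto simp: nbrs_def gen_subspace vec.subspace_inter)
    then have "?J \<subseteq> y" using y gen_subspace[OF gy] by (intro join_least vec.span_minimal) auto
    then show ?thesis using gen_eqI[OF J gy] by simp
  qed
  ultimately show "{y \<in> nbrs g. v \<in> y} = {?J}" using vJ by blast
qed

text \<open>
  By \<open>unique_nbr_through\<close> the singular vectors of \<open>p\<^sup>\<bottom>\<close> outside \<open>g\<close> are partitioned by the
  neighbours of \<open>g\<close> through \<open>p\<close>.
\<close>

lemma card_nbrs_above:
  assumes g: "gen g" and p: "vec.subspace p" "p \<subseteq> g" and d: "d \<ge> 1"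
  shows "real (card {y \<in> nbrs g. p \<subseteq> y}) * (real CARD('a) - 1) = real CARD('a) * (real CARD('a) ^ (d - vec.dim p) - 1)"
proof -
  let ?r = "vec.dim p"
  let ?F = "{y \<in> nbrs g. p \<subseteq> y}" and ?V = "{v\<in>perp p. Q v = 0} - g"
  have singp: "sing p" using sing_subset[OF gen_sing[OF g] p] .
  have r: "?r \<le> d" using sing_dim_le[OF singp] .
  have gp: "g \<subseteq> perp p" using sing_perp[OF gen_sing[OF g]] perp_antimono[OF p(2)] by auto
  have "card ?F * (CARD('a) ^ d - CARD('a) ^ (d - 1)) = card ?V * 1"
  proof (rule double_count[where r = "\<lambda>z v. v \<in> z"])
    fix y assume y: "y \<in> ?F"
    then have "y \<subseteq> {v\<in>perp p. Q v = 0}"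
      using sing_perp[of y] perp_antimono[of p y] by (auto simp: nbrs_def gen_def sing_def)
    then have "{v\<in>?V. v \<in> y} = y - (y \<inter> g)" by auto
    moreover have "card (y \<inter> g) = CARD('a) ^ (d - 1)"
      using y g card_subspace[of "y \<inter> g"] by (auto simp: nbrs_def gen_subspace vec.subspace_inter)
    ultimately show "card {v\<in>?V. v \<in> y} = CARD('a) ^ d - CARD('a) ^ (d - 1)"
      using y card_gen[of y] by (simp add: card_Diff_subset nbrs_def)
  next
    fix v assume v: "v \<in> ?V"
    let ?J = "join (vec.span {v}) (g \<inter> perp (vec.span {v}))"
    have u: "{y \<in> nbrs g. v \<in> y} = {?J}" using unique_nbr_through(1)[OF g, of v] v by auto
    have "p \<subseteq> g \<inter> perp (vec.span {v})"
      using v p perp_commute[of p "vec.span {v}"] vec.span_minimal[of "{v}" "perp p"] subspace_perp by auto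
    also have "\<dots> \<subseteq> ?J" by (rule join_right) simp
    finally have "{y\<in>?F. v \<in> y} = {?J}" using u by blast
    then show "card {y\<in>?F. v \<in> y} = 1" by simp
  qed auto
  also have "card ?V = CARD('a) ^ (2 * d - ?r) - CARD('a) ^ d"
    using card_singular_perp[OF singp] gp card_gen[OF g] g
    by (subst card_Diff_subset) (auto simp: gen_def sing_def)
  finally have eq: "card ?F * (CARD('a) ^ d - CARD('a) ^ (d - 1)) = CARD('a) ^ (2 * d - ?r) - CARD('a) ^ d" by simp
  have le: "CARD('a) ^ (d - 1) \<le> CARD('a) ^ d" "CARD('a) ^ d \<le> CARD('a) ^ (2 * d - ?r)"
    using r q_gt_1 by (auto intro!: power_increasing)
  have "real (card ?F) * (real CARD('a) ^ d - real CARD('a) ^ (d - 1)) = real CARD('a) ^ (2 * d - ?r) - real CARD('a) ^ d"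
    using arg_cong[OF eq, of real] le by (simp add: of_nat_diff)
  moreover have "real CARD('a) ^ d = real CARD('a) * real CARD('a) ^ (d - 1)" using d by (metis power_eq_if not_one_le_zero)
  moreover have "real CARD('a) ^ (2 * d - ?r) = real CARD('a) ^ d * real CARD('a) ^ (d - ?r)"
    using r by (simp add: power_add[symmetric] mult_2)
  ultimately have "real CARD('a) ^ (d - 1) * (real (card ?F) * (real CARD('a) - 1)) =
      real CARD('a) ^ (d - 1) * (real CARD('a) * (real CARD('a) ^ (d - ?r) - 1))"
    by (simp add: algebra_simps)
  then show ?thesis using q_gt_1 by simp
qed

lemma card_nbrs_above_hyperplane:
  assumes "gen g" "vec.subspace p" "p \<subseteq> g" "vec.dim p + 1 = d"
  shows "card {y \<in> nbrs g. p \<subseteq> y} = CARD('a)"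
proof -
  have "d - vec.dim p = 1" "d \<ge> 1" using assms by auto
  then have "real (card {y \<in> nbrs g. p \<subseteq> y}) * (real CARD('a) - 1) = real CARD('a) * (real CARD('a) - 1)"
    using card_nbrs_above[OF assms(1-3)] by simp
  then show ?thesis using q_gt_1 by simp
qed

definition hyperplanes :: "('a^'n) set \<Rightarrow> ('a^'n) set \<Rightarrow> ('a^'n) set set" where
  "hyperplanes p g = {h. vec.subspace h \<and> p \<subseteq> h \<and> h \<subseteq> g \<and> vec.dim h + 1 = d}"

text \<open>
  Every neighbour of \<open>g\<close> meets \<open>g\<close> in one hyperplane, and every hyperplane lies on \<open>q\<close> neighbours.
\<close>

lemma card_hyperplanes:
  assumes g: "gen g" and p: "vec.subspace p" "p \<subseteq> g" and d: "d \<ge> 1"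
  shows "real (card (hyperplanes p g)) * (real CARD('a) - 1) = real CARD('a) ^ (d - vec.dim p) - 1"
proof -
  let ?F = "{y \<in> nbrs g. p \<subseteq> y}"
  have "card ?F * 1 = card (hyperplanes p g) * CARD('a)"
  proof (rule double_count[where r = "\<lambda>y h. h \<subseteq> y"])
    fix y assume y: "y \<in> ?F"
    have "{h \<in> hyperplanes p g. h \<subseteq> y} = {y \<inter> g}"
    proof -
      have "h = y \<inter> g" if "h \<in> hyperplanes p g" "h \<subseteq> y" for h
        using nbrs_inter_eq[OF g, of y h] y that by (auto simp: hyperplanes_def)
      moreover have "y \<inter> g \<in> hyperplanes p g"
        using y g p by (auto simp: hyperplanes_def nbrs_def gen_subspace vec.subspace_inter)
      ultimately show ?thesis by blast
    qed
    then show "card {h \<in> hyperplanes p g. h \<subseteq> y} = 1" by simp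
  next
    fix h assume h: "h \<in> hyperplanes p g"
    then have "{y\<in>?F. h \<subseteq> y} = {y \<in> nbrs g. h \<subseteq> y}" by (auto simp: hyperplanes_def)
    then show "card {y\<in>?F. h \<subseteq> y} = CARD('a)"
      using card_nbrs_above_hyperplane[OF g, of h] h by (simp add: hyperplanes_def)
  qed auto
  then have "real (card (hyperplanes p g)) * real CARD('a) = real (card ?F)" by (simp add: mult.commute flip: of_nat_mult)
  then have "real CARD('a) * (real (card (hyperplanes p g)) * (real CARD('a) - 1)) = real CARD('a) * (real CARD('a) ^ (d - vec.dim p) - 1)"
    using card_nbrs_above[OF g p d] by (simp add: algebra_simps)
  then show ?thesis using q_gt_1 by simp
qed


section \<open>The spectrum of the opposition operator\<close>

text \<open>
  Real functions on the generators are vectors indexed by all sets of vectors, with value 0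
  outside the generators. This makes them a Euclidean space, in which orthogonal projections exist.
\<close>

definition pencil :: "('a^'n) set \<Rightarrow> real ^ (('a^'n) set)" where
  "pencil S = (\<chi> y. if gen y \<and> S \<subseteq> y then 1 else 0)"

text \<open>
  The adjacency operator of the graph in which two generators are joined if they are disjoint.
\<close>

definition opp :: "real ^ (('a^'n) set) \<Rightarrow> real ^ (('a^'n) set)" where
  "opp f = (\<chi> y. if gen y then (\<Sum>z | gen z \<and> z \<inter> y = {0}. f $ z) else 0)"

text \<open>
  An increasing filtration: it starts with 0, its first step is spanned by the constant function, its
  second step is spanned by this function and the point pencils, and step \<open>Suc d\<close> contains all functions on the
  generators.
\<close>

definition low :: "nat \<Rightarrow> (real ^ (('a^'n) set)) set" where
  "low t = span {pencil R |R. sing R \<and> vec.dim R < t}"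

text \<open>
  The eigenvalue of the opposition operator on the orthogonal complement of \<open>low t\<close> in
  \<open>low (Suc t)\<close>.
\<close>

definition opp_eigenval :: "nat \<Rightarrow> real" where
  "opp_eigenval t = (-1) ^ t * real CARD('a) ^ ((Suc (d - t) choose 2) + (t choose 2))"

text \<open>
  The largest absolute value of an eigenvalue on functions of sum zero; it is attained for
  \<open>t = 1\<close> and \<open>t = d\<close>.
\<close>

definition lam :: real where "lam = real CARD('a) ^ (d choose 2)"

lemma lam_pos: "lam > 0" using q_gt_1 by (simp add: lam_def)

lemma linear_opp: "linear opp"
  by (rule linearI) (simp_all add: opp_def vec_eq_iff sum.distrib sum_distrib_left)

lemma opp_symmetric: "opp f \<bullet> g = f \<bullet> opp g"
proof -
  have if_sum: "(\<Sum>y\<in>UNIV. if gen y then h y else 0) = (\<Sum>y | gen y. h y)" for h :: "_ \<Rightarrow> real"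
    by (simp add: sum.If_cases)
  have "opp f \<bullet> g = (\<Sum>y | gen y. \<Sum>z | z \<in> {z. gen z} \<and> z \<inter> y = {0}. f $ z * g $ y)"
    by (simp add: inner_vec_def opp_def if_distrib[of "\<lambda>x. x * _"] if_sum sum_distrib_right
        cong: if_cong)
  also have "\<dots> = (\<Sum>z | gen z. \<Sum>y | y \<in> {y. gen y} \<and> z \<inter> y = {0}. f $ z * g $ y)"
    by (rule sum.swap_restrict) simp_all
  also have "\<dots> = f \<bullet> opp g"
    by (simp add: inner_vec_def opp_def if_distrib[of "\<lambda>x. _ * x"] if_sum sum_distrib_left
        Int_commute cong: if_cong)
  finally show ?thesis .
qed

text \<open>
  At a generator \<open>y\<close> the left-hand side counts the generators through \<open>S\<close> that are disjoint from \<open>y\<close>.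
  The count is a constant if \<open>S \<inter> y = 0\<close>, and zero otherwise. Moebius inversion over the subspaces of
  \<open>S\<close> that lie in \<open>y\<close> expresses this indicator by pencils.
\<close>

lemma opp_pencil:
  assumes S: "sing S"
  shows "opp (pencil S) = real CARD('a) ^ (Suc (d - vec.dim S) choose 2) *\<^sub>R
    (\<Sum>R | vec.subspace R \<and> R \<subseteq> S. subspace_moebius TYPE('a) (vec.dim R) *\<^sub>R pencil R)"
proof (rule vec_eq_iff[THEN iffD2], rule allI)
  fix y
  let ?\<mu> = "\<lambda>R. subspace_moebius TYPE('a) (vec.dim R)"
  let ?c = "real CARD('a) ^ (Suc (d - vec.dim S) choose 2)"
  show "opp (pencil S) $ y =
    (?c *\<^sub>R (\<Sum>R | vec.subspace R \<and> R \<subseteq> S. ?\<mu> R *\<^sub>R pencil R)) $ y"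
  proof (cases "gen y")
    case False
    then show ?thesis by (simp add: opp_def pencil_def)
  next
    case True
    have sub: "vec.subspace (S \<inter> y)" using S True
      by (simp add: sing_subspace gen_subspace vec.subspace_inter)
    have "opp (pencil S) $ y = real (card {z. gen z \<and> S \<subseteq> z \<and> z \<inter> y = {0}})"
      using True by (simp add: opp_def pencil_def sum.If_cases Int_def conj_ac)
    also have "\<dots> = (if S \<inter> y = {0} then ?c else 0)"
    proof (cases "S \<inter> y = {0}")
      case True
      with card_opposite_above[OF S \<open>gen y\<close>] show ?thesis by simp
    next
      case False
      have "S \<inter> y = {0}" if "S \<subseteq> z" "z \<inter> y = {0}" for z
        using that vec.subspace_0[OF sub] by blast
      with False have none: "{z. gen z \<and> S \<subseteq> z \<and> z \<inter> y = {0}} = {}" by auto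
      show ?thesis using False unfolding none by simp
    qed
    also have "\<dots> = ?c * (\<Sum>R | vec.subspace R \<and> R \<subseteq> S \<inter> y. ?\<mu> R)"
      by (subst sum_subspace_moebius[OF sub]) simp
    also have "(\<Sum>R | vec.subspace R \<and> R \<subseteq> S \<inter> y. ?\<mu> R) =
        (\<Sum>R | vec.subspace R \<and> R \<subseteq> S. if R \<subseteq> y then ?\<mu> R else 0)"
    proof -
      have "{R. vec.subspace R \<and> R \<subseteq> S \<inter> y} = {R. vec.subspace R \<and> R \<subseteq> S} \<inter> {R. R \<subseteq> y}" by auto
      then show ?thesis by (simp add: sum.If_cases)
    qed
    also have "?c * \<dots> = (?c *\<^sub>R (\<Sum>R | vec.subspace R \<and> R \<subseteq> S. ?\<mu> R *\<^sub>R pencil R)) $ y"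
      using True by (simp add: pencil_def if_distrib cong: if_cong)
    finally show ?thesis .
  qed
qed

lemma pencil_in_low: "sing R \<Longrightarrow> vec.dim R < t \<Longrightarrow> pencil R \<in> low t"
  unfolding low_def by (rule span_base) blast

lemma low_mono: "s \<le> t \<Longrightarrow> low s \<subseteq> low t"
  unfolding low_def by (rule span_mono) auto

lemma subspace_low: "subspace (low t)" by (simp add: low_def)

text \<open>
  The opposition operator is triangular with respect to the filtration. As it is also symmetric, its
  diagonal entries are its eigenvalues.
\<close>

lemma opp_pencil_lower:
  assumes S: "sing S"
  shows "opp (pencil S) - opp_eigenval (vec.dim S) *\<^sub>R pencil S \<in> low (vec.dim S)"
proof -
  let ?t = "vec.dim S"
  let ?c = "real CARD('a) ^ (Suc (d - ?t) choose 2)"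
  let ?\<mu> = "\<lambda>R. subspace_moebius TYPE('a) (vec.dim R)"
  let ?L = "{R. vec.subspace R \<and> R \<subseteq> S}"
  have S_in: "S \<in> ?L" using S by (simp add: sing_def)
  have "opp (pencil S) = ?c *\<^sub>R (?\<mu> S *\<^sub>R pencil S + (\<Sum>R\<in>?L - {S}. ?\<mu> R *\<^sub>R pencil R))"
    unfolding opp_pencil[OF S] using S_in by (subst sum.remove[of ?L S]) auto
  also have "\<dots> = opp_eigenval ?t *\<^sub>R pencil S + ?c *\<^sub>R (\<Sum>R\<in>?L - {S}. ?\<mu> R *\<^sub>R pencil R)"
    by (simp add: opp_eigenval_def subspace_moebius_def scaleR_add_right power_add mult_ac)
  finally have "opp (pencil S) - opp_eigenval ?t *\<^sub>R pencil S = ?c *\<^sub>R (\<Sum>R\<in>?L - {S}. ?\<mu> R *\<^sub>R pencil R)"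
    by simp
  moreover have "pencil R \<in> low ?t" if "R \<in> ?L - {S}" for R
    using that S by (intro pencil_in_low dim_strict_mono) (auto intro: sing_subset simp: sing_def)
  ultimately show ?thesis
    by (simp only:) (intro subspace_scale subspace_sum subspace_low)
qed

lemma opp_low: assumes "f \<in> low t" shows "opp f \<in> low t"
  using assms unfolding low_def[of t]
proof (induction rule: span_induct_alt)
  case base
  then show ?case using subspace_0[OF subspace_low] by (simp add: linear_0[OF linear_opp] low_def)
next
  case (step c x y)
  then obtain R where R: "x = pencil R" "sing R" "vec.dim R < t" by blast
  have "opp (pencil R) - opp_eigenval (vec.dim R) *\<^sub>R pencil R \<in> low t"
    using opp_pencil_lower[OF R(2)] low_mono[of "vec.dim R" t] R by auto
  then have "(opp (pencil R) - opp_eigenval (vec.dim R) *\<^sub>R pencil R) + opp_eigenval (vec.dim R) *\<^sub>R pencil R \<in> low t"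
    using R by (intro subspace_add subspace_scale subspace_low pencil_in_low)
  then have "opp x \<in> low t" using R by simp
  then show ?case using step.IH
    by (simp add: linear_add[OF linear_opp] linear_scale[OF linear_opp] low_def span_add span_scale)
qed

lemma opp_low_Suc: assumes "f \<in> low (Suc t)" shows "opp f - opp_eigenval t *\<^sub>R f \<in> low t"
  using assms unfolding low_def[of "Suc t"]
proof (induction rule: span_induct_alt)
  case base
  then show ?case using subspace_0[OF subspace_low] by (simp add: linear_0[OF linear_opp])
next
  case (step c x y)
  then obtain R where R: "x = pencil R" "sing R" "vec.dim R \<le> t" by (auto simp: less_Suc_eq_le)
  have "opp x - opp_eigenval t *\<^sub>R x \<in> low t"
  proof (cases "vec.dim R = t")
    case True
    then show ?thesis using opp_pencil_lower[OF R(2)] R by simp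
  next
    case False
    then have "x \<in> low t" using R pencil_in_low by auto
    then show ?thesis by (intro subspace_diff subspace_scale subspace_low opp_low)
  qed
  then have "c *\<^sub>R (opp x - opp_eigenval t *\<^sub>R x) + (opp y - opp_eigenval t *\<^sub>R y) \<in> low t"
    using step.IH by (intro subspace_add subspace_scale subspace_low)
  then show ?case
    by (simp add: linear_add[OF linear_opp] linear_scale[OF linear_opp] algebra_simps)
qed

lemma choose_two_add: "Suc (a + b) choose 2 = (Suc a choose 2) + (Suc b choose 2) + a * b"
proof (induction b)
  case 0
  then show ?case by (simp add: choose_two_Suc[of 0] numeral_2_eq_2)
next
  case (Suc b)
  then show ?case by (simp add: choose_two_Suc[of "Suc b"] choose_two_Suc[of "Suc (a + b)"])
qed

text \<open>
  The defect \<open>(t - 1) * (d - t)\<close> measures how far the eigenvalue stays below the extreme one.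
\<close>

lemma exponent_split:
  assumes "1 \<le> t" "t \<le> d"
  shows "d choose 2 = (Suc (d - t) choose 2) + (t choose 2) + (t - 1) * (d - t)"
  using choose_two_add[of "t - 1" "d - t"] assms by simp

lemma abs_opp_eigenval_le:
  assumes "1 \<le> t" "t \<le> d" shows "\<bar>opp_eigenval t\<bar> \<le> lam"
  using q_gt_1 exponent_split[OF assms]
  by (auto simp: opp_eigenval_def lam_def abs_mult power_abs intro!: power_increasing)

lemma opp_eigenval_eq_lamD:
  assumes "1 \<le> t" "t \<le> d" and "opp_eigenval t = s * lam" "\<bar>s\<bar> = 1"
  shows "(t = 1 \<or> t = d) \<and> s = (-1) ^ t"
proof -
  let ?e = "(Suc (d - t) choose 2) + (t choose 2)"
  have "\<bar>opp_eigenval t\<bar> = \<bar>s * lam\<bar>" using assms by simp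
  then have "real CARD('a) ^ ?e = real CARD('a) ^ (d choose 2)"
    using assms(4) by (simp add: opp_eigenval_def lam_def abs_mult power_abs)
  then have e: "?e = d choose 2" using q_gt_1 by simp
  then have "(-1) ^ t * lam = s * lam" using assms(3) by (simp add: opp_eigenval_def lam_def)
  then show ?thesis using e exponent_split[OF assms(1,2)] assms lam_pos by auto
qed

lemma low_0: "low 0 = {0}" by (simp add: low_def)

text \<open>
  Climb the filtration: split off from \<open>f\<close> its projection to the previous step. The remainder is an
  eigenvector by triangularity and symmetry, and its image stays orthogonal to the image of the
  projection.
\<close>

lemma norm_opp_le:
  assumes "f \<in> low t" "t \<le> Suc d" "f \<bullet> pencil {0} = 0"
  shows "norm (opp f) \<le> lam * norm f"
  using assms
proof (induction t arbitrary: f)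
  case 0
  then show ?case by (simp add: low_0 linear_0[OF linear_opp])
next
  case (Suc t)
  show ?case
  proof (cases "t = 0")
    case True
    have "{pencil R |R. sing R \<and> vec.dim R < 1} \<subseteq> {pencil {0}}"
      by (auto simp: sing_def vec.subspace_0 dest: subspace_eq_zero_iff[THEN iffD2] intro!: arg_cong[where f = pencil])
    then have "low (Suc t) \<subseteq> span {pencil {0}}" unfolding low_def True by (intro span_mono) simp
    then obtain k where "f = k *\<^sub>R pencil {0}" using Suc.prems by (auto simp: span_singleton)
    then have "f \<bullet> f = 0" using Suc.prems(3) by (simp add: inner_commute)
    then have "f = 0" by simp
    then show ?thesis by (simp add: linear_0[OF linear_opp])
  next
    case False
    obtain a b where ab: "a \<in> span (low t)" "\<And>w. w \<in> span (low t) \<Longrightarrow> orthogonal b w" "f = a + b"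
      using orthogonal_subspace_decomp_exists[of "low t" f] by metis
    have sp: "span (low t) = low t" using subspace_low by (simp add: span_eq_iff)
    have a: "a \<in> low t" and b: "\<And>w. w \<in> low t \<Longrightarrow> b \<bullet> w = 0"
      using ab by (auto simp: sp orthogonal_def)
    have "pencil {0} \<in> low t" using False sing_zero by (intro pencil_in_low) auto
    then have "a \<bullet> pencil {0} = 0" using b Suc.prems(3) ab(3) by (simp add: inner_add_left)
    then have IH: "norm (opp a) \<le> lam * norm a" using Suc a by simp
    have "f - a \<in> low (Suc t)" using Suc.prems(1) a low_mono[of t "Suc t"]
      by (intro subspace_diff subspace_low) auto
    then have "opp b - opp_eigenval t *\<^sub>R b \<in> low t" using opp_low_Suc[of b t] ab(3) by simp
    moreover have "(opp b - opp_eigenval t *\<^sub>R b) \<bullet> w = 0" if "w \<in> low t" for w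
      using b[OF that] b[OF opp_low[OF that]] by (simp add: inner_diff_left opp_symmetric)
    ultimately have "(opp b - opp_eigenval t *\<^sub>R b) \<bullet> (opp b - opp_eigenval t *\<^sub>R b) = 0" by blast
    then have eig: "opp b = opp_eigenval t *\<^sub>R b" by simp
    have "orthogonal a b" using b[OF a] by (simp add: orthogonal_def inner_commute)
    then have nf: "(norm f)\<^sup>2 = (norm a)\<^sup>2 + (norm b)\<^sup>2" using ab(3) norm_add_Pythagorean by metis
    have "orthogonal (opp a) (opp b)" using b[OF opp_low[OF a]]
      by (simp add: orthogonal_def eig inner_commute)
    then have "(norm (opp f))\<^sup>2 = (norm (opp a))\<^sup>2 + (norm (opp b))\<^sup>2"
      using ab(3) norm_add_Pythagorean by (metis linear_add[OF linear_opp])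
    also have "\<dots> \<le> (lam * norm a)\<^sup>2 + (lam * norm b)\<^sup>2"
    proof (intro add_mono power_mono IH)
      show "norm (opp b) \<le> lam * norm b"
        using abs_opp_eigenval_le[of t] Suc.prems False by (simp add: eig mult_right_mono)
    qed auto
    also have "\<dots> = (lam * norm f)\<^sup>2" by (simp add: power_mult_distrib nf distrib_left)
    finally show ?thesis using lam_pos by (meson power2_le_imp_le mult_nonneg_nonneg norm_ge_zero less_imp_le)
  qed
qed

text \<open>
  If \<open>u\<close> is orthogonal to all pencils of smaller subspaces, triangularity and symmetry give
  \<open>\<mu> * (u \<bullet> pencil S) = opp_eigenval (dim S) * (u \<bullet> pencil S)\<close>, so an eigenvector with another
  eigenvalue is orthogonal to the pencil of \<open>S\<close> as well.
\<close>

lemma eigenvector_orthogonal_pencils: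
  assumes eig: "opp u = \<mu> *\<^sub>R u"
    and base: "\<And>S. sing S \<Longrightarrow> vec.dim S < s \<Longrightarrow> u \<bullet> pencil S = 0"
    and ne: "\<And>j. s \<le> j \<Longrightarrow> j < t \<Longrightarrow> opp_eigenval j \<noteq> \<mu>"
  shows "sing S \<Longrightarrow> vec.dim S < t \<Longrightarrow> u \<bullet> pencil S = 0"
proof (induction "vec.dim S" arbitrary: S rule: less_induct)
  case less
  show ?case
  proof (cases "vec.dim S < s")
    case False
    let ?w = "opp (pencil S) - opp_eigenval (vec.dim S) *\<^sub>R pencil S"
    have "orthogonal u ?w"
    proof (rule orthogonal_to_span)
      show "?w \<in> span {pencil R |R. sing R \<and> vec.dim R < vec.dim S}"
        using opp_pencil_lower[OF less.prems(1)] by (simp add: low_def)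
    qed (use less in \<open>auto simp: orthogonal_def\<close>)
    then have "\<mu> * (u \<bullet> pencil S) = opp_eigenval (vec.dim S) * (u \<bullet> pencil S)"
      by (simp add: orthogonal_def inner_diff_right opp_symmetric[symmetric] eig)
    then show ?thesis using ne[of "vec.dim S"] False less.prems by auto
  qed (use base less in auto)
qed

text \<open>
  The vectors that represent functions on the generators.
\<close>

definition supported :: "real ^ (('a^'n) set) \<Rightarrow> bool" where
  "supported f \<longleftrightarrow> (\<forall>y. \<not> gen y \<longrightarrow> f $ y = 0)"

lemma inner_pencil: "f \<bullet> pencil S = (\<Sum>y | gen y \<and> S \<subseteq> y. f $ y)"
  by (simp add: inner_vec_def pencil_def if_distrib[of "\<lambda>x. _ * x"] sum.If_cases cong: if_cong)

lemma inner_pencil_gen: assumes "gen y" shows "f \<bullet> pencil y = f $ y"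
proof -
  have "{z. gen z \<and> y \<subseteq> z} = {y}" using gen_eqI[OF assms] assms by auto
  then show ?thesis by (simp add: inner_pencil)
qed

lemma supported_low: "f \<in> low t \<Longrightarrow> supported f"
  unfolding low_def
  by (induction rule: span_induct_alt) (auto simp: supported_def pencil_def)

lemma supported_in_low: assumes "supported f" shows "f \<in> low (Suc d)"
proof -
  have eq: "f = (\<Sum>y | gen y. f $ y *\<^sub>R pencil y)"
  proof (rule vec_eq_iff[THEN iffD2], rule allI)
    fix z
    have "(\<Sum>y | gen y. f $ y *\<^sub>R pencil y) $ z = (\<Sum>y | gen y. if z = y then f $ y else 0)"
    proof -
      have "(f $ y *\<^sub>R pencil y) $ z = (if z = y then f $ y else 0)" if "gen y" for y
        using gen_eqI[OF that, of z] that by (auto simp: pencil_def)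
      then show ?thesis by simp
    qed
    also have "\<dots> = f $ z" using assms by (simp add: supported_def)
    finally show "f $ z = (\<Sum>y | gen y. f $ y *\<^sub>R pencil y) $ z" by simp
  qed
  have mem: "f $ y *\<^sub>R pencil y \<in> low (Suc d)" if "gen y" for y
    using that by (intro subspace_scale subspace_low pencil_in_low) (auto simp: gen_def)
  show ?thesis by (subst eq, rule subspace_sum[OF subspace_low]) (simp add: mem)
qed

lemma supported_eq_zero:
  assumes "supported f" "\<And>S. sing S \<Longrightarrow> vec.dim S < Suc d \<Longrightarrow> f \<bullet> pencil S = 0"
  shows "f = 0"
proof (rule vec_eq_iff[THEN iffD2], rule allI)
  fix y
  show "f $ y = 0 $ y"
    using assms(1) assms(2)[of y] inner_pencil_gen[of y f] by (cases "gen y") (auto simp: supported_def gen_def)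
qed

text \<open>
  In the residue of \<open>p\<close> a combination of point pencils is, up to a constant, an eigenvector of
  adjacency, and the constant is determined by the sum of the values over the residue. Both sides are linear in \<open>f\<close>, so it suffices to compare them on the pencil of
  a point. The cases are: the point lies in \<open>p\<close>; in \<open>g\<close> but not in \<open>p\<close>; in \<open>p\<^sup>\<bottom>\<close> but not in \<open>g\<close>;
  or it is not orthogonal to \<open>p\<close>. The constant function is covered by the first case.
\<close>

lemma nbr_sum_identity:
  assumes f: "f \<in> low 2" and g: "gen g" and p: "vec.subspace p" "p \<subseteq> g" "vec.dim p < d"
  shows "(real CARD('a) - 1) * (\<Sum>y | y \<in> nbrs g \<and> p \<subseteq> y. f $ y) =
    (real CARD('a) ^ (d - vec.dim p) - 2 * real CARD('a) + 1) * f $ g +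
    (real CARD('a) - 1) * ((\<Sum>y | gen y \<and> p \<subseteq> y. f $ y) / real (gens_above (Suc (vec.dim p))))"
  using f unfolding low_def
proof (induction rule: span_induct_alt)
  case base
  then show ?case by simp
next
  case (step c x f)
  let ?r = "vec.dim p"
  let ?N = "real (gens_above (Suc ?r))"
  let ?I = "\<lambda>f. (real CARD('a) - 1) * (\<Sum>y | y \<in> nbrs g \<and> p \<subseteq> y. f $ y) =
    (real CARD('a) ^ (d - vec.dim p) - 2 * real CARD('a) + 1) * f $ g +
    (real CARD('a) - 1) * ((\<Sum>y | gen y \<and> p \<subseteq> y. f $ y) / ?N)"
  have d: "d \<ge> 1" "d - ?r = Suc (d - Suc ?r)" using p by auto
  have N: "?N > 0" using gens_above_pos by simp
  have singp: "sing p" using sing_subset[OF gen_sing[OF g] p(1,2)] .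
  obtain S where S: "x = pencil S" "sing S" "vec.dim S < 2" using step by blast
  have nb: "(\<Sum>y | y \<in> nbrs g \<and> p \<subseteq> y. pencil S $ y) = real (card {y \<in> nbrs g. p \<subseteq> y \<and> S \<subseteq> y})"
    using nbrs_gen by (auto simp: pencil_def sum.If_cases Int_def intro!: arg_cong[where f = card])
  have tot: "(\<Sum>y | gen y \<and> p \<subseteq> y. pencil S $ y) = real (card {y. gen y \<and> p \<subseteq> y \<and> S \<subseteq> y})"
    by (auto simp: pencil_def sum.If_cases Int_def intro!: arg_cong[where f = card])
  have "?I (pencil S)"
  proof (cases "S \<subseteq> p")
    case True
    then have "{y \<in> nbrs g. p \<subseteq> y \<and> S \<subseteq> y} = {y \<in> nbrs g. p \<subseteq> y}"
      "{y. gen y \<and> p \<subseteq> y \<and> S \<subseteq> y} = {y. gen y \<and> p \<subseteq> y}" by auto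
    moreover have "pencil S $ g = 1" using True p g by (auto simp: pencil_def)
    moreover have "real (gens_above ?r) / ?N = real CARD('a) ^ (d - ?r) + 1"
      using gens_above_rec[OF p(3)] N by (simp add: field_simps)
    ultimately show ?thesis
      using card_nbrs_above[OF g p(1,2) d(1)] card_gens_above[OF singp]
      by (simp add: nb tot) (simp add: algebra_simps)
  next
    case False
    then obtain v where v: "v \<in> S" "v \<notin> p" by blast
    then have "v \<noteq> 0" using vec.subspace_0[OF p(1)] by auto
    have "vec.span {v} = S"
      using S v \<open>v \<noteq> 0\<close> by (intro subspace_eqI vec.span_minimal) (auto simp: sing_def)
    then have S_sub: "S \<subseteq> y \<longleftrightarrow> v \<in> y" if "gen y" for y
      using that v vec.span_minimal[of "{v}" y] gen_subspace by auto
    have Qv: "Q v = 0" using S v by (simp add: sing_def)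
    have nb': "{y \<in> nbrs g. p \<subseteq> y \<and> S \<subseteq> y} = {y \<in> nbrs g. p \<subseteq> y \<and> v \<in> y}"
      and tot': "{y. gen y \<and> p \<subseteq> y \<and> S \<subseteq> y} = {y. gen y \<and> p \<subseteq> y \<and> v \<in> y}"
      using S_sub nbrs_gen by auto
    have gS: "pencil S $ g = (if v \<in> g then 1 else 0)" using g S_sub[OF g] by (simp add: pencil_def)
    show ?thesis
    proof (cases "v \<in> perp p")
      case True
      note ext = extend_by_vector[OF singp True Qv v(2)]
      let ?p = "join p (vec.span {v})"
      have "{y. gen y \<and> p \<subseteq> y \<and> v \<in> y} = {y. gen y \<and> ?p \<subseteq> y}"
        using ext(3) gen_subspace by blast
      then have tot1: "real (card {y. gen y \<and> p \<subseteq> y \<and> S \<subseteq> y}) / ?N = 1"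
        using card_gens_above[OF ext(1)] ext(2) tot' N by simp
      show ?thesis
      proof (cases "v \<in> g")
        case True
        have "{y \<in> nbrs g. p \<subseteq> y \<and> v \<in> y} = {y \<in> nbrs g. ?p \<subseteq> y}"
          using ext(3) gen_subspace nbrs_gen by blast
        moreover have "?p \<subseteq> g" using True p g ext(3)[of g] by (simp add: gen_subspace)
        ultimately have "real (card {y \<in> nbrs g. p \<subseteq> y \<and> S \<subseteq> y}) * (real CARD('a) - 1) =
            real CARD('a) * (real CARD('a) ^ (d - Suc ?r) - 1)"
          using card_nbrs_above[OF g sing_subspace[OF ext(1)] _ d(1)] ext(2) nb' by simp
        then show ?thesis unfolding nb tot tot1 gS using True d(2)
          by (simp add: algebra_simps)
      next
        case False
        let ?J = "join (vec.span {v}) (g \<inter> perp (vec.span {v}))"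
        have u: "{y \<in> nbrs g. v \<in> y} = {?J}" by (rule unique_nbr_through(1)[OF g Qv False])
        have "p \<subseteq> g \<inter> perp (vec.span {v})"
          using True p perp_commute[of p "vec.span {v}"] vec.span_minimal[of "{v}" "perp p"]
            subspace_perp by auto
        also have "\<dots> \<subseteq> ?J" by (rule join_right) simp
        finally have "{y \<in> nbrs g. p \<subseteq> y \<and> v \<in> y} = {?J}" using u by blast
        then have "card {y \<in> nbrs g. p \<subseteq> y \<and> S \<subseteq> y} = 1" using nb' by simp
        then show ?thesis unfolding nb tot tot1 gS using False by simp
      qed
    next
      case False
      have "\<not> (p \<subseteq> y \<and> v \<in> y)" if "gen y" for y
        using False sing_B[OF gen_sing[OF that]] by (auto simp: perp_def)
      then have "{y \<in> nbrs g. p \<subseteq> y \<and> v \<in> y} = {}" "{y. gen y \<and> p \<subseteq> y \<and> v \<in> y} = {}"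
        using nbrs_gen by blast+
      moreover have "v \<notin> g" using False sing_B[OF gen_sing[OF g]] p by (auto simp: perp_def)
      ultimately show ?thesis by (simp only: nb tot gS nb' tot') simp
    qed
  qed
  then have I: "?I x" using S by simp
  have "(real CARD('a) - 1) * (\<Sum>y | y \<in> nbrs g \<and> p \<subseteq> y. (c *\<^sub>R x + f) $ y) =
    c * ((real CARD('a) - 1) * (\<Sum>y | y \<in> nbrs g \<and> p \<subseteq> y. x $ y)) +
    (real CARD('a) - 1) * (\<Sum>y | y \<in> nbrs g \<and> p \<subseteq> y. f $ y)"
    by (simp add: sum.distrib sum_distrib_left[symmetric] algebra_simps)
  also have "\<dots> = (real CARD('a) ^ (d - vec.dim p) - 2 * real CARD('a) + 1) * (c *\<^sub>R x + f) $ g +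
    (real CARD('a) - 1) * ((\<Sum>y | gen y \<and> p \<subseteq> y. (c *\<^sub>R x + f) $ y) / ?N)"
    unfolding I step.IH
    by (simp add: sum.distrib sum_distrib_left[symmetric] add_divide_distrib algebra_simps)
  finally show ?case .
qed


section \<open>The bound for cross-intersecting pairs\<close>

definition chi :: "('a^'n) set set \<Rightarrow> real ^ (('a^'n) set)" where
  "chi Y = (\<chi> y. if y \<in> Y then 1 else 0)"

lemma chi_inner: "chi Y \<bullet> chi Z = real (card (Y \<inter> Z))"
  by (simp add: chi_def inner_vec_def if_distrib[of "\<lambda>x. x * _"] sum.If_cases Int_def cong: if_cong)

lemma chi_pencil: "Y \<subseteq> {y. gen y} \<Longrightarrow> chi Y \<bullet> pencil S = real (card {y\<in>Y. S \<subseteq> y})"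
  unfolding inner_pencil
  by (auto simp: chi_def sum.If_cases intro!: arg_cong[where f = card])

lemma inter_trivial_iff: "gen y \<Longrightarrow> gen z \<Longrightarrow> y \<inter> z = {0} \<longleftrightarrow> \<not> 1 \<le> vec.dim (y \<inter> z)"
  using subspace_eq_zero_iff[of "y \<inter> z"] by (simp add: gen_subspace vec.subspace_inter del: vec.dim_eq_0) linarith

text \<open>
  Cross-intersection in the form in which the opposition operator sees it.
\<close>

definition cross :: "('a^'n) set set \<Rightarrow> ('a^'n) set set \<Rightarrow> bool" where
  "cross Y Z \<longleftrightarrow> Y \<subseteq> {y. gen y} \<and> Z \<subseteq> {y. gen y} \<and> (\<forall>y\<in>Y. \<forall>z\<in>Z. y \<inter> z \<noteq> {0})"

lemma cross_commute: "cross Y Z \<Longrightarrow> cross Z Y"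
  unfolding cross_def by (metis Int_commute)

lemma cross_EKR_iff: "cross_EKR {S. sing S} Y Z \<longleftrightarrow> cross Y Z"
proof -
  have "(\<forall>y\<in>Y. \<forall>z\<in>Z. 1 \<le> vec.dim (y \<inter> z)) \<longleftrightarrow> (\<forall>y\<in>Y. \<forall>z\<in>Z. y \<inter> z \<noteq> {0})"
    if "Y \<subseteq> {y. gen y}" "Z \<subseteq> {y. gen y}"
  proof (intro ball_cong refl)
    fix y z assume "y \<in> Y" "z \<in> Z"
    then have "gen y" "gen z" using that by auto
    then show "1 \<le> vec.dim (y \<inter> z) \<longleftrightarrow> y \<inter> z \<noteq> {0}" using inter_trivial_iff by simp
  qed
  then show ?thesis unfolding cross_EKR_def cross_def generators_eq by argo
qed

lemma inner_opp_cross: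
  assumes "cross Y Z" shows "chi Y \<bullet> opp (chi Z) = 0"
proof -
  have "(\<Sum>z | gen z \<and> z \<inter> y = {0}. chi Z $ z) = 0" if "y \<in> Y" for y
    using assms that by (intro sum.neutral) (auto simp: cross_def chi_def Int_commute)
  then show ?thesis unfolding inner_vec_def by (intro sum.neutral) (auto simp: chi_def opp_def)
qed

lemma pencil_zero: "pencil {0} = chi {y. gen y}"
  by (auto simp: pencil_def chi_def vec_eq_iff gen_subspace vec.subspace_0)

lemma opp_pencil_zero:
  assumes "d \<ge> 1" shows "opp (pencil {0}) = (lam * real CARD('a) ^ d) *\<^sub>R pencil {0}"
proof -
  have sub: "{R. vec.subspace R \<and> R \<subseteq> {0::'a^'n}} = {{0}}" using vec.subspace_0 by auto
  show ?thesis unfolding opp_pencil[OF sing_zero] sub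
    by (simp add: subspace_moebius_def numeral_2_eq_2 lam_def choose_two_Suc power_add)
qed

lemma card_gens: "card {y. gen y} = gens_above 0"
proof -
  have "{y. gen y} = {y. gen y \<and> {0} \<subseteq> y}" by (auto simp: gen_subspace vec.subspace_0)
  then show ?thesis using card_gens_above[OF sing_zero] by simp
qed

lemma card_gens_ratio: "d \<ge> 1 \<Longrightarrow> real (card {y. gen y}) = real (gens_above 1) * (real CARD('a) ^ d + 1)"
  using gens_above_rec[of 0] by (simp add: card_gens distrib_left)

text \<open>
  The pairs that show that the spectral bound is attained.
\<close>

lemma cross_pencil:
  assumes "sing p" "vec.dim p = 1"
  shows "cross {y. gen y \<and> p \<subseteq> y} {y. gen y \<and> p \<subseteq> y}"
proof -
  have "p \<noteq> {0}" using assms by (metis less_irrefl subspace_eq_zero_iff sing_subspace zero_less_one)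
  moreover have "0 \<in> p" using assms by (simp add: sing_def vec.subspace_0)
  ultimately show ?thesis by (auto simp: cross_def)
qed

text \<open>
  The spectral bound in normalised form: \<open>a\<close> and \<open>b\<close> are the sizes of the two families in units of a
  point pencil, and \<open>s = q\<^sup>d\<close>. A product of at least 1 forces \<open>a + b \<le> 2\<close>, and equality in the inequality
  of the arithmetic and geometric means.
\<close>

lemma cross_card_rigid:
  fixes a b s :: real
  assumes "s > 1" "a \<ge> 0" "b \<ge> 0" "a * b \<ge> 1" "s\<^sup>2 * (a * b) \<le> (s + 1 - a) * (s + 1 - b)"
  shows "a = 1 \<and> b = 1"
proof -
  have "(s + 1) * ((s - 1) * (a * b)) \<le> (s + 1) * (s + 1 - (a + b))"
    using assms(5) by (simp add: power2_eq_square algebra_simps)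
  then have "(s - 1) * (a * b) \<le> s + 1 - (a + b)" using assms(1) by simp
  moreover have "(s - 1) * 1 \<le> (s - 1) * (a * b)" using assms by (intro mult_left_mono) auto
  ultimately have sum2: "a + b \<le> 2" by simp
  then have "(a + b)\<^sup>2 \<le> 4" using assms power_mono[of "a + b" 2 2] by simp
  moreover have "(a + b)\<^sup>2 = (a - b)\<^sup>2 + 4 * (a * b)" by (simp add: power2_eq_square algebra_simps)
  ultimately have "(a - b)\<^sup>2 \<le> 0" using assms(4) by linarith
  then have "a = b" by simp
  then have "a\<^sup>2 \<ge> 1\<^sup>2" using assms(4) by (simp add: power2_eq_square)
  then have "a \<ge> 1" using assms(2) by (rule power2_le_imp_le)
  then show ?thesis using sum2 \<open>a = b\<close> by simp
qed

lemma card_at_most_gens: "Y \<subseteq> {y. gen y} \<Longrightarrow> real (card Y) \<le> real (card {y. gen y})"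
  by (simp add: card_mono)

text \<open>
  Decompose both indicators into a constant and a part of sum zero. Cross-intersection says that
  \<open>chi Y \<bullet> opp (chi Z)\<close> vanishes, so the constant parts, which contribute the large eigenvalue
  \<open>lam * q\<^sup>d\<close>, must be cancelled by the other parts, on which the operator is bounded by \<open>lam\<close>.
\<close>

lemma max_cross_cards:
  assumes d: "d \<ge> 1" and YZ: "cross Y Z"
    and max: "gens_above 1 * gens_above 1 \<le> card Y * card Z"
  shows "card Y = gens_above 1 \<and> card Z = gens_above 1"
proof -
  define N n s where "N = real (gens_above 1)" and "n = real (card {y. gen y})" and "s = real CARD('a) ^ d"
  define a b where "a = real (card Y)" and "b = real (card Z)"
  define j where "j = pencil {0}"
  have N: "N > 0" using gens_above_pos by (simp add: N_def)
  have s: "s > 1" using q_gt_1 d by (simp add: s_def one_less_power)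
  have n: "n = N * (s + 1)" using card_gens_ratio[OF d] by (simp add: n_def N_def s_def)
  then have n0: "n > 0" using N s by simp
  have sub: "Y \<subseteq> {y. gen y}" "Z \<subseteq> {y. gen y}" using YZ by (auto simp: cross_def)
  have ab_le: "a \<le> n" "b \<le> n" using card_at_most_gens sub by (auto simp: a_def b_def n_def)
  have ab: "a * b \<ge> N * N"
    using max by (simp add: a_def b_def N_def flip: of_nat_mult)
  then have ab0: "a * b > 0" using N by (smt (verit) mult_pos_pos)
  have inn: "chi Y \<bullet> j = a" "chi Z \<bullet> j = b" "j \<bullet> j = n" "chi Y \<bullet> chi Y = a" "chi Z \<bullet> chi Z = b"
    using sub unfolding j_def pencil_zero chi_inner
    by (simp_all add: a_def b_def n_def Int_absorb2)
  let ?y = "chi Y - (a / n) *\<^sub>R j" and ?z = "chi Z - (b / n) *\<^sub>R j"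
  have yj: "?y \<bullet> j = 0" "?z \<bullet> j = 0" using n0 by (simp_all add: inner_diff_left inn)
  have nrm: "(norm ?y)\<^sup>2 = a * (n - a) / n" "(norm ?z)\<^sup>2 = b * (n - b) / n"
  proof -
    have "(chi A - (x / n) *\<^sub>R j) \<bullet> (chi A - (x / n) *\<^sub>R j) = x * (n - x) / n"
      if "chi A \<bullet> j = x" "chi A \<bullet> chi A = x" for A x
      unfolding inner_diff_left inner_diff_right inner_scaleR_left inner_scaleR_right
        inner_commute[of j "chi A"] that inn(3) using n0 by (simp add: field_simps)
    then show "(norm ?y)\<^sup>2 = a * (n - a) / n" "(norm ?z)\<^sup>2 = b * (n - b) / n"
      unfolding power2_norm_eq_inner using inn by blast+
  qed
  have oj: "opp j = (lam * s) *\<^sub>R j" using opp_pencil_zero[OF d] by (simp add: j_def s_def)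
  have "supported ?z" using sub by (auto simp: supported_def chi_def j_def pencil_def)
  then have bound: "norm (opp ?z) \<le> lam * norm ?z"
    using yj(2) by (intro norm_opp_le[OF supported_in_low]) (auto simp: j_def)
  have oz: "opp ?z = opp (chi Z) - (b / n * (lam * s)) *\<^sub>R j"
    by (simp add: linear_diff[OF linear_opp] linear_scale[OF linear_opp] oj)
  have "j \<bullet> opp (chi Z) = lam * s * b"
    unfolding opp_symmetric[symmetric] oj inner_scaleR_left inner_commute[of j "chi Z"] inn by simp
  then have "?y \<bullet> opp ?z = - (lam * s * (a * b) / n)"
    using n0 inner_opp_cross[OF YZ]
    by (simp add: oz inner_diff_left inner_diff_right inn \<open>j \<bullet> opp (chi Z) = lam * s * b\<close> field_simps)
  then have "lam * s * (a * b) / n = \<bar>?y \<bullet> opp ?z\<bar>" using lam_pos s ab0 n0 by simp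
  also have "\<dots> \<le> norm ?y * norm (opp ?z)" by (rule Cauchy_Schwarz_ineq2)
  also have "\<dots> \<le> norm ?y * (lam * norm ?z)" using bound by (intro mult_left_mono) auto
  finally have "(lam * s * (a * b) / n)\<^sup>2 \<le> (norm ?y * (lam * norm ?z))\<^sup>2"
    using lam_pos s ab0 n0 by (intro power_mono) auto
  also have "\<dots> = lam\<^sup>2 * ((norm ?y)\<^sup>2 * (norm ?z)\<^sup>2)" by (simp add: power_mult_distrib)
  also have "\<dots> = lam\<^sup>2 * (a * b * ((n - a) * (n - b))) / n\<^sup>2"
    unfolding nrm by (simp add: power2_eq_square)
  finally have "lam\<^sup>2 * (s\<^sup>2 * (a * b)\<^sup>2) \<le> lam\<^sup>2 * (a * b * ((n - a) * (n - b)))"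
    using n0 by (simp add: power_divide power_mult_distrib divide_le_cancel mult.assoc)
  then have "(a * b) * (s\<^sup>2 * (a * b)) \<le> (a * b) * ((n - a) * (n - b))"
  proof -
    have "lam\<^sup>2 > 0" using lam_pos by simp
    then have "s\<^sup>2 * (a * b)\<^sup>2 \<le> a * b * ((n - a) * (n - b))"
      using \<open>lam\<^sup>2 * (s\<^sup>2 * (a * b)\<^sup>2) \<le> _\<close> mult_le_cancel_left_pos by blast
    then show ?thesis by (simp add: power2_eq_square[of "a * b"] mult_ac)
  qed
  then have "s\<^sup>2 * (a * b) \<le> (n - a) * (n - b)"
    using ab0 mult_le_cancel_left_pos[of "a * b"] by blast
  then have "s\<^sup>2 * (a / N * (b / N)) \<le> (s + 1 - a / N) * (s + 1 - b / N)"
    using N unfolding n by (simp add: field_simps)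
  moreover have "a / N * (b / N) \<ge> 1" using ab N by (simp add: field_simps)
  ultimately have "a / N = 1 \<and> b / N = 1"
    using s N by (intro cross_card_rigid[of s]) (auto simp: a_def b_def)
  then show ?thesis using N by (simp add: a_def b_def N_def)
qed

text \<open>
  Equality in the Cauchy-Schwarz estimate behind the bound. With \<open>y\<close> and \<open>z\<close> the parts of sum zero,
  \<open>opp z + lam * y\<close> has norm 0, because its squared norm is at most
  \<open>lam\<^sup>2 - 2 lam\<^sup>2 + lam\<^sup>2 = 0\<close> times that of \<open>y\<close>.
\<close>

lemma max_cross_opp:
  assumes d: "d \<ge> 1" and YZ: "cross Y Z" and cY: "card Y = gens_above 1" and cZ: "card Z = gens_above 1"
  shows "opp (chi Z) = lam *\<^sub>R (pencil {0} - chi Y)"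
proof -
  define N s where "N = real (gens_above 1)" and "s = real CARD('a) ^ d"
  define j where "j = pencil {0}"
  \<comment> \<open>The mean value of the indicator of a point pencil, and so of \<open>chi Y\<close> and \<open>chi Z\<close>.\<close>
  define c where "c = 1 / (s + 1)"
  have N: "N > 0" using gens_above_pos by (simp add: N_def)
  have s: "s > 1" using q_gt_1 d by (simp add: s_def one_less_power)
  have c: "c * (s + 1) = 1" using s by (simp add: c_def)
  have n: "real (card {y. gen y}) = N * (s + 1)" using card_gens_ratio[OF d] by (simp add: N_def s_def)
  have sub: "Y \<subseteq> {y. gen y}" "Z \<subseteq> {y. gen y}" using YZ by (auto simp: cross_def)
  have inn: "chi Y \<bullet> j = N" "chi Z \<bullet> j = N" "j \<bullet> j = N * (s + 1)" "chi Y \<bullet> chi Y = N" "chi Z \<bullet> chi Z = N"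
    using sub n unfolding j_def pencil_zero chi_inner
    by (simp_all add: N_def Int_absorb2 cY cZ)
  let ?y = "chi Y - c *\<^sub>R j" and ?z = "chi Z - c *\<^sub>R j"
  have cs: "c * (N * (s + 1)) = N" by (simp only: mult.left_commute[of c N] c mult_1_right)
  have yj: "?y \<bullet> j = 0" "?z \<bullet> j = 0" using cs by (simp_all add: inner_diff_left inn)
  have nrm: "?y \<bullet> ?y = N * (1 - c)" "?z \<bullet> ?z = N * (1 - c)"
  proof -
    have "(chi A - c *\<^sub>R j) \<bullet> (chi A - c *\<^sub>R j) = N * (1 - c)"
      if "chi A \<bullet> j = N" "chi A \<bullet> chi A = N" for A
      unfolding inner_diff_left inner_diff_right inner_scaleR_left inner_scaleR_right
        inner_commute[of j "chi A"] that inn(3) cs by (simp add: algebra_simps)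
    then show "?y \<bullet> ?y = N * (1 - c)" "?z \<bullet> ?z = N * (1 - c)" using inn by blast+
  qed
  have oj: "opp j = (lam * s) *\<^sub>R j" using opp_pencil_zero[OF d] by (simp add: j_def s_def)
  have "supported ?z" using sub by (auto simp: supported_def chi_def j_def pencil_def)
  then have bound: "norm (opp ?z) \<le> lam * norm ?z"
    using yj(2) by (intro norm_opp_le[OF supported_in_low]) (auto simp: j_def)
  have oz: "opp ?z = opp (chi Z) - (c * (lam * s)) *\<^sub>R j"
    by (simp add: linear_diff[OF linear_opp] linear_scale[OF linear_opp] oj)
  have jz: "j \<bullet> opp (chi Z) = lam * s * N"
    unfolding opp_symmetric[symmetric] oj inner_scaleR_left inner_commute[of j "chi Z"] inn by simp
  \<comment> \<open>The value forced by cross-intersection meets the Cauchy-Schwarz bound \<open>lam * norm ?y * norm ?z\<close>.\<close>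
  have "?y \<bullet> opp ?z = - (lam * (s * c) * N)"
  proof -
    have "?y \<bullet> opp ?z = ?y \<bullet> opp (chi Z)" by (simp add: oz inner_diff_right yj)
    also have "\<dots> = - (c * (lam * s * N))"
      by (simp add: inner_diff_left inner_opp_cross[OF YZ] jz)
    finally show ?thesis by (simp add: mult_ac)
  qed
  moreover have "s * c = 1 - c" using c by (simp add: algebra_simps)
  ultimately have inz: "?y \<bullet> opp ?z = - (lam * (N * (1 - c)))" by (simp add: mult_ac)
  have "opp ?z \<bullet> opp ?z \<le> lam\<^sup>2 * (?z \<bullet> ?z)"
    using power_mono[OF bound, of 2] by (simp add: power_mult_distrib power2_norm_eq_inner)
  then have "opp ?z \<bullet> opp ?z \<le> lam\<^sup>2 * (N * (1 - c))" by (simp only: nrm)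
  moreover have "(opp ?z + lam *\<^sub>R ?y) \<bullet> (opp ?z + lam *\<^sub>R ?y) =
      opp ?z \<bullet> opp ?z + 2 * lam * (?y \<bullet> opp ?z) + lam\<^sup>2 * (?y \<bullet> ?y)"
    by (simp only: inner_add_left inner_add_right inner_scaleR_left inner_scaleR_right
        inner_commute[of "opp ?z" ?y]) (simp add: power2_eq_square algebra_simps)
  ultimately have "(opp ?z + lam *\<^sub>R ?y) \<bullet> (opp ?z + lam *\<^sub>R ?y) \<le> 0"
    unfolding inz nrm by (simp add: power2_eq_square algebra_simps)
  then have "opp ?z + lam *\<^sub>R ?y = 0" by (metis inner_eq_zero_iff inner_ge_zero order_antisym)
  then have "opp (chi Z) = (lam * (c * (s + 1))) *\<^sub>R j - lam *\<^sub>R chi Y"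
    unfolding oz by (simp add: algebra_simps)
  then show ?thesis unfolding c by (simp add: j_def algebra_simps)
qed

text \<open>
  The difference of the indicators is an eigenvector for \<open>+lam\<close> and has sum zero. For odd \<open>d\<close> both extreme
  eigenvalues, at \<open>t = 1\<close> and \<open>t = d\<close>, are negative.
\<close>

lemma max_cross_odd:
  assumes "odd d" and YZ: "cross Y Z" and c: "card Y = gens_above 1" "card Z = gens_above 1"
  shows "Y = Z"
proof -
  have d: "d \<ge> 1" using assms(1) by (cases d) auto
  let ?u = "chi Y - chi Z"
  have sub: "Y \<subseteq> {y. gen y}" "Z \<subseteq> {y. gen y}" using YZ by (auto simp: cross_def)
  have eig: "opp ?u = lam *\<^sub>R ?u"
    using max_cross_opp[OF d YZ c] max_cross_opp[OF d cross_commute[OF YZ] c(2,1)]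
    by (simp add: linear_diff[OF linear_opp] algebra_simps)
  have one: "?u \<bullet> pencil {0} = 0"
    using c sub unfolding pencil_zero inner_diff_left chi_inner by (simp add: Int_absorb2)
  have base: "?u \<bullet> pencil R = 0" if "sing R" "vec.dim R < 1" for R
    using subspace_eq_zero_iff[OF sing_subspace[OF that(1)]] that(2) one by (metis less_one)
  have ne: "opp_eigenval j \<noteq> lam" if "1 \<le> j" "j < Suc d" for j
    using opp_eigenval_eq_lamD[of j 1] that assms(1) by (auto simp: minus_one_power_iff split: if_splits)
  have orth: "?u \<bullet> pencil S = 0" if "sing S" "vec.dim S < Suc d" for S
    by (rule eigenvector_orthogonal_pencils[OF eig base ne that])
  have "?u = 0"
    using sub by (intro supported_eq_zero orth) (auto simp: supported_def chi_def)
  then show ?thesis by (auto simp: chi_def vec_eq_iff split: if_splits)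
qed

text \<open>
  For even \<open>d\<close> the eigenvalue \<open>+lam\<close> occurs only in the top layer \<open>t = d\<close>, which is orthogonal to the
  pencils of all smaller subspaces.
\<close>

lemma max_cross_even_balanced:
  assumes "even d" "d \<ge> 1" and YZ: "cross Y Z" and c: "card Y = gens_above 1" "card Z = gens_above 1"
    and S: "sing S" "vec.dim S < d"
  shows "card {y\<in>Y. S \<subseteq> y} = card {z\<in>Z. S \<subseteq> z}"
proof -
  let ?u = "chi Y - chi Z"
  have sub: "Y \<subseteq> {y. gen y}" "Z \<subseteq> {y. gen y}" using YZ by (auto simp: cross_def)
  have eig: "opp ?u = lam *\<^sub>R ?u"
    using max_cross_opp[OF assms(2) YZ c] max_cross_opp[OF assms(2) cross_commute[OF YZ] c(2,1)]
    by (simp add: linear_diff[OF linear_opp] algebra_simps)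
  have one: "?u \<bullet> pencil {0} = 0"
    using c sub unfolding pencil_zero inner_diff_left chi_inner by (simp add: Int_absorb2)
  have base: "?u \<bullet> pencil R = 0" if "sing R" "vec.dim R < 1" for R
    using subspace_eq_zero_iff[OF sing_subspace[OF that(1)]] that(2) one by (metis less_one)
  have ne: "opp_eigenval j \<noteq> lam" if "1 \<le> j" "j < d" for j
    using opp_eigenval_eq_lamD[of j 1] that assms(1) by (auto simp: minus_one_power_iff split: if_splits)
  have "?u \<bullet> pencil S = 0"
    by (rule eigenvector_orthogonal_pencils[OF eig base ne S])
  then show ?thesis using chi_pencil[OF sub(1)] chi_pencil[OF sub(2)] by (simp add: inner_diff_left)
qed

text \<open>
  For even \<open>d\<close> the eigenvalue \<open>-lam\<close> occurs only in the layer \<open>t = 1\<close>. The part of the sum orthogonal to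
  \<open>low 2\<close> is again an eigenvector for \<open>-lam\<close>, hence orthogonal to every pencil, hence zero.
\<close>

lemma max_cross_even_sum:
  assumes "even d" "d \<ge> 1" and YZ: "cross Y Z" and c: "card Y = gens_above 1" "card Z = gens_above 1"
  shows "chi Y + chi Z \<in> low 2"
proof -
  define s where "s = real CARD('a) ^ d"
  \<comment> \<open>The mean value of \<open>chi Y + chi Z\<close>, since a point pencil makes up \<open>1 / (s + 1)\<close> of all generators.\<close>
  define k where "k = 2 / (s + 1)"
  define j where "j = pencil {0}"
  let ?v = "chi Y + chi Z - k *\<^sub>R j"
  have s: "s > 1" using q_gt_1 assms(2) by (simp add: s_def one_less_power)
  have k: "k * (s + 1) = 2" using s by (simp add: k_def field_simps)
  have sub: "Y \<subseteq> {y. gen y}" "Z \<subseteq> {y. gen y}" using YZ by (auto simp: cross_def)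
  have oj: "opp j = (lam * s) *\<^sub>R j" using opp_pencil_zero[OF assms(2)] by (simp add: j_def s_def)
  have "opp ?v = opp (chi Y) + opp (chi Z) - k *\<^sub>R opp j"
    by (simp only: linear_diff[OF linear_opp] linear_add[OF linear_opp] linear_scale[OF linear_opp])
  also have "\<dots> = (lam + lam - k * (lam * s)) *\<^sub>R j - lam *\<^sub>R chi Y - lam *\<^sub>R chi Z"
    unfolding max_cross_opp[OF assms(2) YZ c] max_cross_opp[OF assms(2) cross_commute[OF YZ] c(2,1)] oj
      j_def[symmetric]
    by (simp only: scaleR_add_left scaleR_diff_left scaleR_diff_right scaleR_scaleR) simp
  also have "lam + lam - k * (lam * s) = lam * k"
  proof -
    have "lam + lam = lam * (k * (s + 1))" unfolding k by simp
    then show ?thesis by (simp add: algebra_simps)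
  qed
  finally have eig: "opp ?v = - lam *\<^sub>R ?v" by (simp add: algebra_simps)
  have j2: "j \<in> low 2" unfolding j_def using sing_zero by (intro pencil_in_low) auto
  obtain a b where ab: "a \<in> span (low 2)" "\<And>w. w \<in> span (low 2) \<Longrightarrow> orthogonal b w" "?v = a + b"
    using orthogonal_subspace_decomp_exists[of "low 2" ?v] by metis
  have sp: "span (low 2) = low 2" using subspace_low by (simp add: span_eq_iff)
  have a: "a \<in> low 2" and b: "\<And>w. w \<in> low 2 \<Longrightarrow> b \<bullet> w = 0"
    using ab by (auto simp: sp orthogonal_def)
  have "opp a + opp b = - lam *\<^sub>R a - lam *\<^sub>R b"
    using eig unfolding ab(3) by (simp add: linear_add[OF linear_opp] algebra_simps)
  then have "opp a + opp b + (lam *\<^sub>R a + lam *\<^sub>R b) = 0" by simp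
  then have eq: "opp b + lam *\<^sub>R b = - (opp a + lam *\<^sub>R a)"
    unfolding eq_neg_iff_add_eq_0 by (simp add: add_ac)
  have "opp b + lam *\<^sub>R b \<in> low 2" unfolding eq
    using a by (intro subspace_neg subspace_add subspace_scale subspace_low opp_low)
  moreover have "(opp b + lam *\<^sub>R b) \<bullet> w = 0" if "w \<in> low 2" for w
    using b[OF that] b[OF opp_low[OF that]] by (simp add: inner_add_left opp_symmetric)
  ultimately have "(opp b + lam *\<^sub>R b) \<bullet> (opp b + lam *\<^sub>R b) = 0" by blast
  then have "opp b + lam *\<^sub>R b = 0" by simp
  then have eigb: "opp b = - lam *\<^sub>R b" by (simp add: eq_neg_iff_add_eq_0)
  have ne: "opp_eigenval i \<noteq> - lam" if "2 \<le> i" "i < Suc d" for i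
    using opp_eigenval_eq_lamD[of i "-1"] that assms(1) by (auto simp: minus_one_power_iff split: if_splits)
  have orth: "b \<bullet> pencil S = 0" if "sing S" "vec.dim S < Suc d" for S
    by (rule eigenvector_orthogonal_pencils[OF eigb _ ne that]) (auto intro: b pencil_in_low)
  have "supported ?v" using sub by (auto simp: supported_def chi_def j_def pencil_def)
  then have "supported b" using supported_low[OF a] ab(3)
    by (auto simp: supported_def vec_eq_iff)
  then have "b = 0" using orth by (rule supported_eq_zero)
  then have "?v \<in> low 2" using a ab by simp
  then have "?v + k *\<^sub>R j \<in> low 2" using j2 by (intro subspace_add subspace_scale subspace_low)
  then show ?thesis by simp
qed

lemma max_cross_even_nbrs:
  assumes "even d" "d \<ge> 1" and YZ: "cross Y Z" and c: "card Y = gens_above 1" "card Z = gens_above 1"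
    and g: "gen g" and p: "vec.subspace p" "p \<subseteq> g" "vec.dim p < d"
  shows "(real CARD('a) - 1) * real (card {y\<in>Y. y \<in> nbrs g \<and> p \<subseteq> y} + card {z\<in>Z. z \<in> nbrs g \<and> p \<subseteq> z}) =
    (real CARD('a) ^ (d - vec.dim p) - 2 * real CARD('a) + 1) * ((if g \<in> Y then 1 else 0) + (if g \<in> Z then 1 else 0)) +
    (real CARD('a) - 1) * (real (card {y\<in>Y. p \<subseteq> y} + card {z\<in>Z. p \<subseteq> z}) / real (gens_above (Suc (vec.dim p))))"
proof -
  have sub: "Y \<subseteq> {y. gen y}" "Z \<subseteq> {y. gen y}" using YZ by (auto simp: cross_def)
  have 1: "(\<Sum>y | y \<in> nbrs g \<and> p \<subseteq> y. chi A $ y) = real (card {y\<in>A. y \<in> nbrs g \<and> p \<subseteq> y})" for A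
    by (auto simp: chi_def sum.If_cases intro!: arg_cong[where f = card])
  have 2: "(\<Sum>y | gen y \<and> p \<subseteq> y. chi A $ y) = real (card {y\<in>A. p \<subseteq> y})" if "A \<subseteq> {y. gen y}" for A
    using that by (auto simp: chi_def sum.If_cases intro!: arg_cong[where f = card])
  have 3: "chi A $ g = (if g \<in> A then 1 else 0)" for A by (simp add: chi_def)
  show ?thesis
    using nbr_sum_identity[OF max_cross_even_sum[OF assms(1-5)] g p]
    by (simp add: sum.distrib 1 2 3 sub)
qed


section \<open>Extremal pairs and hyperbolic hyperplane sections\<close>

text \<open>
  The combinatorial content of extremality for even \<open>d\<close>, in a form that is symmetric in the two
  families: \<open>chi Y - chi Z\<close> lies in the top layer, and \<open>chi Y + chi Z\<close> lies in the span of the point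
  pencils.
\<close>

definition balanced_pair :: "('a^'n) set set \<Rightarrow> ('a^'n) set set \<Rightarrow> bool" where
  "balanced_pair Y Z \<longleftrightarrow> Y \<subseteq> {y. gen y} \<and> Z \<subseteq> {y. gen y} \<and>
     card Y = gens_above 1 \<and> card Z = gens_above 1 \<and>
     (\<forall>S. sing S \<and> vec.dim S < d \<longrightarrow> card {y\<in>Y. S \<subseteq> y} = card {z\<in>Z. S \<subseteq> z}) \<and>
     (\<forall>g p. gen g \<and> vec.subspace p \<and> p \<subseteq> g \<and> vec.dim p < d \<longrightarrow>
       (real CARD('a) - 1) * real (card {y\<in>Y. y \<in> nbrs g \<and> p \<subseteq> y} + card {z\<in>Z. z \<in> nbrs g \<and> p \<subseteq> z}) =
       (real CARD('a) ^ (d - vec.dim p) - 2 * real CARD('a) + 1) * ((if g \<in> Y then 1 else 0) + (if g \<in> Z then 1 else 0)) +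
       (real CARD('a) - 1) * (real (card {y\<in>Y. p \<subseteq> y} + card {z\<in>Z. p \<subseteq> z}) / real (gens_above (Suc (vec.dim p)))))"

lemma balanced_pair_commute: "balanced_pair Y Z \<Longrightarrow> balanced_pair Z Y"
  unfolding balanced_pair_def by (simp add: add.commute)

lemma balanced_gen: "balanced_pair Y Z \<Longrightarrow> y \<in> Y \<Longrightarrow> gen y" "balanced_pair Y Z \<Longrightarrow> z \<in> Z \<Longrightarrow> gen z"
  by (auto simp: balanced_pair_def)

lemma balanced_card: "balanced_pair Y Z \<Longrightarrow> sing S \<Longrightarrow> vec.dim S < d \<Longrightarrow>
    card {y\<in>Y. S \<subseteq> y} = card {z\<in>Z. S \<subseteq> z}"
  by (simp add: balanced_pair_def)

lemma balanced_nbrs: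
  assumes "balanced_pair Y Z" "gen g" "vec.subspace p" "p \<subseteq> g" "vec.dim p < d"
  shows "(real CARD('a) - 1) * real (card {y\<in>Y. y \<in> nbrs g \<and> p \<subseteq> y} + card {z\<in>Z. z \<in> nbrs g \<and> p \<subseteq> z}) =
    (real CARD('a) ^ (d - vec.dim p) - 2 * real CARD('a) + 1) * ((if g \<in> Y then 1 else 0) + (if g \<in> Z then 1 else 0)) +
    (real CARD('a) - 1) * (real (card {y\<in>Y. p \<subseteq> y} + card {z\<in>Z. p \<subseteq> z}) / real (gens_above (Suc (vec.dim p))))"
  using assms unfolding balanced_pair_def by meson

lemma hyperplanes_mono: "p \<subseteq> p' \<Longrightarrow> hyperplanes p' g \<subseteq> hyperplanes p g"
  by (auto simp: hyperplanes_def)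

lemma hyperplanesD:
  assumes "h \<in> hyperplanes p g"
  shows "vec.subspace h" "p \<subseteq> h" "h \<subseteq> g" "vec.dim h + 1 = d" "h \<in> hyperplanes {0} g"
  using assms by (auto simp: hyperplanes_def vec.subspace_0)

lemma hyperplanesI: "vec.subspace h \<Longrightarrow> h \<subseteq> g \<Longrightarrow> vec.dim h + 1 = d \<Longrightarrow> h \<in> hyperplanes {0} g"
  by (auto simp: hyperplanes_def vec.subspace_0)

lemma nbr_hyperplane: "gen g \<Longrightarrow> y \<in> nbrs g \<Longrightarrow> y \<inter> g \<in> hyperplanes {0} g"
  by (intro hyperplanesI) (auto simp: nbrs_def gen_subspace vec.subspace_inter)

lemma card_nbrs_by_hyperplane:
  assumes g: "gen g" and p: "p \<subseteq> g"
  shows "card {y\<in>A. y \<in> nbrs g \<and> p \<subseteq> y} = (\<Sum>h\<in>hyperplanes p g. card {y\<in>A. y \<in> nbrs g \<and> h \<subseteq> y})"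
proof -
  let ?S = "{y\<in>A. y \<in> nbrs g \<and> p \<subseteq> y}"
  have img: "(\<lambda>y. y \<inter> g) ` ?S \<subseteq> hyperplanes p g"
    using p nbr_hyperplane[OF g] by (auto simp: hyperplanes_def)
  have "card ?S = (\<Sum>h\<in>hyperplanes p g. card {y\<in>?S. y \<inter> g = h})"
    using sum.group[OF _ _ img, of "\<lambda>_. 1::nat"] by simp
  also have "\<dots> = (\<Sum>h\<in>hyperplanes p g. card {y\<in>A. y \<in> nbrs g \<and> h \<subseteq> y})"
  proof (intro sum.cong refl arg_cong[where f = card])
    fix h assume "h \<in> hyperplanes p g"
    note h = hyperplanesD[OF this]
    show "{y\<in>?S. y \<inter> g = h} = {y\<in>A. y \<in> nbrs g \<and> h \<subseteq> y}"
      using nbrs_inter_eq[OF g _ h(1,3) _ h(4)] h(2) by auto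
  qed
  finally show ?thesis .
qed

text \<open>
  Every hyperplane of \<open>g\<close> lies on equally many members of \<open>Y\<close> and of \<open>Z\<close>, so besides \<open>g\<close> it lies on at
  least one member of \<open>Z\<close>. The neighbour count of \<open>g\<close> is just the number of its hyperplanes, which
  leaves no room for more.
\<close>

lemma private_hyperplanes:
  assumes bal: "balanced_pair Y Z" and d: "d \<ge> 1" and gY: "g \<in> Y" "g \<notin> Z"
    and h: "h \<in> hyperplanes {0} g"
  shows "\<exists>z. {y\<in>Y. h \<subseteq> y} = {g} \<and> {z\<in>Z. h \<subseteq> z} = {z} \<and> z \<notin> Y \<and> z \<in> nbrs g"
proof -
  have g: "gen g" using balanced_gen(1)[OF bal gY(1)] .
  let ?H = "hyperplanes {0} g"
  \<comment> \<open>The hyperplane \<open>h\<close> lies on \<open>a h\<close> members of \<open>Y\<close>, one of which is \<open>g\<close>, and on \<open>a h\<close> members of \<open>Z\<close>.\<close>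
  define a where "a h = card {y\<in>Y. h \<subseteq> y}" for h
  have aZ: "card {z\<in>Z. k \<subseteq> z} = a k" if k: "k \<in> ?H" for k
    using balanced_card[OF bal, of k] hyperplanesD[OF k] sing_subset[OF gen_sing[OF g], of k]
    by (simp add: a_def)
  have ge: "a k \<ge> 1" if k: "k \<in> ?H" for k
  proof -
    have "g \<in> {y\<in>Y. k \<subseteq> y}" using gY hyperplanesD[OF k] by auto
    then show ?thesis by (auto simp: a_def Suc_le_eq card_gt_0_iff)
  qed
  have nb: "{y\<in>A. y \<in> nbrs g \<and> k \<subseteq> y} = {y\<in>A. k \<subseteq> y} - {g}"
    if k: "k \<in> ?H" and "A \<subseteq> {y. gen y}" for k A
    using that nbrs_iff_contains[OF g _ hyperplanesD(1,3,4)[OF k]] by auto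
  have zero: "vec.subspace {0::'a^'n}" "{0} \<subseteq> g" "vec.dim {0::'a^'n} = 0"
    using gen_subspace[OF g] by (auto simp: vec.subspace_0)
  have above0: "{y\<in>A. {0} \<subseteq> y} = A" if "A \<subseteq> {y. gen y}" for A
    using that by (auto simp: vec.subspace_0 gen_subspace)
  have subYZ: "Y \<subseteq> {y. gen y}" "Z \<subseteq> {y. gen y}" and cards: "card Y = gens_above 1" "card Z = gens_above 1"
    using bal by (auto simp: balanced_pair_def)
  have cY: "card {y\<in>Y. y \<in> nbrs g \<and> k \<subseteq> y} = a k - 1" if k: "k \<in> ?H" for k
    unfolding nb[OF k subYZ(1)] using gY hyperplanesD[OF k] by (subst card_Diff_singleton) (auto simp: a_def)
  have cZ: "card {z\<in>Z. z \<in> nbrs g \<and> k \<subseteq> z} = a k" if k: "k \<in> ?H" for k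
    unfolding nb[OF k subYZ(2)] using gY aZ[OF k] by (subst Diff_insert0) auto
  have "(real CARD('a) - 1) * real (card {y\<in>Y. y \<in> nbrs g \<and> {0} \<subseteq> y} + card {z\<in>Z. z \<in> nbrs g \<and> {0} \<subseteq> z}) =
     (real CARD('a) ^ d - 2 * real CARD('a) + 1) + (real CARD('a) - 1) * (real (2 * gens_above 1) / real (gens_above 1))"
    using balanced_nbrs[OF bal g zero(1,2)] zero(3) d gY
    unfolding above0[OF subYZ(1)] above0[OF subYZ(2)] cards by simp
  also have "\<dots> = real CARD('a) ^ d - 1" using gens_above_pos[of 1] by (simp add: algebra_simps)
  also have "\<dots> = (real CARD('a) - 1) * real (card ?H)"
    using card_hyperplanes[OF g zero(1,2) d] zero by (simp add: mult.commute)
  finally have "card {y\<in>Y. y \<in> nbrs g \<and> {0} \<subseteq> y} + card {z\<in>Z. z \<in> nbrs g \<and> {0} \<subseteq> z} = card ?H"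
    using q_gt_1 by simp
  \<comment> \<open>On average a hyperplane lies on one neighbour of \<open>g\<close> from the families, and each lies on at least one.\<close>
  then have "(\<Sum>k\<in>?H. (a k - 1) + a k) = (\<Sum>k\<in>?H. 1)"
    unfolding card_nbrs_by_hyperplane[OF g zero(2)] by (simp add: sum.distrib cY cZ)
  moreover have "(\<Sum>k\<in>?H. (a k - 1) + a k) = (\<Sum>k\<in>?H. 2 * (a k - 1)) + (\<Sum>k\<in>?H. 1)"
  proof -
    have "a k - 1 + a k = 2 * (a k - 1) + 1" if "k \<in> ?H" for k using ge[OF that] by simp
    then show ?thesis by (simp only: sum.distrib[symmetric]) (rule sum.cong, auto)
  qed
  ultimately have "(\<Sum>k\<in>?H. 2 * (a k - 1)) = 0" by simp
  then have "a h \<le> 1" using h by simp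
  then have "a h = 1" using ge[OF h] by simp
  then have "card {y\<in>Y. h \<subseteq> y} = 1" by (simp add: a_def)
  then obtain y0 where y0: "{y\<in>Y. h \<subseteq> y} = {y0}" by (rule card_1_singletonE)
  have "g \<in> {y\<in>Y. h \<subseteq> y}" using gY hyperplanesD[OF h] by simp
  then have "{y\<in>Y. h \<subseteq> y} = {g}" using y0 by simp
  moreover obtain z where z: "{z\<in>Z. h \<subseteq> z} = {z}"
    using aZ[OF h] \<open>a h = 1\<close> card_1_singletonE by metis
  moreover have "z \<noteq> g" "z \<in> Z" "h \<subseteq> z" using z gY by auto
  moreover from this have "z \<in> nbrs g" "z \<notin> Y"
    using nbrs_iff_contains[OF g _ hyperplanesD(1,3,4)[OF h], of z] subYZ \<open>{y\<in>Y. h \<subseteq> y} = {g}\<close> by auto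
  ultimately show ?thesis by blast
qed

lemma private_partner:
  assumes "balanced_pair Y Z" "d \<ge> 1" "g \<in> Y" "g \<notin> Z" "h \<in> hyperplanes {0} g"
  shows "\<exists>z\<in>Z. h \<subseteq> z \<and> z \<notin> Y \<and> z \<in> nbrs g \<and>
    (\<forall>z'\<in>Z. h \<subseteq> z' \<longrightarrow> z' = z) \<and> (\<forall>y\<in>Y. h \<subseteq> y \<longrightarrow> y = g)"
proof -
  obtain z where z: "{y\<in>Y. h \<subseteq> y} = {g}" "{z\<in>Z. h \<subseteq> z} = {z}" "z \<notin> Y" "z \<in> nbrs g"
    using private_hyperplanes[OF assms] by metis
  have "z' = z" if "z' \<in> Z" "h \<subseteq> z'" for z' using z(2) that by (metis (mono_tags) mem_Collect_eq singletonD)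
  moreover have "y = g" if "y \<in> Y" "h \<subseteq> y" for y using z(1) that by (metis (mono_tags) mem_Collect_eq singletonD)
  moreover have "z \<in> {z\<in>Z. h \<subseteq> z}" using z(2) by simp
  ultimately show ?thesis using z(3,4) by (intro bexI[of _ z]) auto
qed

lemma private_nbr:
  assumes "balanced_pair Y Z" "d \<ge> 1" "g \<in> Y" "g \<notin> Z" "z \<in> Z" "z \<in> nbrs g"
  shows "z \<notin> Y" "g \<in> nbrs z"
proof -
  have g: "gen g" using assms balanced_gen by blast
  show "z \<notin> Y" using private_partner[OF assms(1-4) nbr_hyperplane[OF g assms(6)]] assms(5) by blast
  show "g \<in> nbrs z" using assms(6) g by (simp add: nbrs_def Int_commute)
qed

lemma private_no_nbr:
  assumes "balanced_pair Y Z" "d \<ge> 1" "g \<in> Y" "g \<notin> Z" "y \<in> Y"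
  shows "y \<notin> nbrs g"
proof
  assume y: "y \<in> nbrs g"
  have g: "gen g" using assms balanced_gen by blast
  have "y = g" using private_partner[OF assms(1-4) nbr_hyperplane[OF g y]] assms(5) by blast
  then show False using y gen_dim[OF g] by (simp add: nbrs_def)
qed

text \<open>
  In the residue of \<open>p\<close>, a generalised quadrangle, \<open>g\<close> is a line with \<open>q + 1\<close> points, and each of them lies on
  one line of \<open>Z\<close>. The neighbour count in this residue determines the total number of lines of \<open>Z\<close>
  to be \<open>q + 1\<close>, so there are no others: \<open>Y\<close> and \<open>Z\<close> induce the two reguli of a grid.
\<close>

lemma private_coline:
  assumes bal: "balanced_pair Y Z" and gY: "g \<in> Y" "g \<notin> Z"
    and p: "vec.subspace p" "p \<subseteq> g" "vec.dim p + 2 = d"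
  shows "z \<in> Z \<Longrightarrow> p \<subseteq> z \<Longrightarrow> z \<in> nbrs g" and "card {y\<in>Y. p \<subseteq> y} = CARD('a) + 1"
proof -
  have d: "d \<ge> 1" using p by simp
  have g: "gen g" using balanced_gen(1)[OF bal gY(1)] .
  let ?H = "hyperplanes p g"
  let ?Zn = "{z\<in>Z. z \<in> nbrs g \<and> p \<subseteq> z}" and ?Z = "{z\<in>Z. p \<subseteq> z}"
  have dr: "d - vec.dim p = 2" "Suc (vec.dim p) = d - 1" using p(3) by auto
  have "real (card ?H) * (real CARD('a) - 1) = (real CARD('a) + 1) * (real CARD('a) - 1)"
    using card_hyperplanes[OF g p(1,2) d] unfolding dr by (simp add: power2_eq_square algebra_simps)
  then have cH: "real (card ?H) = real CARD('a) + 1" using q_gt_1 by simp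
  have "card {z\<in>Z. z \<in> nbrs g \<and> h \<subseteq> z} = 1" if h: "h \<in> ?H" for h
  proof -
    obtain z where "z \<in> Z" "h \<subseteq> z" "z \<in> nbrs g" "\<forall>z'\<in>Z. h \<subseteq> z' \<longrightarrow> z' = z"
      using private_partner[OF bal d gY hyperplanesD(5)[OF h]] by blast
    then have "{z\<in>Z. z \<in> nbrs g \<and> h \<subseteq> z} = {z}" by blast
    then show ?thesis by simp
  qed
  then have Zn: "card ?Zn = card ?H" unfolding card_nbrs_by_hyperplane[OF g p(2)] by simp
  have Yn: "{y\<in>Y. y \<in> nbrs g \<and> p \<subseteq> y} = {}" using private_no_nbr[OF bal d gY] by auto
  have bc: "card {y\<in>Y. p \<subseteq> y} = card ?Z"
    using balanced_card[OF bal sing_subset[OF gen_sing[OF g] p(1,2)]] p(3) by simp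
  have ga: "real (gens_above (Suc (vec.dim p))) = real CARD('a) + 1"
    using d dr by (simp add: gens_above_def)
  have "(real CARD('a) - 1) * real (card ?Zn) =
      (real CARD('a) ^ 2 - 2 * real CARD('a) + 1) + (real CARD('a) - 1) * (real (2 * card ?Z) / (real CARD('a) + 1))"
    using balanced_nbrs[OF bal g p(1,2)] p(3) gY unfolding ga dr(1) Yn bc by simp
  then have "(real CARD('a) - 1) * (real CARD('a) + 1) = (real CARD('a) - 1) * (real CARD('a) - 1 + 2 * real (card ?Z) / (real CARD('a) + 1))"
    unfolding Zn cH by (simp add: power2_eq_square algebra_simps)
  then have "real CARD('a) + 1 = real CARD('a) - 1 + 2 * real (card ?Z) / (real CARD('a) + 1)" using q_gt_1 by simp
  then have "2 * (real CARD('a) + 1) = 2 * real (card ?Z)" by (simp add: field_simps)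
  then have Z: "real (card ?Z) = real CARD('a) + 1" by simp
  then show "card {y\<in>Y. p \<subseteq> y} = CARD('a) + 1" using bc by simp
  have "?Zn = ?Z" using Z Zn cH by (intro card_subset_eq) auto
  then show "z \<in> nbrs g" if "z \<in> Z" "p \<subseteq> z" using that by blast
qed

lemma private_coline_meet:
  assumes bal: "balanced_pair Y Z" and gY: "g \<in> Y" "g \<notin> Z"
    and p: "vec.subspace p" "p \<subseteq> g" "vec.dim p + 2 = d" and y: "y \<in> Y" "y \<noteq> g" "p \<subseteq> y"
  shows "y \<inter> g = p"
proof (rule subspace_eqI[symmetric])
  have d: "d \<ge> 1" using p by simp
  have g: "gen g" and gy: "gen y" using balanced_gen(1)[OF bal] gY y by auto
  show sub: "vec.subspace (y \<inter> g)" using g gy by (simp add: gen_subspace vec.subspace_inter)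
  show "p \<subseteq> y \<inter> g" using p y by auto
  have "y \<inter> g \<subset> y" using gen_eqI[OF gy g] y by auto
  then have "vec.dim (y \<inter> g) < d" using dim_strict_mono[OF sub gen_subspace[OF gy]] gen_dim[OF gy] by simp
  moreover have "vec.dim (y \<inter> g) + 1 \<noteq> d" using private_no_nbr[OF bal d gY y(1)] gy by (simp add: nbrs_def)
  ultimately show "vec.dim (y \<inter> g) \<le> vec.dim p" using p by simp
qed (use p in simp)

text \<open>
  A line of one regulus is spanned by its intersection points with two lines of the other one.
\<close>

lemma private_coline_span:
  assumes bal: "balanced_pair Y Z" and gY: "g \<in> Y" "g \<notin> Z"
    and p: "vec.subspace p" "p \<subseteq> g" "vec.dim p + 2 = d" and y: "y \<in> Y" "y \<noteq> g" "p \<subseteq> y"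
    and z: "z \<in> Z" "p \<subseteq> z"
  shows "z \<subseteq> join g y"
proof -
  have d: "d \<ge> 1" using p by simp
  have gens: "gen g" "gen y" "gen z" using balanced_gen[OF bal] gY y z by auto
  note sub = gen_subspace[OF gens(1)] gen_subspace[OF gens(2)] gen_subspace[OF gens(3)]
  have zg: "z \<in> nbrs g" by (rule private_coline(1)[OF bal gY p z])
  have zY: "z \<notin> Y" using private_nbr(1)[OF bal d gY z(1) zg] .
  have yz: "y \<in> nbrs z"
    by (rule private_coline(1)[OF balanced_pair_commute[OF bal] z(1) zY p(1) z(2) p(3) y(1,3)])
  have "(z \<inter> g) \<inter> (z \<inter> y) = p"
    using private_coline_meet[OF bal gY p y] z by auto
  then have "vec.dim (join (z \<inter> g) (z \<inter> y)) = d"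
    using dim_join[of "z \<inter> g" "z \<inter> y"] zg yz p(3) sub
    by (simp add: nbrs_def Int_commute vec.subspace_inter)
  then have "join (z \<inter> g) (z \<inter> y) = z"
    using sub gens by (intro subspace_eqI subspace_join join_least) (auto simp: vec.subspace_inter gen_dim)
  moreover have "join (z \<inter> g) (z \<inter> y) \<subseteq> join g y" by (auto simp: join_def)
  ultimately show ?thesis by simp
qed

text \<open>
  The union of the joins of \<open>g\<close> with its partners, one for each hyperplane of \<open>g\<close>. It turns out to be
  a subspace, namely the hyperplane of the ambient space that carries the hyperbolic quadric.
\<close>

definition partner_span :: "('a^'n) set set \<Rightarrow> ('a^'n) set \<Rightarrow> ('a^'n) set" where
  "partner_span Z g = {v. \<exists>h\<in>hyperplanes {0} g. \<exists>z\<in>Z. h \<subseteq> z \<and> v \<in> join g z}"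

lemma join_in_partner_span: "h \<in> hyperplanes {0} g \<Longrightarrow> z \<in> Z \<Longrightarrow> h \<subseteq> z \<Longrightarrow> join g z \<subseteq> partner_span Z g"
  by (auto simp: partner_span_def)

lemma hyperplane_exists:
  assumes "gen g" "d \<ge> 1" shows "\<exists>h. h \<in> hyperplanes {0} g"
  using obtain_hyperplane[of g "{0}" "d - 1"] assms gen_dim[OF assms(1)] gen_subspace[OF assms(1)]
  by (metis hyperplanesI vec.subspace_0 vec.subspace_single_0 singletonD subsetI vec.dim_eq_0 le0
      le_add_diff_inverse2 diff_le_self order_refl)

lemma gen_in_partner_span:
  assumes bal: "balanced_pair Y Z" and d: "d \<ge> 1" and gY: "g \<in> Y" "g \<notin> Z"
  shows "g \<subseteq> partner_span Z g"
proof -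
  have g: "gen g" using balanced_gen(1)[OF bal gY(1)] .
  obtain h where h: "h \<in> hyperplanes {0} g" using hyperplane_exists[OF g d] by blast
  obtain z where z: "z \<in> Z" "h \<subseteq> z" using private_partner[OF bal d gY h] by blast
  have "g \<subseteq> join g z" using z balanced_gen(2)[OF bal] by (intro join_left gen_subspace) auto
  then show ?thesis using join_in_partner_span[OF h z] by blast
qed

text \<open>
  The grid in the residue of \<open>p\<close> spans \<open>join g y\<close>. A vector \<open>b\<close> of \<open>y\<close> outside \<open>g\<close> determines the hyperplane
  \<open>g \<inter> b\<^sup>\<bottom>\<close>, and the partner of \<open>g\<close> on it meets \<open>y\<close> in a hyperplane of \<open>y\<close> that contains \<open>b\<close>.
\<close>

lemma coline_join_in_partner_span:
  assumes bal: "balanced_pair Y Z" and gY: "g \<in> Y" "g \<notin> Z"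
    and p: "vec.subspace p" "p \<subseteq> g" "vec.dim p + 2 = d" and y: "y \<in> Y" "y \<noteq> g" "p \<subseteq> y"
  shows "join g y \<subseteq> partner_span Z g"
proof
  have d: "d \<ge> 1" using p by simp
  have g: "gen g" and gy: "gen y" using balanced_gen(1)[OF bal] gY y by auto
  fix v assume "v \<in> join g y"
  then obtain a b where ab: "a \<in> g" "b \<in> y" "v = a + b" by (auto elim: joinE)
  show "v \<in> partner_span Z g"
  proof (cases "b \<in> g")
    case True
    then have "v \<in> g" using ab g by (simp add: gen_subspace vec.subspace_add)
    then show ?thesis using gen_in_partner_span[OF bal d gY] by blast
  next
    case False
    let ?h = "g \<inter> perp (vec.span {b})"
    have Qb: "Q b = 0" using ab gy by (simp add: gen_def sing_def)
    have dimh: "vec.dim ?h + 1 = d" by (rule unique_nbr_through(2)[OF g Qb False])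
    have h: "?h \<in> hyperplanes {0} g"
      using dimh g by (intro hyperplanesI) (auto simp: vec.subspace_inter subspace_perp gen_subspace)
    obtain z where z: "z \<in> Z" "?h \<subseteq> z" "z \<notin> Y" using private_partner[OF bal d gY h] by blast
    have gz: "gen z" using balanced_gen(2)[OF bal z(1)] .
    have "p \<subseteq> ?h" using p y ab sing_B[OF gen_sing[OF gy]] by (auto simp: perp_span)
    then have "y \<in> nbrs z" using z
      by (intro private_coline(1)[OF balanced_pair_commute[OF bal] z(1,3) p(1) _ p(3) y(1,3)]) auto
    then have dimyz: "vec.dim (y \<inter> z) + 1 = d" by (simp add: nbrs_def)
    have "\<not> y \<subseteq> perp ?h"
    proof
      assume "y \<subseteq> perp ?h"
      then have "?h \<subseteq> perp y" by (simp add: perp_commute)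
      then have "?h \<subseteq> y" using gen_maximal[OF gy] g by (auto simp: gen_def sing_def)
      then have "?h \<subseteq> p" using private_coline_meet[OF bal gY p y] by auto
      then show False using vec.dim_subset[of ?h p] dimh p(3) by simp
    qed
    then have "vec.dim (y \<inter> perp ?h) < d"
      using dim_strict_mono[of "y \<inter> perp ?h" y] gy
      by (auto simp: gen_subspace subspace_perp vec.subspace_inter gen_dim)
    moreover have "y \<inter> z \<subseteq> y \<inter> perp ?h"
      using z sing_B[OF gen_sing[OF gz]] by (auto simp: perp_def)
    ultimately have "y \<inter> z = y \<inter> perp ?h"
      using dimyz gy gz by (intro subspace_eqI) (auto simp: gen_subspace subspace_perp vec.subspace_inter)
    moreover have "b \<in> perp ?h" using perp_commute[of "vec.span {b}" ?h] vec.span_base[of b "{b}"] by auto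
    ultimately have "b \<in> z" using ab by auto
    then show ?thesis using ab join_in_partner_span[OF h z(1,2)] by (auto simp: joinI)
  qed
qed

lemma hyperplanes_meet:
  assumes g: "gen g" and h: "h \<in> hyperplanes {0} g" "h' \<in> hyperplanes {0} g" "h \<noteq> h'"
  shows "vec.subspace (h \<inter> h')" "vec.dim (h \<inter> h') + 2 = d" "join h h' = g"
proof -
  note H = hyperplanesD[OF h(1)] hyperplanesD[OF h(2)]
  show "vec.subspace (h \<inter> h')" using H by (simp add: vec.subspace_inter)
  have "h \<subset> join h h'"
  proof -
    have "\<not> h' \<subseteq> h" using subspace_eqI[of h' h] H h(3) by auto
    then show ?thesis using join_left[of h' h] join_right[of h h'] H by auto
  qed
  then have "vec.dim h < vec.dim (join h h')" using H by (intro dim_strict_mono subspace_join)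
  moreover have sub: "join h h' \<subseteq> g" using H g by (intro join_least gen_subspace)
  moreover from sub have "vec.dim (join h h') \<le> d" using vec.dim_subset[OF sub] gen_dim[OF g] by simp
  ultimately have dj: "vec.dim (join h h') = d" using H by simp
  then show "vec.dim (h \<inter> h') + 2 = d" using dim_join[of h h'] H by simp
  show "join h h' = g" 
    using dj gen_dim[OF g] by (intro subspace_eqI[OF subspace_join[OF H(1,6)] gen_subspace[OF g] sub]) simp
qed

text \<open>
  The partners on two hyperplanes of \<open>g\<close> belong to one grid, in the residue of the intersection of
  the hyperplanes. The join spanned by this grid contains the sum.
\<close>

lemma subspace_partner_span:
  assumes bal: "balanced_pair Y Z" and d: "d \<ge> 1" and gY: "g \<in> Y" "g \<notin> Z"
  shows "vec.subspace (partner_span Z g)"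
proof (rule vec.subspaceI)
  have g: "gen g" using balanced_gen(1)[OF bal gY(1)] .
  show "0 \<in> partner_span Z g" using gen_in_partner_span[OF bal d gY] vec.subspace_0[OF gen_subspace[OF g]] by auto
  show "c *s u \<in> partner_span Z g" if u0: "u \<in> partner_span Z g" for c u
  proof -
    obtain h z where u: "h \<in> hyperplanes {0} g" "z \<in> Z" "h \<subseteq> z" "u \<in> join g z"
      using u0 by (auto simp: partner_span_def)
    have "vec.subspace (join g z)"
      using g balanced_gen(2)[OF bal u(2)] by (intro subspace_join gen_subspace)
    then show ?thesis using join_in_partner_span[OF u(1-3)] vec.subspace_scale u(4) by blast
  qed
  fix u v assume "u \<in> partner_span Z g" "v \<in> partner_span Z g"
  then obtain h z h' z' where u: "h \<in> hyperplanes {0} g" "z \<in> Z" "h \<subseteq> z" "u \<in> join g z"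
    and v: "h' \<in> hyperplanes {0} g" "z' \<in> Z" "h' \<subseteq> z'" "v \<in> join g z'"
    by (auto simp: partner_span_def)
  have gz: "gen z" "gen z'" using balanced_gen(2)[OF bal] u v by auto
  show "u + v \<in> partner_span Z g"
  proof (cases "h = h'")
    case True
    have "z = z'" using private_partner[OF bal d gY u(1)] u v True by metis
    then have "u + v \<in> join g z"
      using u v vec.subspace_add[OF subspace_join[OF gen_subspace[OF g] gen_subspace[OF gz(1)]]] by simp
    then show ?thesis using join_in_partner_span[OF u(1-3)] by blast
  next
    case False
    let ?p = "h \<inter> h'"
    note p = hyperplanes_meet[OF g u(1) v(1) False]
    have pg: "?p \<subseteq> g" using hyperplanesD[OF u(1)] by auto
    have "card {y\<in>Y. ?p \<subseteq> y} = CARD('a) + 1" by (rule private_coline(2)[OF bal gY p(1) pg p(2)])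
    then have "\<not> {y\<in>Y. ?p \<subseteq> y} \<subseteq> {g}" using q_gt_1 card_mono[of "{g}" "{y\<in>Y. ?p \<subseteq> y}"] by auto
    then obtain y where y: "y \<in> Y" "y \<noteq> g" "?p \<subseteq> y" by blast
    have sj: "vec.subspace (join g y)" using g balanced_gen(1)[OF bal y(1)] by (intro subspace_join gen_subspace)
    have gj: "g \<subseteq> join g y" using balanced_gen(1)[OF bal y(1)] by (intro join_left gen_subspace)
    have "z \<subseteq> join g y" "z' \<subseteq> join g y"
      using u v private_coline_span[OF bal gY p(1) pg p(2) y] by (meson Int_lower1 Int_lower2 order.trans)+
    then have "join g z \<subseteq> join g y" "join g z' \<subseteq> join g y" using gj sj by (simp_all add: join_least)
    then have "u + v \<in> join g y" using u v sj by (auto intro!: vec.subspace_add)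
    then show ?thesis using coline_join_in_partner_span[OF bal gY p(1) pg p(2) y] by blast
  qed
qed

text \<open>
  Maximality of the generator, for a singular vector known only modulo \<open>g\<close>.
\<close>

lemma gen_add_perp:
  assumes g: "gen g" and "a \<in> g" "Q b = 0" "a + b \<in> perp g" shows "a + b \<in> g"
proof -
  have "b = (a + b) - a" by simp
  also have "\<dots> \<in> perp g" using assms sing_perp[OF gen_sing[OF g]] by (intro vec.subspace_diff subspace_perp) auto
  finally have "b \<in> g" using gen_maximal[OF g] assms by blast
  then show ?thesis using assms by (simp add: gen_subspace vec.subspace_add)
qed

text \<open>
  A vector from the join with another partner is orthogonal to that partner's hyperplane; if it is
  also orthogonal to \<open>h\<close>, it is orthogonal to all of \<open>g\<close>.
\<close>

lemma partner_span_perp_hyperplane: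
  assumes bal: "balanced_pair Y Z" and d: "d \<ge> 1" and gY: "g \<in> Y" "g \<notin> Z"
    and h: "h \<in> hyperplanes {0} g" and z: "z \<in> Z" "h \<subseteq> z"
  shows "partner_span Z g \<inter> perp h \<subseteq> join g z"
proof
  have g: "gen g" using balanced_gen(1)[OF bal gY(1)] .
  have gz: "gen z" using balanced_gen(2)[OF bal z(1)] .
  fix v assume v: "v \<in> partner_span Z g \<inter> perp h"
  then obtain h' z' where z': "h' \<in> hyperplanes {0} g" "z' \<in> Z" "h' \<subseteq> z'" "v \<in> join g z'"
    by (auto simp: partner_span_def)
  have gz': "gen z'" using balanced_gen(2)[OF bal z'(2)] .
  show "v \<in> join g z"
  proof (cases "h = h'")
    case True
    have "z = z'" using private_partner[OF bal d gY h] z z' True by metis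
    then show ?thesis using z' by simp
  next
    case False
    obtain a b where ab: "a \<in> g" "b \<in> z'" "v = a + b" using z'(4) by (rule joinE)
    have "h' \<subseteq> perp g" "h' \<subseteq> perp z'"
      using sing_perp[OF gen_sing] g gz' z'(3) hyperplanesD(3)[OF z'(1)] by blast+
    then have "a \<in> perp h'" "b \<in> perp h'" using ab perp_commute by blast+
    then have "v \<in> perp h'" using ab by (simp add: vec.subspace_add subspace_perp)
    then have "v \<in> perp (join h h')"
      using v perp_join[OF hyperplanesD(1)[OF h] hyperplanesD(1)[OF z'(1)]] by auto
    then have "v \<in> g" using gen_add_perp[OF g ab(1), of b] ab gz' hyperplanes_meet(3)[OF g h z'(1) False]
      by (simp add: gen_def sing_def)
    then show ?thesis using join_left[OF gen_subspace[OF gz], of g] by blast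
  qed
qed

lemma join_commute: "join S T = join T S"
  by (auto simp: join_def) (metis add.commute)+

text \<open>
  A partner \<open>y\<close> of \<open>z\<close> on another hyperplane of \<open>z\<close> belongs to the grid of \<open>g\<close> in the residue of the
  intersection of the two hyperplanes, so \<open>join z y \<subseteq> join g y\<close>.
\<close>

lemma partner_span_nbr_subset:
  assumes bal: "balanced_pair Y Z" and d: "d \<ge> 1" and gY: "g \<in> Y" "g \<notin> Z"
    and h: "h \<in> hyperplanes {0} g" and z: "z \<in> Z" "h \<subseteq> z"
  shows "partner_span Y z \<subseteq> partner_span Z g"
proof
  have g: "gen g" using balanced_gen(1)[OF bal gY(1)] .
  have gz: "gen z" using balanced_gen(2)[OF bal z(1)] .
  have zz: "z \<notin> Y" "z \<in> nbrs g" and only_g: "\<And>y. y \<in> Y \<Longrightarrow> h \<subseteq> y \<Longrightarrow> y = g"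
    using private_partner[OF bal d gY h] z by metis+
  have zg: "z \<inter> g = h" using nbrs_inter_eq[OF g zz(2) hyperplanesD(1,3)[OF h] z(2) hyperplanesD(4)[OF h]] .
  have hz: "h \<in> hyperplanes {0} z" using hyperplanesD[OF h] z by (intro hyperplanesI)
  fix v assume "v \<in> partner_span Y z"
  then obtain k y where k: "k \<in> hyperplanes {0} z" "y \<in> Y" "k \<subseteq> y" "v \<in> join z y"
    by (auto simp: partner_span_def)
  have gy: "gen y" using balanced_gen(1)[OF bal k(2)] .
  show "v \<in> partner_span Z g"
  proof (cases "k = h")
    case True
    then have "y = g" using only_g k by blast
    then show ?thesis using k join_in_partner_span[OF h z] join_commute by blast
  next
    case False
    let ?p = "h \<inter> k"
    note p = hyperplanes_meet[OF gz hz k(1) False[symmetric]]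
    have pg: "?p \<subseteq> g" "?p \<subseteq> y" "?p \<subseteq> z" using hyperplanesD(3)[OF h] k z by auto
    have "y \<noteq> g"
    proof
      assume "y = g"
      then have "k \<subseteq> h" using zg k hyperplanesD(3)[OF k(1)] by auto
      then show False using False subspace_eqI[of k h] hyperplanesD[OF h] hyperplanesD[OF k(1)] by simp
    qed
    note Y = k(2) this pg(2)
    have "z \<subseteq> join g y" by (rule private_coline_span[OF bal gY p(1) pg(1) p(2) Y z(1) pg(3)])
    moreover have "y \<subseteq> join g y" using g by (intro join_right gen_subspace)
    ultimately have "join z y \<subseteq> join g y" using g gy by (intro join_least subspace_join gen_subspace)
    then show ?thesis using k coline_join_in_partner_span[OF bal gY p(1) pg(1) p(2) Y] by blast
  qed
qed

lemma partner_span_nbr_eq: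
  assumes bal: "balanced_pair Y Z" and d: "d \<ge> 1" and gY: "g \<in> Y" "g \<notin> Z"
    and h: "h \<in> hyperplanes {0} g" and z: "z \<in> Z" "h \<subseteq> z"
  shows "partner_span Y z = partner_span Z g"
proof
  show "partner_span Y z \<subseteq> partner_span Z g" by (rule partner_span_nbr_subset[OF assms])
  have "z \<notin> Y" using private_partner[OF bal d gY h] z by blast
  moreover have "h \<in> hyperplanes {0} z" using hyperplanesD[OF h] z by (intro hyperplanesI)
  ultimately show "partner_span Z g \<subseteq> partner_span Y z"
    using partner_span_nbr_subset[OF balanced_pair_commute[OF bal] d z(1)] gY hyperplanesD(3)[OF h] by blast
qed

lemma gen_separating_hyperplane:
  assumes g: "gen g" and v: "v \<in> g" "v \<noteq> 0"
  shows "\<exists>h\<in>hyperplanes {0} g. v \<notin> h"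
proof (rule ccontr)
  assume "\<not> ?thesis"
  then have all: "v \<in> h" if "h \<in> hyperplanes {0} g" for h using that by blast
  have "h \<in> hyperplanes (vec.span {v}) g" if h: "h \<in> hyperplanes {0} g" for h
    using hyperplanesD(1,3,4)[OF h] vec.span_minimal[of "{v}" h] all[OF h] by (simp add: hyperplanes_def)
  moreover have "hyperplanes (vec.span {v}) g \<subseteq> hyperplanes {0} g"
    by (intro hyperplanes_mono) (simp add: vec.span_zero)
  ultimately have "hyperplanes {0} g = hyperplanes (vec.span {v}) g" by blast
  moreover have vg: "vec.span {v} \<subseteq> g" using v g by (intro vec.span_minimal gen_subspace) auto
  moreover from vg have d: "d \<ge> 1" using vec.dim_subset[OF vg] v gen_dim[OF g] by simp
  moreover have "{0} \<subseteq> g" using vec.subspace_0[OF gen_subspace[OF g]] by simp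
  ultimately have "real CARD('a) ^ d = real CARD('a) ^ (d - 1)"
    using card_hyperplanes[OF g _ _ d, of "{0}"] card_hyperplanes[OF g _ vg d] v by simp
  then have "d = d - 1" using q_gt_1 by simp
  then show False using d by simp
qed

text \<open>
  A vector of \<open>g\<close> orthogonal to the span is orthogonal to all partners, so it lies in all of them
  and thus in all hyperplanes of \<open>g\<close>. The dimension then follows from the pairing of the span
  with \<open>g\<close>.
\<close>

lemma partner_span_nonsingular:
  assumes bal: "balanced_pair Y Z" and d: "d \<ge> 1" and gY: "g \<in> Y" "g \<notin> Z"
  shows "g \<inter> perp (partner_span Z g) = {0}" "nonsingular_on (partner_span Z g) Q" "vec.dim (partner_span Z g) = 2 * d"
proof -
  have g: "gen g" using balanced_gen(1)[OF bal gY(1)] .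
  let ?H = "partner_span Z g"
  have gH: "g \<subseteq> ?H" by (rule gen_in_partner_span[OF bal d gY])
  have zero: "v = 0" if v: "v \<in> g" "v \<in> perp ?H" for v
  proof (rule ccontr)
    assume "v \<noteq> 0"
    then obtain h where h: "h \<in> hyperplanes {0} g" "v \<notin> h" using gen_separating_hyperplane[OF g v(1)] by blast
    obtain z where z: "z \<in> Z" "h \<subseteq> z" "z \<in> nbrs g" using private_partner[OF bal d gY h(1)] by blast
    have gz: "gen z" using balanced_gen(2)[OF bal z(1)] .
    have "z \<subseteq> ?H" using join_in_partner_span[OF h(1) z(1,2)] join_right[OF gen_subspace[OF g], of z] by blast
    then have "v \<in> perp z" using v perp_antimono by blast
    then have "v \<in> z" using gen_maximal[OF gz] v g by (simp add: gen_def sing_def)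
    then show False
      using nbrs_inter_eq[OF g z(3) hyperplanesD(1,3)[OF h(1)] z(2) hyperplanesD(4)[OF h(1)]] v h by blast
  qed
  then show meet: "g \<inter> perp ?H = {0}" using g by (auto simp: gen_subspace vec.subspace_0 subspace_perp)
  show "nonsingular_on ?H Q" unfolding nonsingular_on_def
  proof (intro ballI impI)
    fix v assume "v \<in> ?H" and v: "Q v = 0 \<and> (\<forall>w\<in>?H. B v w = 0)"
    then have "v \<in> perp ?H" by (simp add: perp_def)
    moreover from this have "v \<in> g" using gen_maximal[OF g] v perp_antimono[OF gH] by blast
    ultimately show "v = 0" using zero by blast
  qed
  have "{s\<in>?H. \<forall>t\<in>g. B s t = 0} = g"
  proof
    show "{s\<in>?H. \<forall>t\<in>g. B s t = 0} \<subseteq> g"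
    proof
      fix v assume v: "v \<in> {s\<in>?H. \<forall>t\<in>g. B s t = 0}"
      then obtain z where "z \<in> Z" "v \<in> join g z" by (auto simp: partner_span_def)
      moreover from this obtain a b where "a \<in> g" "b \<in> z" "v = a + b" by (auto elim: joinE)
      ultimately show "v \<in> g" using v gen_add_perp[OF g, of a b] balanced_gen(2)[OF bal]
        by (auto simp: perp_def gen_def sing_def)
    qed
  qed (use gH sing_B[OF gen_sing[OF g]] in auto)
  moreover have "{t\<in>g. \<forall>s\<in>?H. B s t = 0} = {0}" using meet by (auto simp: perp_def B_commute)
  ultimately show "vec.dim ?H = 2 * d"
    using dim_pairing[OF bilin subspace_partner_span[OF bal d gY] gen_subspace[OF g]] gen_dim[OF g]
    by (simp add: vec.dim_eq_0)
qed

text \<open>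
  A generator \<open>h \<noteq> g\<close> is moved towards \<open>g\<close> inside \<open>H\<close> by projecting it onto a point of \<open>g\<close> outside \<open>h\<close>.
\<close>

lemma gens_in_subspace_connected:
  assumes H: "vec.subspace H" and g: "gen g" "g \<subseteq> H" "C g"
    and step: "\<And>h' h. C h' \<Longrightarrow> gen h' \<Longrightarrow> h' \<subseteq> H \<Longrightarrow> h \<subseteq> H \<Longrightarrow> h \<in> nbrs h' \<Longrightarrow> C h"
  shows "gen h \<Longrightarrow> h \<subseteq> H \<Longrightarrow> C h"
proof (induction "d - vec.dim (h \<inter> g)" arbitrary: h rule: less_induct)
  case less
  show ?case
  proof (cases "h = g")
    case False
    then obtain v where v: "v \<in> g" "v \<notin> h" using gen_eqI[OF g(1) less.prems(1)] by blast
    have Qv: "Q v = 0" using v g by (simp add: gen_def sing_def)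
    let ?p = "h \<inter> perp (vec.span {v})" let ?h' = "join (vec.span {v}) ?p"
    have "{y \<in> nbrs h. v \<in> y} = {?h'}" by (rule unique_nbr_through(1)[OF less.prems(1) Qv v(2)])
    then have h': "?h' \<in> nbrs h" "v \<in> ?h'" by auto
    have gh': "gen ?h'" using h' by (simp add: nbrs_def)
    have sub: "?h' \<subseteq> H" using v g less.prems H by (intro join_least vec.span_minimal) auto
    have "h \<inter> g \<subseteq> ?p" using v sing_B[OF gen_sing[OF g(1)]] by (auto simp: perp_span)
    moreover have "?p \<subseteq> ?h'" by (rule join_right) simp
    ultimately have "h \<inter> g \<subset> ?h' \<inter> g" using v h' by auto
    then have lt: "vec.dim (h \<inter> g) < vec.dim (?h' \<inter> g)"
      using less.prems gh' g by (intro dim_strict_mono vec.subspace_inter gen_subspace)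
    have "vec.dim (?h' \<inter> g) \<le> d" using vec.dim_subset[of "?h' \<inter> g" g] gen_dim[OF g(1)] by simp
    then have "C ?h'" using less.hyps[of ?h'] lt gh' sub by simp
    moreover have "h \<in> nbrs ?h'" using h'(1) less.prems by (simp add: nbrs_def Int_commute)
    ultimately show ?thesis using step gh' sub less.prems by blast
  qed (use g in simp)
qed

text \<open>
  The part of the span orthogonal to \<open>h \<inter> g\<close> is the join of \<open>g\<close> with its partner; modulo \<open>h \<inter> g\<close>
  it is a hyperbolic plane, whose only singular one-dimensional subspaces come from \<open>g\<close> and from the partner.
\<close>

lemma nbr_in_partner_span:
  assumes bal: "balanced_pair Y Z" and d: "d \<ge> 1" and gY: "g \<in> Y" "g \<notin> Z"
    and h: "h \<in> nbrs g" "h \<subseteq> partner_span Z g"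
  shows "h \<in> Z \<and> h \<notin> Y \<and> partner_span Y h = partner_span Z g"
proof -
  have g: "gen g" using balanced_gen(1)[OF bal gY(1)] .
  have gh: "gen h" using h by (simp add: nbrs_def)
  let ?p = "h \<inter> g"
  have p: "?p \<in> hyperplanes {0} g" by (rule nbr_hyperplane[OF g h(1)])
  obtain z where z: "z \<in> Z" "?p \<subseteq> z" "z \<notin> Y" using private_partner[OF bal d gY p] by blast
  have gz: "gen z" using balanced_gen(2)[OF bal z(1)] .
  have "h \<subseteq> z"
  proof
    fix x assume x: "x \<in> h"
    show "x \<in> z"
    proof (cases "x \<in> g")
      case True
      then show ?thesis using x z by auto
    next
      case False
      have "x \<in> perp ?p" using x sing_B[OF gen_sing[OF gh]] by (auto simp: perp_def)
      then have "x \<in> join g z" using partner_span_perp_hyperplane[OF bal d gY p z(1,2)] x h by auto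
      then obtain a b where ab: "a \<in> g" "b \<in> z" "x = a + b" by (rule joinE)
      have Q0: "Q x = 0" "Q a = 0" "Q b = 0" using x ab gh g gz by (auto simp: gen_def sing_def)
      then have Bab: "B b a = 0" using Q_add[of a b] ab B_commute by simp
      have "a \<in> ?p"
      proof (rule ccontr)
        assume a: "a \<notin> ?p"
        note J = insert_vector_to_subspace[OF hyperplanesD(1)[OF p] a]
        have "join ?p (vec.span {a}) = g"
        proof (rule subspace_eqI[OF J(1) gen_subspace[OF g]])
          show "join ?p (vec.span {a}) \<subseteq> g"
            using ab g by (intro join_least vec.span_minimal gen_subspace) auto
        qed (use J(2) hyperplanesD(4)[OF p] gen_dim[OF g] in simp)
        moreover have "b \<in> perp ?p" using ab z sing_B[OF gen_sing[OF gz]] by (auto simp: perp_def)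
        moreover have "b \<in> perp (vec.span {a})" using Bab by (simp add: perp_span)
        ultimately have "b \<in> perp g" using perp_join[OF hyperplanesD(1)[OF p] vec.subspace_span[of "{a}"]] by simp
        then have "b \<in> g" using gen_maximal[OF g] Q0 by blast
        then show False using False ab g by (simp add: gen_subspace vec.subspace_add)
      qed
      then show ?thesis using ab z gz by (auto intro!: vec.subspace_add gen_subspace)
    qed
  qed
  then have "h = z" by (rule gen_eqI[OF gh gz])
  then show ?thesis using z partner_span_nbr_eq[OF bal d gY p z(1,2)] by simp
qed

text \<open>
  Take \<open>H\<close> to be the partner span of one \<open>g\<close> in \<open>Y - Z\<close>. Connectedness shows that all generators inside \<open>H\<close>
  belong to exactly one of the families and have the same span. A generator \<open>y\<close> that is not inside \<open>H\<close>
  meets \<open>H\<close> in a hyperplane of \<open>y\<close>, which also lies on some generator inside \<open>H\<close>. That generator and its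
  partner, both inside \<open>H\<close>, are the only members of the families on this hyperplane.
\<close>

lemma balanced_pair_hyperbolic:
  assumes bal: "balanced_pair Y Z" and d: "d \<ge> 1" and ne: "Y \<noteq> Z"
  shows "\<exists>H g. vec.subspace H \<and> vec.dim H = 2 * d \<and> nonsingular_on H Q \<and> gen g \<and> g \<subseteq> H \<and>
    Y \<union> Z = {y. gen y \<and> y \<subseteq> H}"
proof -
  have "\<not> Y \<subseteq> Z" using bal ne card_subset_eq[of Z Y] by (auto simp: balanced_pair_def)
  then obtain g where gY: "g \<in> Y" "g \<notin> Z" by blast
  have g: "gen g" using balanced_gen(1)[OF bal gY(1)] .
  define H where "H = partner_span Z g"
  note bal' = balanced_pair_commute[OF bal]
  have H: "vec.subspace H" "vec.dim H = 2 * d" "nonsingular_on H Q" "g \<subseteq> H"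
    using subspace_partner_span[OF bal d gY] partner_span_nonsingular[OF bal d gY] gen_in_partner_span[OF bal d gY]
    by (auto simp: H_def)
  \<comment> \<open>Membership in exactly one family, with the same span \<open>H\<close>; this passes from a generator to its neighbours inside \<open>H\<close>.\<close>
  define C where "C h \<longleftrightarrow> h \<in> Y \<and> h \<notin> Z \<and> partner_span Z h = H \<or> h \<in> Z \<and> h \<notin> Y \<and> partner_span Y h = H" for h
  have C: "C h" if "gen h" "h \<subseteq> H" for h
  proof (rule gens_in_subspace_connected[where C = C, OF H(1) g H(4) _ _ that])
    show "C g" using gY by (simp add: C_def H_def)
    show "C k" if "C h'" "gen h'" "h' \<subseteq> H" "k \<subseteq> H" "k \<in> nbrs h'" for h' k
      using that nbr_in_partner_span[OF bal d, of h' k] nbr_in_partner_span[OF bal' d, of h' k] by (auto simp: C_def)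
  qed
  have "y \<subseteq> H" if y: "y \<in> Y \<union> Z" for y
  proof (rule ccontr)
    assume nH: "\<not> y \<subseteq> H"
    have gy: "gen y" using y balanced_gen[OF bal] by auto
    let ?p = "y \<inter> H"
    have sub: "vec.subspace ?p" using gy H by (simp add: gen_subspace vec.subspace_inter)
    have "vec.dim ?p < d" using dim_strict_mono[of ?p y] sub gy nH by (auto simp: gen_subspace gen_dim)
    then have dimp: "vec.dim ?p + 1 = d"
      using dim_inter_hyperplane[OF gen_subspace[OF gy] H(1)] H(2) card_index gen_dim[OF gy] by simp
    \<comment> \<open>A generator inside \<open>H\<close> on the trace of \<open>y\<close>: the projection of \<open>g\<close>.\<close>
    let ?c = "join ?p (g \<inter> perp ?p)"
    have singp: "sing ?p" using sing_subset[OF gen_sing[OF gy] sub] by simp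
    have c: "gen ?c" by (rule dim_gen_perp(2)[OF singp g])
    have cH: "?c \<subseteq> H" using H by (intro join_least) auto
    have pc: "?p \<subseteq> ?c" using g by (intro join_left) (auto simp: gen_subspace subspace_perp vec.subspace_inter)
    have hc: "?p \<in> hyperplanes {0} ?c" by (rule hyperplanesI[OF sub pc dimp])
    have key: False if b: "balanced_pair Y' Z'" "y \<in> Y' \<union> Z'" "?c \<in> Y'" "?c \<notin> Z'" "partner_span Z' ?c = H" for Y' Z'
    proof -
      obtain z where z: "z \<in> Z'" "?p \<subseteq> z" "\<forall>z'\<in>Z'. ?p \<subseteq> z' \<longrightarrow> z' = z" "\<forall>y\<in>Y'. ?p \<subseteq> y \<longrightarrow> y = ?c"
        using private_partner[OF b(1) d b(3,4) hc] by metis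
      have "z \<subseteq> join ?c z" by (rule join_right[OF gen_subspace[OF c]])
      also have "\<dots> \<subseteq> H" using join_in_partner_span[OF hc z(1,2)] b(5) by simp
      finally have "z \<subseteq> H" .
      moreover have "?p \<subseteq> y" by simp
      then have "y = ?c \<or> y = z" using z(3,4) b(2) by (metis UnE)
      ultimately show False using nH cH by metis
    qed
    show False using C[OF c cH] key[OF bal] key[OF bal'] y unfolding C_def by blast
  qed
  then have "Y \<union> Z = {y. gen y \<and> y \<subseteq> H}" using C balanced_gen[OF bal] by (auto simp: C_def)
  then show ?thesis using H g by blast
qed


lemma maximum_pair_structure:
  assumes d: "d \<ge> 1" and max: "max_cross_EKR {S. sing S} Y Z"
  shows "Y = Z \<or> even d \<and> (\<exists>G. hyperbolic_section d {S. sing S} G \<and> Y \<union> Z = generators G)"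
proof (cases "Y = Z")
  case False
  have YZ: "cross Y Z" using max by (simp add: max_cross_EKR_def cross_EKR_iff)
  obtain p where p: "sing p" "vec.dim p = 1" using sing_of_dim[OF d] by auto
  let ?X = "{y. gen y \<and> p \<subseteq> y}"
  have "card ?X * card ?X \<le> card Y * card Z"
    using max cross_pencil[OF p] by (simp add: max_cross_EKR_def cross_EKR_iff)
  then have c: "card Y = gens_above 1" "card Z = gens_above 1"
    using max_cross_cards[OF d YZ] card_gens_above[OF p(1)] p(2) by auto
  have ev: "even d" using max_cross_odd[OF _ YZ c] False by blast
  have bal: "balanced_pair Y Z" unfolding balanced_pair_def
    using YZ c max_cross_even_balanced[OF ev d YZ c] max_cross_even_nbrs[OF ev d YZ c]
    by (intro conjI allI impI) (simp_all add: cross_def)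
  obtain H g where H: "vec.subspace H" "vec.dim H = 2 * d" "nonsingular_on H Q"
    and g: "gen g" "g \<subseteq> H" and un: "Y \<union> Z = {y. gen y \<and> y \<subseteq> H}"
    using balanced_pair_hyperbolic[OF bal d False] by (elim exE conjE) (rule that)
  let ?G = "{S \<in> {S. sing S}. S \<subseteq> H}"
  have rank: "polar_rank ?G = d" unfolding polar_rank_def
  proof (rule Max_eqI)
    show "d \<in> vec.dim ` ?G" using g gen_sing gen_dim by (intro image_eqI[of _ _ g]) auto
  qed (auto simp: sing_dim_le)
  have "?G = totally_singular_subspaces H Q"
    by (auto simp: totally_singular_subspaces_def sing_def)
  then have "hyperbolic_quadric_in d H ?G"
    unfolding hyperbolic_quadric_in_def using H rank quad by blast
  then have "hyperbolic_section d {S. sing S} ?G"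
    unfolding hyperbolic_section_def using H card_index by (intro exI[of _ H]) simp
  moreover have "Y \<union> Z = generators ?G"
    unfolding generators_def rank un by (auto simp: gen_def)
  ultimately show ?thesis using ev by blast
qed simp

end

lemma parabolic_quadric_maximum_pair:
  assumes "d \<ge> 1" "parabolic_quadric d P" "max_cross_EKR P Y Z"
  shows "Y = Z \<or> even d \<and> (\<exists>G. hyperbolic_section d P G \<and> Y \<union> Z = generators G)"
proof -
  obtain Q where Q: "quadratic_form Q" "nonsingular_on UNIV Q" "P = totally_singular_subspaces UNIV Q"
    and c: "CARD('b) = 2 * d + 1"
    using assms(2) by (auto simp: parabolic_quadric_def)
  interpret parabolic Q d using Q c by unfold_locales
  show ?thesis using maximum_pair_structure[OF assms(1)] assms(3) unfolding Q(3) totally_singular_eq by simp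
qed

section \<open>Symplectic spaces in characteristic 2\<close>

text \<open>
  In odd characteristic squaring is two-to-one on the nonzero elements.
\<close>

lemma char2_of_even_card:
  assumes "even CARD('a::{field,finite})"
  shows "(2::'a) = 0"
proof (rule ccontr)
  assume two: "(2::'a) \<noteq> 0"
  define s where "s = (\<lambda>x::'a. x\<^sup>2) ` (UNIV - {0})"
  have "card {x \<in> UNIV - {0}. x\<^sup>2 = z} = 2" if z: "z \<in> s" for z
  proof -
    obtain x0 where x0: "x0 \<noteq> 0" "z = x0\<^sup>2" using z by (auto simp: s_def)
    have "{x \<in> UNIV - {0}. x\<^sup>2 = z} = {x0, - x0}" using x0 by (auto simp: power2_eq_iff)
    moreover have "x0 \<noteq> - x0"
    proof
      assume "x0 = - x0"
      then have "x0 + x0 = 0" by (simp only: eq_neg_iff_add_eq_0)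
      then have "2 * x0 = 0" by (simp only: mult_2)
      then show False using two x0 by simp
    qed
    ultimately show ?thesis by simp
  qed
  then have "card (UNIV - {0::'a}) = (\<Sum>z\<in>s. 2)"
    using sum.group[of "UNIV - {0::'a}" s "\<lambda>x. x\<^sup>2" "\<lambda>_. 1::nat"] by (simp add: s_def)
  then have "even (card (UNIV - {0::'a}))" by simp
  moreover have "card (UNIV - {0::'a}) = CARD('a) - 1" by (simp add: card_Diff_singleton)
  ultimately show False using assms card_field_gt_1[where 'a='a] by simp
qed

lemma bilinear_formI:
  fixes B :: "'a::field^'n \<Rightarrow> 'a^'n \<Rightarrow> 'a"
  assumes "\<And>u v w. B (u + v) w = B u w + B v w" "\<And>u v w. B w (u + v) = B w u + B w v"
    and "\<And>c v w. B (c *s v) w = c * B v w" "\<And>c v w. B w (c *s v) = c * B w v"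
  shows "bilinear_form B"
  unfolding bilinear_form_def Vector_Spaces.linear_iff
  by (intro conjI allI assms vec.vector_space_axioms vector_space_over_itself.vector_space_axioms)

lemma bilinear_form_coordinates:
  fixes B :: "'a::field^'n \<Rightarrow> 'a^'n \<Rightarrow> 'a"
  assumes B: "bilinear_form B"
  shows "B u w = (\<Sum>i\<in>UNIV. \<Sum>j\<in>UNIV. B (axis i 1) (axis j 1) * u $ i * w $ j)"
proof -
  have suml: "B (\<Sum>i\<in>A. g i) v = (\<Sum>i\<in>A. B (g i) v)" if "finite A" for A and g :: "'n \<Rightarrow> _" and v
    using that by (induction rule: finite_induct) (simp_all add: bilinear_formD[OF B])
  have sumr: "B v (\<Sum>i\<in>A. g i) = (\<Sum>i\<in>A. B v (g i))" if "finite A" for A and g :: "'n \<Rightarrow> _" and v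
    using that by (induction rule: finite_induct) (simp_all add: bilinear_formD[OF B])
  have "B u w = B (\<Sum>i\<in>UNIV. (u $ i) *s axis i 1) (\<Sum>j\<in>UNIV. (w $ j) *s axis j 1)"
    by (simp only: basis_expansion)
  also have "\<dots> = (\<Sum>i\<in>UNIV. B ((u $ i) *s axis i 1) (\<Sum>j\<in>UNIV. (w $ j) *s axis j 1))"
    by (rule suml) simp
  also have "\<dots> = (\<Sum>i\<in>UNIV. \<Sum>j\<in>UNIV. B ((u $ i) *s axis i 1) ((w $ j) *s axis j 1))"
    by (intro sum.cong refl sumr) simp
  finally show ?thesis by (simp add: bilinear_formD(3,4)[OF B] mult_ac)
qed

text \<open>
  The strictly upper triangular part of the matrix of \<open>B\<close> in an arbitrary ordering of the
  coordinates.
\<close>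

lemma alternating_form_refined:
  fixes B :: "'a::field^'n \<Rightarrow> 'a^'n \<Rightarrow> 'a"
  assumes B: "bilinear_form B" and alt: "\<And>v. B v v = 0"
  shows "\<exists>b. bilinear_form b \<and> (\<forall>u w. B u w = b u w - b w u)"
proof -
  obtain idx :: "'n \<Rightarrow> nat" where idx: "inj idx"
    using finite_imp_inj_to_nat_seg[of "UNIV :: 'n set"] by auto
  define e where "e i j = B (axis i 1) (axis j 1)" for i j
  define b where "b u w = (\<Sum>i\<in>UNIV. \<Sum>j\<in>UNIV. (if idx i < idx j then e i j else 0) * u $ i * w $ j)"
    for u w :: "'a^'n"
  have "bilinear_form b"
    by (rule bilinear_formI)
      (simp_all add: b_def sum.distrib[symmetric] sum_distrib_left algebra_simps)
  moreover have "B u w = b u w - b w u" for u w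
  proof -
    have skew: "e j i = - e i j" for i j
      using alt[of "axis i 1 + axis j 1"] alt[of "axis i 1"] alt[of "axis j 1"]
      by (simp add: e_def bilinear_formD[OF B] eq_neg_iff_add_eq_0 add.commute)
    have "b w u = (\<Sum>j\<in>UNIV. \<Sum>i\<in>UNIV. (if idx i < idx j then e i j else 0) * w $ i * u $ j)"
      unfolding b_def by (rule sum.swap)
    also have "\<dots> = (\<Sum>i\<in>UNIV. \<Sum>j\<in>UNIV. (if idx j < idx i then - e i j else 0) * u $ i * w $ j)"
    proof (intro sum.cong refl)
      fix i j
      show "(if idx j < idx i then e j i else 0) * w $ j * u $ i =
          (if idx j < idx i then - e i j else 0) * u $ i * w $ j"
        unfolding skew[of j i] by simp
    qed
    finally have "b u w - b w u = (\<Sum>i\<in>UNIV. \<Sum>j\<in>UNIV.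
        (if idx i < idx j then e i j else 0) * u $ i * w $ j -
        (if idx j < idx i then - e i j else 0) * u $ i * w $ j)"
      by (simp add: b_def sum_subtractf)
    also have "\<dots> = (\<Sum>i\<in>UNIV. \<Sum>j\<in>UNIV. e i j * u $ i * w $ j)"
    proof (intro sum.cong refl)
      fix i j
      have "i = j" if "\<not> idx i < idx j" "\<not> idx j < idx i" using that idx by (simp add: inj_eq)
      moreover have "e i i = 0" by (simp add: e_def alt)
      ultimately show "(if idx i < idx j then e i j else 0) * u $ i * w $ j -
        (if idx j < idx i then - e i j else 0) * u $ i * w $ j = e i j * u $ i * w $ j"
        by (cases "idx i < idx j"; cases "idx j < idx i") auto
    qed
    also have "\<dots> = B u w" unfolding e_def by (rule bilinear_form_coordinates[OF B, symmetric])
    finally show ?thesis by simp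
  qed
  ultimately show ?thesis by blast
qed

text \<open>
  The projection from the nucleus, which is spanned by the coordinate vector of \<open>None\<close>.
\<close>

definition drop_None :: "'a^('n::finite option) \<Rightarrow> 'a^'n" where
  "drop_None v = (\<chi> i. v $ Some i)"

lemma drop_None_linear:
  "drop_None (u + v) = drop_None u + drop_None v" "drop_None (c *s v) = c *s drop_None v"
  "drop_None (u - v) = drop_None u - drop_None v" "drop_None 0 = 0"
  for u v :: "'a::field^('n::finite option)"
  by (simp_all add: drop_None_def vec_eq_iff)

lemma linear_drop_None: "Vector_Spaces.linear (*s) (*s) (drop_None :: 'a::field^('n::finite option) \<Rightarrow> 'a^'n)"
  unfolding Vector_Spaces.linear_iff
  by (intro conjI allI vec.vector_space_axioms drop_None_linear)

lemma vec_option_eq_iff: "u = v \<longleftrightarrow> u $ None = v $ None \<and> drop_None u = drop_None v"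
  for u v :: "'a::field^('n::finite option)"
  by (auto simp: vec_eq_iff drop_None_def split_option_all)

text \<open>
  A quadratic form of \<open>Q(2d,q)\<close>. In characteristic 2 the square of the coordinate of \<open>None\<close> does not
  contribute to the polar form, which is therefore the pullback of the alternating form
  \<open>b u w - b w u\<close>.
\<close>

definition nucleus_projection_form :: "('a::field^'n::finite \<Rightarrow> 'a^'n \<Rightarrow> 'a) \<Rightarrow> 'a^('n option) \<Rightarrow> 'a" where
  "nucleus_projection_form b v = (v $ None)\<^sup>2 + b (drop_None v) (drop_None v)"

text \<open>
  Above a vector \<open>u\<close> lies exactly one singular vector, since the equation \<open>t\<^sup>2 = - b u u\<close> has exactly one
  solution \<open>t\<close> in characteristic 2. The singular vectors above a totally isotropic subspace form a
  subspace, because the polar form is the pullback of the alternating form.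
\<close>

lemma symplectic_from_parabolic:
  fixes P :: "('a::{field,finite}^'n) set set"
  assumes ev: "even CARD('a)" and P: "symplectic_polar_space d P"
  shows "\<exists>P\<^sub>0 :: ('a^('n option)) set set. parabolic_quadric d P\<^sub>0 \<and> linear_polar_iso drop_None P\<^sub>0 P \<and>
    (\<forall>S\<in>P\<^sub>0. vec.subspace S \<and> inj_on drop_None S) \<and>
    (\<forall>S\<in>P\<^sub>0. \<forall>T\<in>P\<^sub>0. drop_None ` (S \<inter> T) = drop_None ` S \<inter> drop_None ` T)"
proof -
  obtain B :: "'a^'n \<Rightarrow> 'a^'n \<Rightarrow> 'a" where card: "CARD('n) = 2 * d" and B: "bilinear_form B"
    and alt: "\<And>v. B v v = 0" and nondeg: "\<And>v. (\<And>w. B v w = 0) \<Longrightarrow> v = 0"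
    and P: "P = totally_isotropic_subspaces B"
    using P by (auto simp: symplectic_polar_space_def)
  obtain b where b: "bilinear_form b" and Bb: "\<And>u w. B u w = b u w - b w u"
    using alternating_form_refined[OF B alt] by blast
  define Q where "Q = nucleus_projection_form b"
  let ?f = "drop_None :: 'a^('n option) \<Rightarrow> 'a^'n"
  have two: "(2::'a) = 0" using char2_of_even_card[OF ev] .
  have dbl: "x + x = 0" for x :: 'a using two by (simp flip: mult_2)
  have Qdef: "Q v = (v $ None)\<^sup>2 + b (?f v) (?f v)" for v by (simp add: Q_def nucleus_projection_form_def)
  have polar: "polar_form Q v w = B (?f v) (?f w)" for v w
  proof -
    have "polar_form Q v w = 2 * v $ None * w $ None + (b (?f v) (?f w) + b (?f w) (?f v))"
      by (simp add: polar_form_def Qdef drop_None_linear bilinear_formD[OF b] power2_sum algebra_simps)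
    also have "\<dots> = B (?f v) (?f w)"
      using dbl[of "b (?f w) (?f v)"] by (simp add: two Bb eq_diff_eq add.assoc)
    finally show ?thesis .
  qed
  have Qadd: "Q (v + w) = Q v + Q w + B (?f v) (?f w)" for v w
    unfolding polar[symmetric] by (simp add: polar_form_def)
  have quad: "quadratic_form Q"
    unfolding quadratic_form_def
  proof
    show "\<forall>c v. Q (c *s v) = c\<^sup>2 * Q v"
      by (simp add: Qdef drop_None_linear bilinear_formD[OF b] power2_eq_square algebra_simps)
    show "bilinear_form (polar_form Q)"
      by (rule bilinear_formI) (simp_all add: polar drop_None_linear bilinear_formD[OF B])
  qed
  have surj: "\<exists>v. ?f v = u \<and> v $ None = t" for u t
    by (rule exI[of _ "\<chi> k. case k of None \<Rightarrow> t | Some i \<Rightarrow> u $ i"]) (simp add: drop_None_def vec_eq_iff)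
  have nonsing: "nonsingular_on UNIV Q" unfolding nonsingular_on_def
  proof (intro ballI impI)
    fix v assume v: "Q v = 0 \<and> (\<forall>w\<in>UNIV. polar_form Q v w = 0)"
    have "?f v = 0"
    proof (rule nondeg)
      fix w obtain w' where "?f w' = w" using surj by blast
      then show "B (?f v) w = 0" using v polar by auto
    qed
    then have "v $ None = 0" using v by (simp add: Qdef bilinear_formD[OF b])
    then show "v = 0" using \<open>?f v = 0\<close> by (simp add: vec_option_eq_iff drop_None_linear)
  qed
  let ?P = "totally_singular_subspaces UNIV Q"
  have para: "parabolic_quadric d ?P"
    unfolding parabolic_quadric_def using card quad nonsing by auto
  have inj: "v = w" if "Q v = 0" "Q w = 0" "?f v = ?f w" for v w
  proof -
    have "(v $ None)\<^sup>2 = (w $ None)\<^sup>2" using that by (simp add: Qdef add_eq_0_iff2)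
    moreover have "- x = x" for x :: 'a using dbl[of x] by (simp add: minus_unique)
    ultimately have "v $ None = w $ None" by (metis power2_eq_iff)
    then show ?thesis using that by (simp add: vec_option_eq_iff)
  qed
  have sing: "vec.subspace S" "v \<in> S \<Longrightarrow> Q v = 0" if "S \<in> ?P" for S v
    using that by (auto simp: totally_singular_subspaces_def)
  have inter: "?f ` (S \<inter> T) = ?f ` S \<inter> ?f ` T" if "S \<in> ?P" "T \<in> ?P" for S T
  proof
    show "?f ` S \<inter> ?f ` T \<subseteq> ?f ` (S \<inter> T)"
    proof
      fix u assume "u \<in> ?f ` S \<inter> ?f ` T"
      then obtain v w where vw: "v \<in> S" "w \<in> T" "u = ?f v" "u = ?f w" by auto
      then have "v = w" using inj sing that by metis
      then show "u \<in> ?f ` (S \<inter> T)" using vw by auto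
    qed
  qed auto
  have injS: "inj_on ?f S" if "S \<in> ?P" for S
    using inj sing that by (metis inj_onI)
  have sub_iff: "S \<subseteq> T \<longleftrightarrow> ?f ` S \<subseteq> ?f ` T" if "S \<in> ?P" "T \<in> ?P" for S T
  proof
    assume fs: "?f ` S \<subseteq> ?f ` T"
    show "S \<subseteq> T"
    proof
      fix v assume v: "v \<in> S"
      then obtain w where w: "w \<in> T" "?f v = ?f w" using fs by blast
      then have "v = w" using inj v sing that by metis
      then show "v \<in> T" using w by simp
    qed
  qed auto
  have "bij_betw ((`) ?f) ?P P"
  proof (rule bij_betw_imageI)
    show "inj_on ((`) ?f) ?P" by (rule inj_onI) (metis sub_iff subset_antisym order_refl)
    show "((`) ?f) ` ?P = P"
    proof
      show "((`) ?f) ` ?P \<subseteq> P"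
      proof clarify
        fix S assume S: "S \<in> ?P"
        have "B (?f v) (?f w) = 0" if "v \<in> S" "w \<in> S" for v w
          using Qadd[of v w] sing(2)[OF S] vec.subspace_add[OF sing(1)[OF S] that] that by simp
        moreover have "vec.subspace (?f ` S)"
        proof (rule vec.subspaceI)
          show "0 \<in> ?f ` S" using vec.subspace_0[OF sing(1)[OF S]] by (intro image_eqI[of _ _ 0]) (simp add: drop_None_linear)
          show "x + y \<in> ?f ` S" if "x \<in> ?f ` S" "y \<in> ?f ` S" for x y
            using that vec.subspace_add[OF sing(1)[OF S]] by (auto simp flip: drop_None_linear(1))
          show "c *s x \<in> ?f ` S" if "x \<in> ?f ` S" for c x
            using that vec.subspace_scale[OF sing(1)[OF S]] by (auto simp flip: drop_None_linear(2))
        qed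
        ultimately show "?f ` S \<in> P" by (auto simp: P totally_isotropic_subspaces_def)
      qed
      show "P \<subseteq> ((`) ?f) ` ?P"
      proof
        fix T assume "T \<in> P"
        then have T: "vec.subspace T" "\<And>u w. u \<in> T \<Longrightarrow> w \<in> T \<Longrightarrow> B u w = 0"
          by (auto simp: P totally_isotropic_subspaces_def)
        let ?S = "{v. ?f v \<in> T \<and> Q v = 0}"
        have "vec.subspace ?S"
          using T vec.subspace_0[OF T(1)] vec.subspace_add[OF T(1)] vec.subspace_scale[OF T(1)]
          by (intro vec.subspaceI) (auto simp: drop_None_linear Qadd quadratic_formD(1,3)[OF quad])
        then have "?S \<in> ?P" by (auto simp: totally_singular_subspaces_def)
        moreover have "T \<subseteq> ?f ` ?S"
        proof
          fix u assume u: "u \<in> T"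
          obtain t where t: "t\<^sup>2 = - b u u" using square_surj_char2[OF two] by blast
          obtain v where "?f v = u" "v $ None = t" using surj by blast
          then show "u \<in> ?f ` ?S" using u t by (intro image_eqI[of _ _ v]) (auto simp: Qdef)
        qed
        then have "T = ?f ` ?S" by auto
        ultimately show "T \<in> ((`) ?f) ` ?P" by blast
      qed
    qed
  qed
  then have "linear_polar_iso ?f ?P P"
    unfolding linear_polar_iso_def using linear_drop_None sub_iff by blast
  then show ?thesis using para sing(1) injS inter by blast
qed

section \<open>Maximum cross-intersecting pairs\<close>

lemma dim_injective_image:
  fixes f :: "'a::{field,finite}^'m \<Rightarrow> 'a^'n"
  assumes "vec.subspace S" "vec.subspace (f ` S)" "inj_on f S"
  shows "vec.dim (f ` S) = vec.dim S"
  using dim_eq_iff_card[OF assms(2)] card_subspace[OF assms(1)] card_image[OF assms(3)] by simp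

theorem theorem5p14:
  fixes P Y Z :: "('a::{field,finite}^'n) set set" and d :: nat
  assumes "d \<ge> 1"
    and "parabolic_quadric d P \<or> even CARD('a) \<and> symplectic_polar_space d P"
    and "max_cross_EKR P Y Z"
  shows "Y = Z \<and> EKR_set P Y \<or>
         even d \<and> (\<exists>G. hyperbolic_subgeometry d P G \<and> Y \<union> Z = generators G)"
proof -
  have EKR: "EKR_set P Y" if "Y = Z"
    using assms(3) that by (simp add: max_cross_EKR_def cross_EKR_def EKR_set_def)
  show ?thesis
  proof (cases "parabolic_quadric d P")
    case True
    then show ?thesis using parabolic_quadric_maximum_pair[OF assms(1) True assms(3)] EKR
      unfolding hyperbolic_subgeometry_def by blast
  next
    case False
    then have W: "even CARD('a)" "symplectic_polar_space d P" using assms(2) by auto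
    let ?f = "drop_None :: 'a^('n option) \<Rightarrow> 'a^'n"
    obtain P\<^sub>0 where P0: "parabolic_quadric d P\<^sub>0 \<and> linear_polar_iso ?f P\<^sub>0 P \<and>
        (\<forall>S\<in>P\<^sub>0. vec.subspace S \<and> inj_on ?f S) \<and>
        (\<forall>S\<in>P\<^sub>0. \<forall>T\<in>P\<^sub>0. ?f ` (S \<inter> T) = ?f ` S \<inter> ?f ` T)"
      using symplectic_from_parabolic[OF W] by (rule exE)
    then have para: "parabolic_quadric d P\<^sub>0" and iso: "linear_polar_iso ?f P\<^sub>0 P"
      and inj: "\<And>S. S \<in> P\<^sub>0 \<Longrightarrow> vec.subspace S" "\<And>S. S \<in> P\<^sub>0 \<Longrightarrow> inj_on ?f S"
      and inter: "\<And>S T. S \<in> P\<^sub>0 \<Longrightarrow> T \<in> P\<^sub>0 \<Longrightarrow> ?f ` (S \<inter> T) = ?f ` S \<inter> ?f ` T"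
      by (simp_all del: image_Int)
    let ?F = "(`) ?f"
    have bij: "inj_on ?F P\<^sub>0" "?F ` P\<^sub>0 = P"
      using iso by (auto simp: linear_polar_iso_def bij_betw_def)
    have subP: "vec.subspace T" if "T \<in> P" for T
      using W(2) that by (auto simp: symplectic_polar_space_def totally_isotropic_subspaces_def)
    have dimF: "vec.dim (?f ` S) = vec.dim S" if "S \<in> P\<^sub>0" for S
      using inj[OF that] subP bij(2) that by (intro dim_injective_image) auto
    have dimI: "vec.dim (?f ` S \<inter> ?f ` T) = vec.dim (S \<inter> T)" if "S \<in> P\<^sub>0" "T \<in> P\<^sub>0" for S T
      unfolding inter[OF that, symmetric]
    proof (rule dim_injective_image)
      show "vec.subspace (S \<inter> T)" using inj(1) that by (simp add: vec.subspace_inter)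
      have "?f ` S \<in> P" "?f ` T \<in> P" using that bij(2) by auto
      then show "vec.subspace (?f ` (S \<inter> T))" unfolding inter[OF that] by (simp add: subP vec.subspace_inter)
      show "inj_on ?f (S \<inter> T)" using inj(2)[OF that(1)] by (rule inj_on_subset) auto
    qed
    have rank: "polar_rank (?F ` R) = polar_rank R" and gens: "generators (?F ` R) = ?F ` generators R"
      if "R \<subseteq> P\<^sub>0" for R
    proof -
      have "vec.dim ` ?F ` R = vec.dim ` R" using dimF that by (force simp: image_image)
      then show rank: "polar_rank (?F ` R) = polar_rank R" by (simp add: polar_rank_def)
      show "generators (?F ` R) = ?F ` generators R"
        using dimF that unfolding generators_def rank by auto
    qed
    have gensP: "generators P = ?F ` generators P\<^sub>0" using gens[of P\<^sub>0] bij(2) by simp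
    have gen0: "generators P\<^sub>0 \<subseteq> P\<^sub>0" by (auto simp: generators_def)
    have cross: "cross_EKR P (?F ` A) (?F ` C) \<longleftrightarrow> cross_EKR P\<^sub>0 A C" if "A \<subseteq> P\<^sub>0" "C \<subseteq> P\<^sub>0" for A C
    proof -
      have "?F ` A \<subseteq> ?F ` generators P\<^sub>0 \<longleftrightarrow> A \<subseteq> generators P\<^sub>0" if "A \<subseteq> P\<^sub>0" for A
        using inj_on_image_subset_iff[OF bij(1) that gen0] .
      moreover have "(\<forall>y\<in>A. \<forall>z\<in>C. 1 \<le> vec.dim (?f ` y \<inter> ?f ` z)) \<longleftrightarrow>
          (\<forall>y\<in>A. \<forall>z\<in>C. 1 \<le> vec.dim (y \<inter> z))"
        using dimI that by (intro ball_cong refl) (metis subsetD)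
      ultimately show ?thesis unfolding cross_EKR_def gensP using that by simp
    qed
    have cardF: "card (?F ` A) = card A" if "A \<subseteq> P\<^sub>0" for A
      using bij(1) that by (meson card_image inj_on_subset)
    define Y\<^sub>0 Z\<^sub>0 where "Y\<^sub>0 = {S\<in>P\<^sub>0. ?f ` S \<in> Y}" and "Z\<^sub>0 = {S\<in>P\<^sub>0. ?f ` S \<in> Z}"
    have sub0: "Y\<^sub>0 \<subseteq> P\<^sub>0" "Z\<^sub>0 \<subseteq> P\<^sub>0" by (auto simp: Y\<^sub>0_def Z\<^sub>0_def)
    have "Y \<subseteq> P" "Z \<subseteq> P" using assms(3) by (auto simp: max_cross_EKR_def cross_EKR_def generators_def)
    then have YZ: "Y = ?F ` Y\<^sub>0" "Z = ?F ` Z\<^sub>0" using bij(2) by (auto simp: Y\<^sub>0_def Z\<^sub>0_def)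
    have "max_cross_EKR P\<^sub>0 Y\<^sub>0 Z\<^sub>0" unfolding max_cross_EKR_def
    proof (intro conjI allI impI)
      show "cross_EKR P\<^sub>0 Y\<^sub>0 Z\<^sub>0" using assms(3) cross[OF sub0] YZ by (simp add: max_cross_EKR_def)
      fix A C assume AC: "cross_EKR P\<^sub>0 A C"
      then have s: "A \<subseteq> P\<^sub>0" "C \<subseteq> P\<^sub>0" using gen0 by (auto simp: cross_EKR_def)
      then have "card (?F ` A) * card (?F ` C) \<le> card Y * card Z"
        using assms(3) cross AC by (simp add: max_cross_EKR_def)
      then show "card A * card C \<le> card Y\<^sub>0 * card Z\<^sub>0" using cardF s sub0 YZ by simp
    qed
    from parabolic_quadric_maximum_pair[OF assms(1) para this] show ?thesis
    proof (elim disjE conjE exE)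
      assume "Y\<^sub>0 = Z\<^sub>0"
      then show ?thesis using YZ EKR by simp
    next
      fix G assume "even d" and G: "hyperbolic_section d P\<^sub>0 G" "Y\<^sub>0 \<union> Z\<^sub>0 = generators G"
      have "G \<subseteq> P\<^sub>0" using G(1) by (auto simp: hyperbolic_section_def)
      then have "Y \<union> Z = generators (?F ` G)" using gens G(2) YZ by (simp add: image_Un[symmetric])
      moreover have "hyperbolic_subgeometry d P (?F ` G)"
        unfolding hyperbolic_subgeometry_def using W para iso G(1) by blast
      ultimately show ?thesis using \<open>even d\<close> by blast
    qed
  qed
qed

end
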